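(* Let the symmetric group $\mathcal{S}_n$ act on real projective space $\mathbb{R}\mathbb{P}^{n-1}$ by permuting homogeneous coordinates. The $\mathcal{L}$-stratification on $\mathbb{R}\mathbb{P}^{n-1}$ induced by this action coincides with the rank $2$ truncation of the projectivized braid arrangement. In particular, the digitalization $Y_{\mathbb{R}\mathbb{P}^{n-1},\mathcal{L}}$ coincides with the maximal projective arrangement model for $\mathbb{P}\mathcal{A}_{n-1}$.
   Context: The $\mathcal{L}$-stratification: let a finite group $G$ act differentiably on a smooth manifold $X$. For $x\in X$ and $H\le\mathrm{stab}\,x=\{g\in G: gx=x\}$, the group $H$ acts linearly on $T_xX$. Let $L(x,H)\subseteq T_xX$ be the linear span of all lines (one-dimensional linear subspaces) $\ell\subseteq T_xX$ with $h\cdot\ell=\ell$ as a set for all $h\in H$, let $F(x,H)\le H$ be the subgroup of elements fixing $L(x,H)$ pointwise, and let $\mathcal{L}(x,H)$ be the connected component containing $x$ of the fixed point set of $F(x,H)$ acting on $X$. The $\mathcal{L}$-stratification of $X$ is the family $\mathcal{L}=\{\mathcal{L}(x,H)\}_{x\in X,\ H\le\mathrm{stab}\,x}$. Here the whole manifold $X$ (arising for instance from trivial $H$) is regarded as the ambient space and not counted as a member of the arrangement. Locally, $\mathcal{L}$ is diffeomorphic to an arrangement of linear subspaces. The maximal wonderful model $Y_{X,\mathcal{L}}$ is the result of successive (real) blowups of all strata (members of $\mathcal{L}$ and their non-empty intersections, other than $X$), respectively of their proper transforms, according to a linear order on strata that is non-decreasing in dimension; the $G$-action lifts to it. When $G$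 acts effectively, it is a digitalization of the action, meaning that all its point stabilizers are elementary abelian $2$-groups. The braid arrangement is $\mathcal{A}_{n-1}=\{H_{ij}:1\le i<j\le n\}$ with $H_{ij}=\{x\in\mathbb{R}^n: x_i=x_j\}$. For a set partition $\pi$ of $\{1,\ldots,n\}$, the braid space $U_\pi$ is the intersection of all $H_{ij}$ with $i,j$ in the same block of $\pi$, and $\mathbb{P}U_\pi\subseteq\mathbb{R}\mathbb{P}^{n-1}$ is its projectivization. The projectivized braid arrangement $\mathbb{P}\mathcal{A}_{n-1}$ is formed by the projectivizations $\mathbb{P}H_{ij}$; its rank $2$ truncation is obtained by omitting the hyperplanes, i.e. it consists of the $\mathbb{P}U_\pi$ with $U_\pi$ of codimension at least $2$ in $\mathbb{R}^n$. The maximal projective arrangement model for $\mathbb{P}\mathcal{A}_{n-1}$ is the projective analogue of the maximal De Concini–Procesi wonderful model: it is obtained from $\mathbb{R}\mathbb{P}^{n-1}$ by successively blowing up all $\mathbb{P}U_\pi\ne\mathbb{R}\mathbb{P}^{n-1}$, respectively their proper transforms, in an order non-decreasing in dimension.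
   Formalization: "Coincides" is taken for strata (members of L and their non-empty intersections, other than the whole space): as a family, L omits some PU_π of codimension at least 2, e.g. π = 12|345 for n = 5, which are only intersections of members. *)

theory Defs
  imports
    "HOL-Analysis.Analysis"
    "HOL-Algebra.Group_Action"
    "HOL-Library.Disjoint_Sets"
begin

section \<open>Smooth maps between subsets of Euclidean spaces\<close>

text \<open>Manifolds are embedded submanifolds of Euclidean spaces, which is no restriction
  by Whitney's theorem.\<close>

text \<open>\<open>Ck_on k U f\<close> is meant for open \<open>U\<close>: all iterated directional derivatives up to
  order \<open>k\<close> exist and are continuous.\<close>

primrec Ck_on ::
    "nat \<Rightarrow> 'a::euclidean_space set \<Rightarrow> ('a \<Rightarrow> 'b::euclidean_space) \<Rightarrow> bool" where
  "Ck_on 0 U f \<longleftrightarrow> continuous_on U f"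
| "Ck_on (Suc k) U f \<longleftrightarrow>
     f differentiable_on U \<and> (\<forall>v. Ck_on k U (\<lambda>x. frechet_derivative f (at x) v))"

definition smooth_map ::
    "'a::euclidean_space set \<Rightarrow> 'b::euclidean_space set \<Rightarrow> ('a \<Rightarrow> 'b) \<Rightarrow> bool" where
  "smooth_map A B f \<longleftrightarrow> f ` A \<subseteq> B \<and>
     (\<forall>a\<in>A. \<exists>U F. open U \<and> a \<in> U \<and> (\<forall>k. Ck_on k U F) \<and> (\<forall>x\<in>A \<inter> U. F x = f x))"

definition diffeo ::
    "'a::euclidean_space set \<Rightarrow> 'b::euclidean_space set \<Rightarrow> ('a \<Rightarrow> 'b) \<Rightarrow> bool" where
  "diffeo A B f \<longleftrightarrow> bij_betw f A B \<and> smooth_map A B f \<and> smooth_map B A (inv_into A f)"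

definition tangent_space :: "'a::euclidean_space set \<Rightarrow> 'a \<Rightarrow> 'a set" where
  "tangent_space X x =
     {v. \<exists>\<gamma>. range \<gamma> \<subseteq> X \<and> \<gamma> 0 = x \<and> (\<gamma> has_vector_derivative v) (at (0::real))}"

text \<open>The differential of \<open>f\<close> at \<open>x\<close>, given by transporting velocities of curves in \<open>X\<close>;
  only its values on \<open>tangent_space X x\<close> are meaningful.\<close>

definition tangent_map ::
    "'a::euclidean_space set \<Rightarrow> ('a \<Rightarrow> 'b::euclidean_space) \<Rightarrow> 'a \<Rightarrow> 'a \<Rightarrow> 'b" where
  "tangent_map X f x v =
     (THE w. \<forall>\<gamma>. range \<gamma> \<subseteq> X \<and> \<gamma> 0 = x \<and> (\<gamma> has_vector_derivative v) (at (0::real))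
        \<longrightarrow> ((f \<circ> \<gamma>) has_vector_derivative w) (at 0))"

text \<open>The dimension of a non-empty submanifold (the largest one, if it is not pure).\<close>

definition mdim :: "'a::euclidean_space set \<Rightarrow> nat" where
  "mdim S = (SUP x\<in>S. dim (tangent_space S x))"


section \<open>The \<open>\<L>\<close>-stratification of a group action\<close>

context
  fixes G :: "('g, 'm) monoid_scheme"
    and \<phi> :: "'g \<Rightarrow> 'a::euclidean_space \<Rightarrow> 'a"
    and X :: "'a set"
begin

definition invariant_lines :: "'a \<Rightarrow> 'g set \<Rightarrow> 'a set set" where
  "invariant_lines x H =
     {l. subspace l \<and> dim l = 1 \<and> l \<subseteq> tangent_space X x \<and>
         (\<forall>h\<in>H. tangent_map X (\<phi> h) x ` l = l)}"

definition L_space :: "'a \<Rightarrow> 'g set \<Rightarrow> 'a set" where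
  "L_space x H = span (\<Union>(invariant_lines x H))"

definition F_subgroup :: "'a \<Rightarrow> 'g set \<Rightarrow> 'g set" where
  "F_subgroup x H = {h\<in>H. \<forall>v\<in>L_space x H. tangent_map X (\<phi> h) x v = v}"

definition L_stratum :: "'a \<Rightarrow> 'g set \<Rightarrow> 'a set" where
  "L_stratum x H = connected_component_set {y\<in>X. \<forall>g\<in>F_subgroup x H. \<phi> g y = y} x"

definition L_stratification :: "'a set set" where
  "L_stratification =
     {L_stratum x H | x H. x \<in> X \<and> subgroup H G \<and> H \<subseteq> stabilizer G \<phi> x} - {X}"

end

definition strata :: "'a set \<Rightarrow> 'a set set \<Rightarrow> 'a set set" where
  "strata X \<A> = {\<Inter>\<S> | \<S>. \<S> \<subseteq> \<A> \<and> \<S> \<noteq> {} \<and> \<Inter>\<S> \<noteq> {}} - {X}"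


section \<open>Projective spaces\<close>

text \<open>The point of projective space with homogeneous coordinates \<open>v \<noteq> 0\<close> is encoded by the
  matrix of the orthogonal projection onto the line spanned by \<open>v\<close>.\<close>

definition proj_point :: "real^'n \<Rightarrow> real^'n^'n" where
  "proj_point v = (\<chi> i j. v $ i * v $ j / (v \<bullet> v))"

definition projectivization :: "(real^'n) set \<Rightarrow> (real^'n^'n) set" where
  "projectivization V = {proj_point v | v. v \<in> V \<and> v \<noteq> 0}"

lemma proj_point_mult: "proj_point v *v w = ((v \<bullet> w) / (v \<bullet> v)) *\<^sub>R v"
  by (simp add: vec_eq_iff matrix_vector_mult_def proj_point_def inner_vec_def
      sum_distrib_left sum_divide_distrib sum_distrib_right algebra_simps)

lemma proj_point_eq_iff:
  assumes "v \<noteq> 0" "w \<noteq> 0"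
  shows "proj_point v = proj_point w \<longleftrightarrow> (\<exists>c. c \<noteq> 0 \<and> w = c *\<^sub>R v)"
proof
  assume "proj_point v = proj_point w"
  then have "proj_point v *v w = proj_point w *v w" by simp
  then have "w = ((v \<bullet> w) / (v \<bullet> v)) *\<^sub>R v"
    using assms by (simp add: proj_point_mult)
  then show "\<exists>c. c \<noteq> 0 \<and> w = c *\<^sub>R v"
    using assms by (metis scaleR_zero_left)
next
  assume "\<exists>c. c \<noteq> 0 \<and> w = c *\<^sub>R v"
  then obtain c where "c \<noteq> 0" "w = c *\<^sub>R v" by blast
  then show "proj_point v = proj_point w"
    by (simp add: proj_point_def)
qed

abbreviation RP :: "(real^'n^'n) set" where
  "RP \<equiv> projectivization UNIV"

abbreviation Sym :: "('n \<Rightarrow> 'n) monoid" where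
  "Sym \<equiv> BijGroup UNIV"

definition RP_action :: "('n \<Rightarrow> 'n) \<Rightarrow> real^'n^'n \<Rightarrow> real^'n^'n" where
  "RP_action \<sigma> = restrict (\<lambda>A. \<chi> i j. A $ (inv_into UNIV \<sigma> i) $ (inv_into UNIV \<sigma> j)) RP"

lemma RP_action_proj_point:
  fixes v :: "real^'n"
  assumes "bij \<sigma>" "v \<noteq> 0"
  shows "RP_action \<sigma> (proj_point v) = proj_point (\<chi> i. v $ (inv_into UNIV \<sigma> i))"
proof -
  have "bij (inv_into UNIV \<sigma>)" using assms(1) by (rule bij_imp_bij_inv)
  then have "(\<Sum>i\<in>UNIV. v $ (inv_into UNIV \<sigma> i) * v $ (inv_into UNIV \<sigma> i)) = (\<Sum>i\<in>UNIV. v $ i * v $ i)"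
    using sum.reindex_bij_betw[of "inv_into UNIV \<sigma>" UNIV UNIV "\<lambda>i. v $ i * v $ i"] by simp
  moreover have "proj_point v \<in> RP"
    using assms(2) by (auto simp: projectivization_def)
  ultimately show ?thesis
    by (simp add: RP_action_def proj_point_def inner_vec_def)
qed

lemma RP_action_in:
  fixes A :: "real^'n^'n"
  assumes "bij \<sigma>" "A \<in> RP"
  shows "RP_action \<sigma> A \<in> RP"
proof -
  obtain v where v: "A = proj_point v" "v \<noteq> 0"
    using assms(2) by (auto simp: projectivization_def)
  have "(\<chi> i. v $ (inv_into UNIV \<sigma> i)) \<noteq> 0"
  proof
    assume "(\<chi> i. v $ (inv_into UNIV \<sigma> i)) = 0"
    then have "v $ (inv_into UNIV \<sigma> (\<sigma> i)) = 0" for i by (simp add: vec_eq_iff)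
    then show False using v(2) assms(1) by (simp add: vec_eq_iff bij_is_inj)
  qed
  then show ?thesis
    using RP_action_proj_point[OF assms(1) v(2)] v(1) by (auto simp: projectivization_def)
qed

lemma RP_action_comp:
  fixes A :: "real^'n^'n"
  assumes "bij \<sigma>" "bij \<tau>" "A \<in> RP"
  shows "RP_action (\<sigma> \<circ> \<tau>) A = RP_action \<sigma> (RP_action \<tau> A)"
  using assms RP_action_in[OF assms(2,3)]
  by (simp add: RP_action_def o_inv_distrib)

lemma RP_group_action: "group_action Sym (RP :: (real^'n^'n) set) RP_action"
proof -
  have inRP: "RP_action \<sigma> \<in> Bij (RP :: (real^'n^'n) set)" if s: "bij \<sigma>" for \<sigma> :: "'n \<Rightarrow> 'n"
  proof -
    have i: "bij (inv_into UNIV \<sigma>)" using s by (rule bij_imp_bij_inv)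
    have id: "RP_action id A = A" if "A \<in> RP" for A :: "real^'n^'n"
      using that by (simp add: RP_action_def inv_id vec_eq_iff)
    have "bij_betw (RP_action \<sigma>) (RP :: (real^'n^'n) set) RP"
    proof (rule bij_betw_byWitness[where f' = "RP_action (inv_into UNIV \<sigma>)"])
      show "\<forall>A\<in>RP. RP_action (inv_into UNIV \<sigma>) (RP_action \<sigma> A) = A"
        using RP_action_comp[OF i s] id s by (simp add: bij_is_inj)
      show "\<forall>A\<in>RP. RP_action \<sigma> (RP_action (inv_into UNIV \<sigma>) A) = A"
        using RP_action_comp[OF s i] id s
        by (metis bij_is_surj surj_iff)
    qed (use RP_action_in[OF s] RP_action_in[OF i] in auto)
    then show ?thesis by (auto simp: Bij_def RP_action_def)
  qed
  have mult: "RP_action (compose UNIV \<sigma> \<tau>) =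
      compose (RP :: (real^'n^'n) set) (RP_action \<sigma>) (RP_action \<tau>)"
    if "bij \<sigma>" "bij \<tau>" for \<sigma> \<tau> :: "'n \<Rightarrow> 'n"
  proof (rule extensionalityI[where A = RP])
    show "RP_action (compose UNIV \<sigma> \<tau>) \<in> extensional (RP :: (real^'n^'n) set)"
      by (simp add: RP_action_def)
    show "RP_action (compose UNIV \<sigma> \<tau>) A = compose RP (RP_action \<sigma>) (RP_action \<tau>) A"
      if "A \<in> RP" for A :: "real^'n^'n"
      using that RP_action_comp[OF \<open>bij \<sigma>\<close> \<open>bij \<tau>\<close> that] by (simp add: compose_def comp_def restrict_UNIV)
  qed (rule compose_extensional)
  have "RP_action \<in> hom Sym (BijGroup (RP :: (real^'n^'n) set))"
    using inRP mult by (auto simp: hom_def BijGroup_def Bij_def)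
  then show ?thesis
    by (auto simp: group_action_def group_hom_def group_hom_axioms_def group_BijGroup)
qed


section \<open>The projectivized braid arrangement\<close>

definition braid_hyperplane :: "'n \<Rightarrow> 'n \<Rightarrow> (real^'n) set" where
  "braid_hyperplane i j = {x. x $ i = x $ j}"

definition braid_space :: "'n set set \<Rightarrow> (real^'n) set" where
  "braid_space \<pi> = \<Inter>{braid_hyperplane i j | i j. i \<noteq> j \<and> (\<exists>b\<in>\<pi>. i \<in> b \<and> j \<in> b)}"

definition projective_braid_spaces :: "(real^'n^'n) set set" where
  "projective_braid_spaces = {projectivization (braid_space \<pi>) | \<pi>. partition_on UNIV \<pi>}"

definition rank2_truncation :: "(real^'n^'n) set set" where
  "rank2_truncation =
     {projectivization (braid_space \<pi>) | \<pi>.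
        partition_on UNIV \<pi> \<and> CARD('n) - dim (braid_space \<pi> :: (real^'n) set) \<ge> 2}"


section \<open>Real blowups and maximal wonderful models\<close>

text \<open>For linear subspaces \<open>S \<subseteq> T\<close>, the blowup of \<open>T\<close> along \<open>S\<close> consists of the pairs of a
  point \<open>w \<in> T\<close> and a line in \<open>T/S\<close> containing the class of \<open>w\<close>. The quotient \<open>T/S\<close> is
  identified with the orthogonal complement of \<open>S\<close> in \<open>T\<close>.\<close>

definition linear_blowup ::
    "(real^'m) set \<Rightarrow> (real^'m) set \<Rightarrow> ((real^'m) \<times> (real^'m^'m)) set" where
  "linear_blowup T S =
     {(w, proj_point u) | w u. w \<in> T \<and> u \<in> T \<and> u \<noteq> 0 \<and> (\<forall>s\<in>S. orthogonal u s) \<and>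
        (\<exists>c. w - c *\<^sub>R u \<in> S)}"

text \<open>\<open>\<beta>\<close> exhibits \<open>B\<close> as the real blowup of \<open>X\<close> along the closed submanifold \<open>Z\<close>: it is a
  diffeomorphism away from \<open>Z\<close>, and in charts of \<open>X\<close> in which \<open>Z\<close> is a linear subspace it
  is the linear blowup. This determines \<open>(B, \<beta>)\<close> up to unique diffeomorphism over \<open>X\<close>.\<close>

definition is_blowup ::
    "(real^'m) set \<Rightarrow> (real^'m) set \<Rightarrow> (real^'m) set \<Rightarrow> (real^'m \<Rightarrow> real^'m) \<Rightarrow> bool" where
  "is_blowup X Z B \<beta> \<longleftrightarrow>
     closedin (top_of_set X) Z \<and>
     smooth_map B X \<beta> \<and>
     diffeo (B - \<beta> -` Z) (X - Z) \<beta> \<and>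
     (\<forall>z\<in>Z. \<exists>V W T S (\<phi> :: real^'m \<Rightarrow> real^'m) \<psi>.
        openin (top_of_set X) V \<and> z \<in> V \<and>
        subspace T \<and> subspace S \<and> S \<subseteq> T \<and> openin (top_of_set T) W \<and>
        diffeo V W \<phi> \<and> \<phi> ` (V \<inter> Z) = W \<inter> S \<and>
        diffeo (B \<inter> \<beta> -` V) {q \<in> linear_blowup T S. fst q \<in> W} \<psi> \<and>
        (\<forall>y\<in>B \<inter> \<beta> -` V. fst (\<psi> y) = \<phi> (\<beta> y)))"

definition proper_transform ::
    "'a::euclidean_space set \<Rightarrow> 'a set \<Rightarrow> ('a \<Rightarrow> 'a) \<Rightarrow> 'a set \<Rightarrow> 'a set" where
  "proper_transform Z B \<beta> S = B \<inter> closure (B \<inter> \<beta> -` (S - Z))"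

inductive iterated_blowup ::
    "(real^'m) set \<Rightarrow> (real^'m) set list \<Rightarrow> (real^'m) set \<Rightarrow> (real^'m \<Rightarrow> real^'m) \<Rightarrow> bool" where
  Nil: "iterated_blowup X [] X id"
| Cons: "is_blowup X Z B \<beta> \<Longrightarrow>
     iterated_blowup B (map (proper_transform Z B \<beta>) Zs) Y b \<Longrightarrow>
     iterated_blowup X (Z # Zs) Y (\<beta> \<circ> b)"

text \<open>\<open>Y\<close> with blowdown map \<open>p\<close> to \<open>X\<close> is a maximal wonderful model for the family \<open>\<S>\<close> of
  strata. Since blowups need room, \<open>X\<close> is first replaced by a diffeomorphic copy in the Euclidean
  space containing \<open>Y\<close>; the models thus form a class closed under diffeomorphisms over \<open>X\<close>.\<close>

definition maximal_wonderful_model ::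
    "'a::euclidean_space set \<Rightarrow> 'a set set \<Rightarrow> (real^'m) set \<Rightarrow> (real^'m \<Rightarrow> 'a) \<Rightarrow> bool" where
  "maximal_wonderful_model X \<S> Y p \<longleftrightarrow>
     (\<exists>Zs X' \<iota> b.
        set Zs = \<S> \<and> distinct Zs \<and> sorted_wrt (\<lambda>S T. mdim S \<le> mdim T) Zs \<and>
        diffeo X' X \<iota> \<and>
        iterated_blowup X' (map (\<lambda>S. X' \<inter> \<iota> -` S) Zs) Y b \<and>
        (\<forall>y\<in>Y. p y = \<iota> (b y)))"

definition digitalization ::
    "('g, 'k) monoid_scheme \<Rightarrow> ('g \<Rightarrow> 'a \<Rightarrow> 'a) \<Rightarrow> 'a::euclidean_space set \<Rightarrow>
     (real^'m) set \<Rightarrow> (real^'m \<Rightarrow> 'a) \<Rightarrow> bool" where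
  "digitalization G \<phi> X Y p \<longleftrightarrow>
     maximal_wonderful_model X (strata X (L_stratification G \<phi> X)) Y p"

definition maximal_projective_braid_model ::
    "(real^'m) set \<Rightarrow> (real^'m \<Rightarrow> real^'n^'n) \<Rightarrow> bool" where
  "maximal_projective_braid_model Y p \<longleftrightarrow>
     maximal_wonderful_model RP (projective_braid_spaces - {RP}) Y p"

end

theory Submission
  imports Defs "HOL-Algebra.Generated_Groups"
begin

text \<open>At a point \<open>[v]\<close> with stabilizing subgroup \<open>H\<close>, the group \<open>F\<close> consists of the elements of \<open>H\<close> that fix all
  joint eigenvectors of \<open>H\<close> in \<open>\<real>\<^sup>n\<close>, and the stratum is the projectivized fixed space of \<open>F\<close>. This is a
  braid space, and it cannot be a hyperplane. Conversely, cyclic groups generated by 3-cycles and 4-cycles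
  at \<open>[1, \<dots>, 1]\<close> produce all braid spaces of codimension 2, whose intersections are all those of larger
  codimension.

  The two wonderful models differ by the blowups along the hyperplanes, which come last. Charts in which all
  remaining centres are linear persist under each blowup, because blowups of a linear space along a subspace
  are unique up to diffeomorphism (Hadamard's lemma). So when their turn comes, the
  hyperplanes are smooth hypersurfaces, and blowing them up is a diffeomorphism.\<close>

section \<open>Smooth functions\<close>

text \<open>The obstacle is that \<open>is_blowup\<close> describes \<open>B\<close> through
  unrelated charts, each of which linearises the centre alone and says nothing about the other
  members of the arrangement. Before a proper transform can be computed, such a chart is exchanged
  for one that linearises all remaining centres at once, by lifting the transition map. The
  arrangement stays indexed by the original subspaces of R^n, so containments and intersections of
  iterated proper transforms are read off from indices that never change.

  The cycles come from eigenvalues: a permutation has only the real eigenvalues 1 and -1, so squares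
  of elements of H fix all joint eigenvectors and lie in F. A 3-cycle is the square of a 3-cycle,
  and a product of two disjoint transpositions is the square of a 4-cycle, whereas a single
  transposition is no square.

  The discarded hyperplane blowups leave a diffeomorphism over X, not an equality. It is absorbed by
  the last remaining blowup, or by the identification with projective space if no centre
  remains.\<close>

lemma Ck_on_SucD: "Ck_on (Suc k) U f \<Longrightarrow> Ck_on k U f"
  by (induction k arbitrary: f) (auto intro: differentiable_imp_continuous_on)

lemma Ck_on_subset: "Ck_on k U f \<Longrightarrow> V \<subseteq> U \<Longrightarrow> Ck_on k V f"
  by (induction k arbitrary: f)
    (auto intro: continuous_on_subset differentiable_on_subset)

lemma Ck_on_cong:
  assumes "open U" "\<And>x. x \<in> U \<Longrightarrow> f x = g x" "Ck_on k U f"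
  shows "Ck_on k U g"
  using assms(2,3)
proof (induction k arbitrary: f g)
  case 0
  then show ?case by (auto cong: continuous_on_cong)
next
  case (Suc k)
  have eq: "frechet_derivative f (at x) = frechet_derivative g (at x)" if "x \<in> U" for x
  proof -
    have "f differentiable (at x)"
      using Suc.prems(2) that assms(1) by (simp add: differentiable_on_eq_differentiable_at)
    then show ?thesis
      using frechet_derivative_transform_within_open[OF _ assms(1) that, of f g] Suc.prems(1) by blast
  qed
  have "g differentiable_on U"
    using Suc.prems by (auto simp: differentiable_on_def intro: differentiable_transform_within[OF _ zero_less_one])
  then show ?case
    using Suc.prems(2) Suc.IH[of "\<lambda>x. frechet_derivative f (at x) v" "\<lambda>x. frechet_derivative g (at x) v" for v] eq
    by simp
qed

lemma Ck_on_SucI: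
  assumes "open U" "\<And>x. x \<in> U \<Longrightarrow> (f has_derivative f' x) (at x)" "\<And>v. Ck_on k U (\<lambda>x. f' x v)"
  shows "Ck_on (Suc k) U f"
proof -
  have "frechet_derivative f (at x) = f' x" if "x \<in> U" for x
    using assms(2)[OF that] by (metis frechet_derivative_at)
  then have "Ck_on k U (\<lambda>x. frechet_derivative f (at x) v)" for v
    using Ck_on_cong[OF assms(1) _ assms(3)[of v]] by simp
  moreover have "f differentiable_on U"
    using assms(2) by (meson differentiable_on_def differentiable_at_withinI differentiable_def)
  ultimately show ?thesis by simp
qed

lemma Ck_on_has_derivative:
  assumes "Ck_on (Suc k) U f" "open U" "x \<in> U"
  shows "(f has_derivative frechet_derivative f (at x)) (at x)"
  using assms by (simp add: differentiable_on_eq_differentiable_at frechet_derivative_works[symmetric])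

lemma Ck_on_const: "open U \<Longrightarrow> Ck_on k U (\<lambda>x. c)"
  by (induction k arbitrary: c) (auto intro!: continuous_intros)

lemma Ck_on_linear:
  assumes "open U" "bounded_linear f"
  shows "Ck_on k U f"
proof (cases k)
  case 0
  then show ?thesis using assms linear_continuous_on by auto
next
  case (Suc j)
  then show ?thesis
    using Ck_on_SucI[OF assms(1), of f "\<lambda>_. f"] Ck_on_const[OF assms(1)] bounded_linear_imp_has_derivative[OF assms(2)]
    by blast
qed

lemma Ck_on_bounded_linear:
  assumes "open U" "bounded_linear h" "Ck_on k U f"
  shows "Ck_on k U (\<lambda>x. h (f x))"
  using assms(3)
proof (induction k arbitrary: f)
  case 0
  then show ?case
    using assms(2) by (auto intro: continuous_on_compose2[of UNIV h] linear_continuous_on)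
next
  case (Suc k)
  show ?case
    by (rule Ck_on_SucI[OF assms(1), where f' = "\<lambda>x v. h (frechet_derivative f (at x) v)"])
      (use Suc assms in \<open>auto intro: bounded_linear.has_derivative simp: differentiable_on_eq_differentiable_at frechet_derivative_works[symmetric]\<close>)
qed

lemma Ck_on_add:
  assumes "open U" "Ck_on k U f" "Ck_on k U g"
  shows "Ck_on k U (\<lambda>x. f x + g x)"
  using assms(2,3)
proof (induction k arbitrary: f g)
  case 0
  then show ?case by (auto intro: continuous_intros)
next
  case (Suc k)
  show ?case
    by (rule Ck_on_SucI[OF assms(1), where f' = "\<lambda>x v. frechet_derivative f (at x) v + frechet_derivative g (at x) v"])
      (use Suc assms in \<open>auto intro!: has_derivative_add simp: differentiable_on_eq_differentiable_at frechet_derivative_works[symmetric]\<close>)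
qed

lemma Ck_on_sum:
  assumes "open U" "\<And>i. i \<in> I \<Longrightarrow> Ck_on k U (f i)"
  shows "Ck_on k U (\<lambda>x. \<Sum>i\<in>I. f i x)"
  using assms(2)
  by (induction I rule: infinite_finite_induct) (auto intro: Ck_on_add Ck_on_const assms(1))

lemma Ck_on_bilinear:
  assumes "open U" "bounded_bilinear p" "Ck_on k U f" "Ck_on k U g"
  shows "Ck_on k U (\<lambda>x. p (f x) (g x))"
  using assms(3,4)
proof (induction k arbitrary: f g)
  case 0
  then show ?case using assms(2) by (auto intro: bounded_bilinear.continuous_on)
next
  case (Suc k)
  note dd = Ck_on_has_derivative[OF Suc.prems(1) assms(1)] Ck_on_has_derivative[OF Suc.prems(2) assms(1)]
  show ?case
  proof (rule Ck_on_SucI[OF assms(1), where f' = "\<lambda>x v. p (f x) (frechet_derivative g (at x) v) + p (frechet_derivative f (at x) v) (g x)"])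
    show "((\<lambda>x. p (f x) (g x)) has_derivative
        (\<lambda>v. p (f x) (frechet_derivative g (at x) v) + p (frechet_derivative f (at x) v) (g x))) (at x)"
      if "x \<in> U" for x
      using bounded_bilinear.FDERIV[OF assms(2) dd(1)[OF that] dd(2)[OF that]] .
    show "Ck_on k U (\<lambda>x. p (f x) (frechet_derivative g (at x) v) + p (frechet_derivative f (at x) v) (g x))" for v
    proof (intro Ck_on_add Suc.IH assms(1))
      show "Ck_on k U f" "Ck_on k U g" by (rule Ck_on_SucD, fact)+
      show "Ck_on k U (\<lambda>x. frechet_derivative f (at x) v)" "Ck_on k U (\<lambda>x. frechet_derivative g (at x) v)"
        using Suc.prems by simp_all
    qed
  qed
qed

lemma Ck_on_inverse:
  assumes "U \<subseteq> {x::real. x \<noteq> 0}" "open U"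
  shows "Ck_on k U inverse"
proof (induction k)
  case 0
  then show ?case using assms by (auto intro!: continuous_intros)
next
  case (Suc k)
  show ?case
  proof (rule Ck_on_SucI[OF assms(2), where f' = "\<lambda>x v. - (inverse x * v * inverse x)"])
    show "(inverse has_derivative (\<lambda>v. - (inverse x * v * inverse x))) (at x)" if "x \<in> U" for x
      using that assms(1) has_derivative_inverse'[of x UNIV] by auto
    have "Ck_on k U (\<lambda>x. inverse x * v)" for v
      by (rule Ck_on_bilinear[OF assms(2) bounded_bilinear_mult Suc Ck_on_const[OF assms(2)]])
    then have "Ck_on k U (\<lambda>x. inverse x * v * inverse x)" for v
      by (rule Ck_on_bilinear[OF assms(2) bounded_bilinear_mult _ Suc])
    then show "Ck_on k U (\<lambda>x. - (inverse x * v * inverse x))" for v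
      by (rule Ck_on_bounded_linear[OF assms(2) bounded_linear_minus[OF bounded_linear_ident]])
  qed
qed

lemma Ck_on_compose:
  assumes "open U" "open V" "f ` U \<subseteq> V" "Ck_on k U f" "Ck_on k V g"
  shows "Ck_on k U (\<lambda>x. g (f x))"
  using assms(4,5)
proof (induction k arbitrary: g)
  case 0
  then show ?case using assms(3) by (auto intro: continuous_on_compose2)
next
  case (Suc k)
  let ?f' = "\<lambda>x. frechet_derivative f (at x)" and ?g' = "\<lambda>x. frechet_derivative g (at x)"
  have lin: "linear (?g' y)" if "y \<in> V" for y
    using Ck_on_has_derivative[OF Suc.prems(2) assms(2) that] by (auto dest: has_derivative_linear)
  have "Ck_on (Suc k) U (\<lambda>x. g (f x))"
  \<comment> \<open>In the chain rule the derivative of g is taken in a direction that moves with x,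
    while \<open>Ck_on\<close> speaks of constant directions. Expanding that direction over the
    basis leaves products of functions that are C^k, by hypothesis or by induction.\<close>
  proof (rule Ck_on_SucI[OF assms(1), where f' = "\<lambda>x v. \<Sum>b\<in>Basis. (?f' x v \<bullet> b) *\<^sub>R ?g' (f x) b"])
    show "((\<lambda>x. g (f x)) has_derivative (\<lambda>v. \<Sum>b\<in>Basis. (?f' x v \<bullet> b) *\<^sub>R ?g' (f x) b)) (at x)"
      if "x \<in> U" for x
    proof -
      have fx: "f x \<in> V" using that assms(3) by auto
      have "((\<lambda>x. g (f x)) has_derivative (\<lambda>v. ?g' (f x) (?f' x v))) (at x)"
        by (rule has_derivative_compose[OF Ck_on_has_derivative[OF Suc.prems(1) assms(1) that]
              Ck_on_has_derivative[OF Suc.prems(2) assms(2) fx]])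
      moreover have "?g' (f x) (?f' x v) = (\<Sum>b\<in>Basis. (?f' x v \<bullet> b) *\<^sub>R ?g' (f x) b)" for v
        by (subst euclidean_representation[of "?f' x v", symmetric])
          (simp add: linear_sum[OF lin[OF fx]] linear_scale[OF lin[OF fx]])
      ultimately show ?thesis by simp
    qed
    show "Ck_on k U (\<lambda>x. \<Sum>b\<in>Basis. (?f' x v \<bullet> b) *\<^sub>R ?g' (f x) b)" for v
    proof (rule Ck_on_sum[OF assms(1)], rule Ck_on_bilinear[OF assms(1) bounded_bilinear_scaleR])
      fix b
      show "Ck_on k U (\<lambda>x. ?f' x v \<bullet> b)"
        by (rule Ck_on_bounded_linear[OF assms(1) bounded_linear_inner_left]) (use Suc.prems(1) in simp)
      show "Ck_on k U (\<lambda>x. ?g' (f x) b)"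
        by (rule Suc.IH[OF Ck_on_SucD[OF Suc.prems(1)]]) (use Suc.prems(2) in simp)
    qed
  qed
  then show ?case .
qed

definition smooth_on :: "'a::euclidean_space set \<Rightarrow> ('a \<Rightarrow> 'b::euclidean_space) \<Rightarrow> bool" where
  "smooth_on U f \<longleftrightarrow> open U \<and> (\<forall>k. Ck_on k U f)"

lemma smooth_on_open: "smooth_on U f \<Longrightarrow> open U"
  by (simp add: smooth_on_def)

lemma smooth_on_subset: "smooth_on U f \<Longrightarrow> open V \<Longrightarrow> V \<subseteq> U \<Longrightarrow> smooth_on V f"
  by (auto simp: smooth_on_def intro: Ck_on_subset)

lemma smooth_on_cong: "smooth_on U f \<Longrightarrow> (\<And>x. x \<in> U \<Longrightarrow> f x = g x) \<Longrightarrow> smooth_on U g"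
  unfolding smooth_on_def using Ck_on_cong by blast

lemma smooth_on_const: "open U \<Longrightarrow> smooth_on U (\<lambda>x. c)"
  by (auto simp: smooth_on_def intro: Ck_on_const)

lemma smooth_on_linear: "open U \<Longrightarrow> bounded_linear f \<Longrightarrow> smooth_on U f"
  by (auto simp: smooth_on_def intro: Ck_on_linear)

lemma smooth_on_ident: "open U \<Longrightarrow> smooth_on U (\<lambda>x. x)"
  by (rule smooth_on_linear[OF _ bounded_linear_ident])

lemma smooth_on_bounded_linear: "bounded_linear h \<Longrightarrow> smooth_on U f \<Longrightarrow> smooth_on U (\<lambda>x. h (f x))"
  by (auto simp: smooth_on_def intro: Ck_on_bounded_linear)

lemma smooth_on_add: "smooth_on U f \<Longrightarrow> smooth_on U g \<Longrightarrow> smooth_on U (\<lambda>x. f x + g x)"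
  by (auto simp: smooth_on_def intro: Ck_on_add)

lemma smooth_on_sum: "open U \<Longrightarrow> (\<And>i. i \<in> I \<Longrightarrow> smooth_on U (f i)) \<Longrightarrow> smooth_on U (\<lambda>x. \<Sum>i\<in>I. f i x)"
  by (auto simp: smooth_on_def intro: Ck_on_sum)

lemma smooth_on_bilinear:
  "bounded_bilinear p \<Longrightarrow> smooth_on U f \<Longrightarrow> smooth_on U g \<Longrightarrow> smooth_on U (\<lambda>x. p (f x) (g x))"
  by (auto simp: smooth_on_def intro: Ck_on_bilinear)

lemmas smooth_on_scaleR = smooth_on_bilinear[OF bounded_bilinear_scaleR]
  and smooth_on_mult = smooth_on_bilinear[OF bounded_bilinear_mult[where 'a = real]]
  and smooth_on_inner = smooth_on_bilinear[OF bounded_bilinear_inner]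

lemma smooth_on_minus: "smooth_on U f \<Longrightarrow> smooth_on U (\<lambda>x. - f x)"
  by (rule smooth_on_bounded_linear[OF bounded_linear_minus[OF bounded_linear_ident]])

lemma smooth_on_diff: "smooth_on U f \<Longrightarrow> smooth_on U g \<Longrightarrow> smooth_on U (\<lambda>x. f x - g x)"
  using smooth_on_add[OF _ smooth_on_minus] by fastforce

lemma smooth_on_compose:
  "smooth_on U f \<Longrightarrow> smooth_on V g \<Longrightarrow> f ` U \<subseteq> V \<Longrightarrow> smooth_on U (\<lambda>x. g (f x))"
  by (auto simp: smooth_on_def intro: Ck_on_compose)

lemma smooth_on_inverse:
  assumes "smooth_on U f" "\<And>x. x \<in> U \<Longrightarrow> f x \<noteq> (0::real)"
  shows "smooth_on U (\<lambda>x. inverse (f x))"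
proof (rule smooth_on_compose[OF assms(1)])
  have "open {x::real. x \<noteq> 0}" by (simp add: open_Collect_neq)
  then show "smooth_on {x::real. x \<noteq> 0} inverse"
    by (auto simp: smooth_on_def intro: Ck_on_inverse)
qed (use assms(2) in auto)

lemma smooth_on_divide:
  "smooth_on U f \<Longrightarrow> smooth_on U g \<Longrightarrow> (\<And>x. x \<in> U \<Longrightarrow> g x \<noteq> (0::real)) \<Longrightarrow> smooth_on U (\<lambda>x. f x / g x)"
  unfolding divide_inverse by (intro smooth_on_mult smooth_on_inverse)

lemma smooth_on_fst: "smooth_on U f \<Longrightarrow> smooth_on U (\<lambda>x. fst (f x))"
  and smooth_on_snd: "smooth_on U f \<Longrightarrow> smooth_on U (\<lambda>x. snd (f x))"
  by (auto intro: smooth_on_bounded_linear bounded_linear_fst bounded_linear_snd)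

lemma smooth_on_Pair:
  assumes "smooth_on U f" "smooth_on U g"
  shows "smooth_on U (\<lambda>x. (f x, g x))"
proof -
  have "bounded_linear (\<lambda>x::'b. (x, 0::'c))" "bounded_linear (\<lambda>y::'c. (0::'b, y))"
    by (auto intro!: bounded_linear_Pair bounded_linear_ident bounded_linear_zero)
  from smooth_on_add[OF smooth_on_bounded_linear[OF this(1) assms(1)] smooth_on_bounded_linear[OF this(2) assms(2)]]
  show ?thesis by simp
qed

lemma smooth_on_vec_nth: "smooth_on U f \<Longrightarrow> smooth_on U (\<lambda>x. f x $ i)"
  by (rule smooth_on_bounded_linear[OF bounded_linear_vec_nth])

lemma smooth_on_vec_lambda:
  fixes f :: "'a::euclidean_space \<Rightarrow> 'n::finite \<Rightarrow> 'b::euclidean_space"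
  assumes "open U" "\<And>i. smooth_on U (\<lambda>x. f x i)"
  shows "smooth_on U (\<lambda>x. \<chi> i. f x i)"
proof -
  have ax: "axis i y $ j = (if j = i then y else 0)" for i j :: 'n and y :: 'b
    by (auto simp only: axis_def vec_lambda_beta)
  have "linear (axis i :: 'b \<Rightarrow> 'b^'n)" for i
    by (rule linearI; rule vec_eq_iff[THEN iffD2])
      (auto simp only: ax vector_add_component vector_scaleR_component if_True if_False add_0_left scaleR_zero_right split: if_split)
  then have bl: "bounded_linear (axis i :: 'b \<Rightarrow> 'b^'n)" for i
    by (simp only: linear_conv_bounded_linear)
  have "smooth_on U (\<lambda>x. \<Sum>i\<in>UNIV. (axis i (f x i) :: 'b^'n))"
    by (rule smooth_on_sum[OF assms(1)], rule smooth_on_bounded_linear[OF bl assms(2)])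
  moreover have "(\<Sum>i\<in>UNIV. axis i (f x i)) = (\<chi> i. f x i)" for x
    by (rule vec_eq_iff[THEN iffD2]) (simp only: sum_component ax vec_lambda_beta sum.delta sum.delta' finite_class.finite_UNIV UNIV_I if_True simp_thms)
  ultimately show ?thesis by (simp only:)
qed

lemma smooth_on_matrix_vector_mult:
  fixes A :: "'a::euclidean_space \<Rightarrow> real^'n^'k"
  assumes "smooth_on U A" "smooth_on U v"
  shows "smooth_on U (\<lambda>x. A x *v v x)"
  unfolding matrix_vector_mult_def
  by (intro smooth_on_vec_lambda smooth_on_sum smooth_on_mult smooth_on_vec_nth assms smooth_on_open[OF assms(1)])

lemma smooth_on_proj_point:
  assumes "smooth_on U v" "\<And>x. x \<in> U \<Longrightarrow> v x \<noteq> 0"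
  shows "smooth_on U (\<lambda>x. proj_point (v x))"
  unfolding proj_point_def
  using assms by (intro smooth_on_vec_lambda smooth_on_divide smooth_on_mult smooth_on_inner smooth_on_vec_nth)
    (auto dest: smooth_on_open)

lemma smooth_on_imp_continuous: "smooth_on U f \<Longrightarrow> continuous_on U f"
  unfolding smooth_on_def using Ck_on.simps(1) by blast

lemma smooth_on_open_vimage:
  assumes "smooth_on U f" "open V"
  shows "open (U \<inter> f -` V)"
  using continuous_on_open_vimage[OF smooth_on_open[OF assms(1)], of f] smooth_on_imp_continuous[OF assms(1)] assms(2)
  by (simp add: Int_commute)

lemma smooth_on_has_derivative:
  "smooth_on U f \<Longrightarrow> x \<in> U \<Longrightarrow> (f has_derivative frechet_derivative f (at x)) (at x)"
  unfolding smooth_on_def using Ck_on_has_derivative by blast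

lemma smooth_on_frechet_derivative:
  assumes "smooth_on U f"
  shows "smooth_on U (\<lambda>x. frechet_derivative f (at x) v)"
  unfolding smooth_on_def
proof (intro conjI allI)
  fix k
  have "Ck_on (Suc k) U f" using assms[unfolded smooth_on_def, THEN conjunct2] by (rule spec)
  then show "Ck_on k U (\<lambda>x. frechet_derivative f (at x) v)" by simp
qed (use assms in \<open>simp add: smooth_on_def\<close>)

text \<open>The direction \<open>v x\<close> moves with the point, so it is expanded over the basis:
  derivatives in constant directions are smooth.\<close>

lemma smooth_on_frechet_derivative_apply:
  assumes "smooth_on U f" "smooth_on V g" "smooth_on V v" "g ` V \<subseteq> U"
  shows "smooth_on V (\<lambda>x. frechet_derivative f (at (g x)) (v x))"
proof (rule smooth_on_cong)
  show "smooth_on V (\<lambda>x. \<Sum>b\<in>Basis. (v x \<bullet> b) *\<^sub>R frechet_derivative f (at (g x)) b)"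
    using assms
    by (intro smooth_on_sum smooth_on_scaleR smooth_on_inner smooth_on_const
        smooth_on_compose[OF assms(2) smooth_on_frechet_derivative[OF assms(1)]])
      (auto dest: smooth_on_open)
  fix x assume "x \<in> V"
  then have "linear (frechet_derivative f (at (g x)))"
    using assms(4) by (intro has_derivative_linear[OF smooth_on_has_derivative[OF assms(1)]]) auto
  then have "frechet_derivative f (at (g x)) (\<Sum>b\<in>Basis. (v x \<bullet> b) *\<^sub>R b) =
      (\<Sum>b\<in>Basis. (v x \<bullet> b) *\<^sub>R frechet_derivative f (at (g x)) b)"
    by (simp add: linear_sum linear_scale)
  then show "(\<Sum>b\<in>Basis. (v x \<bullet> b) *\<^sub>R frechet_derivative f (at (g x)) b) = frechet_derivative f (at (g x)) (v x)"
    by (simp add: euclidean_representation)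
qed

text \<open>Differentiation under the integral sign, iterated: the derivative in direction v is
  again such an integral, with the smooth kernel \<open>frechet_derivative K (at z) (v, 0)\<close>.
  The induction on the order therefore runs over all kernels at once.\<close>

lemma smooth_on_integral:
  fixes K :: "'a::euclidean_space \<times> real \<Rightarrow> 'b::euclidean_space"
  assumes "smooth_on N K" "open D" "\<And>p t. p \<in> D \<Longrightarrow> t \<in> {0..1} \<Longrightarrow> (p, t) \<in> N"
  shows "smooth_on D (\<lambda>p. integral {0..1} (\<lambda>t. K (p, t)))"
proof -
  have cont: "continuous_on (A \<times> cbox 0 1) (\<lambda>(p, t). K (p, t))"
    if "smooth_on N K" "A \<subseteq> D" for K :: "'a \<times> real \<Rightarrow> 'b" and A
    using continuous_on_subset[OF smooth_on_imp_continuous[OF that(1)], of "A \<times> cbox 0 1"] assms(3) that(2)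
    by (auto simp: subset_eq)
  have slice: "continuous_on {0..1} (\<lambda>t. h (p, t))" if "continuous_on ({p} \<times> cbox 0 1) h"
    for p and h :: "'a \<times> real \<Rightarrow> 'z::topological_space"
    by (rule continuous_on_compose2[OF that]) (auto intro!: continuous_intros)
  have "Ck_on k D (\<lambda>p. integral {0..1} (\<lambda>t. K (p, t)))" if "smooth_on N K" for k and K :: "'a \<times> real \<Rightarrow> 'b"
    using that
  proof (induction k arbitrary: K)
    case 0
    then show ?case using integral_continuous_on_param[OF cont[OF 0 order_refl]] by simp
  next
    case (Suc k)
    \<comment> \<open>The partial derivative in p, packaged as a bounded linear function because
      \<open>leibniz_rule\<close> asks for its continuity as an operator-valued map.\<close>
    define fx where "fx p t = Blinfun (\<lambda>v. frechet_derivative K (at (p, t)) (v, 0))" for p t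
    have fx: "blinfun_apply (fx p t) v = frechet_derivative K (at (p, t)) (v, 0)"
      and der: "((\<lambda>p. K (p, t)) has_derivative blinfun_apply (fx p t)) (at p)"
      if "p \<in> D" "t \<in> {0..1}" for p t v
    proof -
      note d = smooth_on_has_derivative[OF Suc.prems assms(3)[OF that]]
      have *: "((\<lambda>p. K (p, t)) has_derivative (\<lambda>v. frechet_derivative K (at (p, t)) (v, 0))) (at p)"
        by (rule has_derivative_compose[of "\<lambda>p. (p, t)" "\<lambda>v. (v, 0)" p UNIV K, OF _ d])
          (auto intro!: derivative_eq_intros)
      then have "bounded_linear (\<lambda>v. frechet_derivative K (at (p, t)) (v, 0))"
        by (rule has_derivative_bounded_linear)
      then have "blinfun_apply (fx p t) = (\<lambda>v. frechet_derivative K (at (p, t)) (v, 0))"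
        unfolding fx_def by (rule bounded_linear_Blinfun_apply)
      with * show "blinfun_apply (fx p t) v = frechet_derivative K (at (p, t)) (v, 0)"
        "((\<lambda>p. K (p, t)) has_derivative blinfun_apply (fx p t)) (at p)"
        by simp_all
    qed
    have smd: "smooth_on N (\<lambda>z. frechet_derivative K (at z) (v, 0))" for v
      by (rule smooth_on_frechet_derivative[OF Suc.prems])
    have contfx: "continuous_on (A \<times> cbox 0 1) (\<lambda>(p, t). fx p t)" if "A \<subseteq> D" for A
    proof (rule continuous_on_blinfun_componentwise)
      fix i :: 'a
      show "continuous_on (A \<times> cbox 0 1) (\<lambda>x. blinfun_apply (case x of (p, t) \<Rightarrow> fx p t) i)"
        by (rule continuous_on_eq[OF cont[OF smd[of i] that]]) (use fx that in auto)
    qed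
    have int: "(\<lambda>t. K (p, t)) integrable_on {0..1}" if "p \<in> D" for p
      using slice[OF cont[OF Suc.prems, of "{p}"]] that by (auto intro: integrable_continuous_real)
    have D: "((\<lambda>p. integral {0..1} (\<lambda>t. K (p, t))) has_derivative
        (\<lambda>v. integral {0..1} (\<lambda>t. frechet_derivative K (at (p, t)) (v, 0)))) (at p)" if p: "p \<in> D" for p
    proof -
      \<comment> \<open>\<open>leibniz_rule\<close> works over a convex parameter set, so it is
        applied on a ball around p.\<close>
      obtain e where e: "e > 0" "ball p e \<subseteq> D"
        using assms(2) p open_contains_ball by blast
      have "((\<lambda>p. integral (cbox 0 1) (\<lambda>t. K (p, t))) has_derivative integral (cbox 0 1) (fx p)) (at p within ball p e)"
      proof (rule leibniz_rule)
        fix x t assume "x \<in> ball p e" "t \<in> cbox (0::real) 1"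
        then show "((\<lambda>x. K (x, t)) has_derivative blinfun_apply (fx x t)) (at x within ball p e)"
          using e(2) by (rule_tac has_derivative_at_withinI, rule_tac der) auto
      next
        fix x assume "x \<in> ball p e"
        then show "(\<lambda>t. K (x, t)) integrable_on cbox 0 1"
          using e(2) int by auto
      qed (use e contfx[OF e(2)] in auto)
      then have d: "((\<lambda>p. integral {0..1} (\<lambda>t. K (p, t))) has_derivative integral {0..1} (fx p)) (at p)"
        using e(1) at_within_open[of p "ball p e"] by simp
      have "continuous_on {0..1} (fx p)"
        using slice[OF contfx[of "{p}"]] p by auto
      then have "fx p integrable_on {0..1}"
        by (rule integrable_continuous_real)
      then have "blinfun_apply (integral {0..1} (fx p)) = (\<lambda>v. integral {0..1} (\<lambda>t. frechet_derivative K (at (p, t)) (v, 0)))"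
        by (auto simp: fun_eq_iff blinfun_apply_integral fx[OF p] intro: integral_cong)
      then show ?thesis using d by simp
    qed
    show ?case
      by (rule Ck_on_SucI[OF assms(2) D Suc.IH[OF smd]])
  qed
  then show ?thesis using assms(1,2) by (simp add: smooth_on_def[of D])
qed

text \<open>Integrate the derivative of r \<mapsto> F (s + r t u) over [0, 1] and pull out the
  factor t. What remains is smooth across t = 0 as well; convexity keeps the segment inside
  U.\<close>

lemma hadamard:
  fixes F :: "'a::euclidean_space \<Rightarrow> 'b::euclidean_space"
  assumes F: "smooth_on U F" and "convex U"
  obtains g :: "'a \<times> real \<times> 'a \<Rightarrow> 'b" where
    "smooth_on {(s, t, u). s \<in> U \<and> s + t *\<^sub>R u \<in> U} g"
    "\<And>s t u. s \<in> U \<Longrightarrow> s + t *\<^sub>R u \<in> U \<Longrightarrow> F (s + t *\<^sub>R u) - F s = t *\<^sub>R g (s, t, u)"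
    "\<And>s u. s \<in> U \<Longrightarrow> g (s, 0, u) = frechet_derivative F (at s) u"
proof
  note U = smooth_on_open[OF F]
  \<comment> \<open>\<open>c ((s, t, u), r)\<close> is the point s + r t u of the segment from s to
    s + t u.\<close>
  define c where "c z = fst (fst z) + (snd z * fst (snd (fst z))) *\<^sub>R snd (snd (fst z))"
    for z :: "('a \<times> real \<times> 'a) \<times> real"
  have "smooth_on UNIV c"
    unfolding c_def by (intro smooth_on_add smooth_on_scaleR smooth_on_mult smooth_on_fst smooth_on_snd smooth_on_ident open_UNIV)
  then have oN: "open (c -` U)" "continuous_on UNIV c"
    using U smooth_on_imp_continuous[of UNIV c] by (auto intro: open_vimage)
  then have sc: "smooth_on (c -` U) c"
    using smooth_on_subset[OF \<open>smooth_on UNIV c\<close>] by blast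
  let ?D = "{(s, t, u). s \<in> U \<and> s + t *\<^sub>R u \<in> U} :: ('a \<times> real \<times> 'a) set"
  let ?g = "\<lambda>p. integral {0..1} (\<lambda>r. frechet_derivative F (at (c (p, r))) (snd (snd p)))"
  have cU: "s + (r * t) *\<^sub>R u \<in> U" if "s \<in> U" "s + t *\<^sub>R u \<in> U" "0 \<le> r" "r \<le> 1" for s u r t
  proof -
    have "s + (r * t) *\<^sub>R u = (1 - r) *\<^sub>R s + r *\<^sub>R (s + t *\<^sub>R u)" by (simp add: algebra_simps)
    then show ?thesis using convexD_alt[OF assms(2) that] by simp
  qed
  have K: "smooth_on (c -` U) (\<lambda>z. frechet_derivative F (at (c z)) (snd (snd (fst z))))"
    by (rule smooth_on_frechet_derivative_apply[OF F sc])
      (auto intro!: smooth_on_snd smooth_on_fst smooth_on_ident oN)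
  have "open ((\<lambda>p. fst p) -` U \<inter> (\<lambda>p. fst p + fst (snd p) *\<^sub>R snd (snd p)) -` U :: ('a \<times> real \<times> 'a) set)"
    by (intro open_Int open_vimage U continuous_intros)
  moreover have "(\<lambda>p. fst p) -` U \<inter> (\<lambda>p. fst p + fst (snd p) *\<^sub>R snd (snd p)) -` U = ?D" by auto
  ultimately have oD: "open ?D" by simp
  show "smooth_on ?D ?g"
    using smooth_on_integral[OF K oD] cU by (auto simp: c_def)
  show "F (s + t *\<^sub>R u) - F s = t *\<^sub>R ?g (s, t, u)" if st: "s \<in> U" "s + t *\<^sub>R u \<in> U" for s t u
  proof -
    let ?h = "\<lambda>r. frechet_derivative F (at (c ((s, t, u), r))) u"
    have lin: "linear (frechet_derivative F (at x))" if "x \<in> U" for x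
      using smooth_on_has_derivative[OF F that] has_derivative_linear by blast
    have "((\<lambda>r. F (s + (r * t) *\<^sub>R u)) has_vector_derivative (t *\<^sub>R ?h r)) (at r within {0..1})" if "r \<in> {0..1}" for r
    proof -
      have x: "s + (r * t) *\<^sub>R u \<in> U" using cU[OF st] that by auto
      have "((\<lambda>r. s + (r * t) *\<^sub>R u) has_derivative (\<lambda>v. (v * t) *\<^sub>R u)) (at r within {0..1})"
        by (auto intro!: derivative_eq_intros)
      from has_derivative_compose[OF this smooth_on_has_derivative[OF F x]]
      show ?thesis by (simp add: has_vector_derivative_def c_def linear_scale[OF lin[OF x]])
    qed
    then have "((\<lambda>r. t *\<^sub>R ?h r) has_integral (F (s + (1 * t) *\<^sub>R u) - F (s + (0 * t) *\<^sub>R u))) {0..1}"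
      by (intro fundamental_theorem_of_calculus) auto
    then have "integral {0..1} (\<lambda>r. t *\<^sub>R ?h r) = F (s + (1 * t) *\<^sub>R u) - F (s + (0 * t) *\<^sub>R u)"
      by (rule integral_unique)
    then show ?thesis by simp
  qed
  show "?g (s, 0, u) = frechet_derivative F (at s) u" for s u
    by (simp add: c_def)
qed

section \<open>Smooth maps, diffeomorphisms and orthogonal projections\<close>

lemma smooth_map_iff:
  "smooth_map A B f \<longleftrightarrow> f ` A \<subseteq> B \<and> (\<forall>a\<in>A. \<exists>U F. a \<in> U \<and> smooth_on U F \<and> (\<forall>x\<in>A \<inter> U. F x = f x))"
  unfolding smooth_map_def smooth_on_def by blast

lemma smooth_map_image: "smooth_map A B f \<Longrightarrow> x \<in> A \<Longrightarrow> f x \<in> B"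
  by (auto simp: smooth_map_def)

lemma smooth_map_extension:
  assumes "smooth_map A B f" "a \<in> A"
  obtains U F where "a \<in> U" "smooth_on U F" "\<And>x. x \<in> A \<Longrightarrow> x \<in> U \<Longrightarrow> F x = f x"
  using assms unfolding smooth_map_iff by blast

lemma smooth_mapI_smooth_on:
  assumes "smooth_on U f" "A \<subseteq> U" "f ` A \<subseteq> B"
  shows "smooth_map A B f"
  using assms unfolding smooth_map_iff by blast

lemma smooth_map_continuous_on:
  assumes "smooth_map A B f"
  shows "continuous_on A f"
  unfolding continuous_on_eq_continuous_within
proof
  fix a assume a: "a \<in> A"
  obtain U F where U: "a \<in> U" "smooth_on U F" "\<And>x. x \<in> A \<Longrightarrow> x \<in> U \<Longrightarrow> F x = f x"
    using smooth_map_extension[OF assms a] by metis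
  have "isCont F a"
    using smooth_on_imp_continuous[OF U(2)] smooth_on_open[OF U(2)] U(1) continuous_on_eq_continuous_at by blast
  then have F: "continuous (at a within A) F" by (rule continuous_at_imp_continuous_at_within)
  obtain d where d: "d > 0" "ball a d \<subseteq> U"
    using smooth_on_open[OF U(2)] U(1) open_contains_ball by blast
  show "continuous (at a within A) f"
    by (rule continuous_transform_within[OF F d(1) a]) (use d(2) U(3) in \<open>auto simp: dist_commute subset_eq\<close>)
qed

lemma smooth_map_subset:
  assumes "smooth_map A B f" "A' \<subseteq> A" "f ` A' \<subseteq> B'"
  shows "smooth_map A' B' f"
  unfolding smooth_map_iff
proof (intro conjI ballI assms)
  fix a assume "a \<in> A'"
  then obtain U F where "a \<in> U" "smooth_on U F" "\<And>x. x \<in> A \<Longrightarrow> x \<in> U \<Longrightarrow> F x = f x"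
    using smooth_map_extension[OF assms(1), of a] assms(2) by blast
  then show "\<exists>U F. a \<in> U \<and> smooth_on U F \<and> (\<forall>x\<in>A' \<inter> U. F x = f x)"
    using assms(2) by (intro exI[of _ U] exI[of _ F]) auto
qed

lemma smooth_map_cong:
  assumes "smooth_map A B f" "\<And>x. x \<in> A \<Longrightarrow> f x = g x"
  shows "smooth_map A B g"
proof -
  have "f ` A = g ` A" "\<And>U F. (\<forall>x\<in>A \<inter> U. F x = f x) \<longleftrightarrow> (\<forall>x\<in>A \<inter> U. F x = g x)"
    using assms(2) by auto
  then show ?thesis using assms(1) unfolding smooth_map_iff by simp
qed

lemma smooth_map_compose:
  assumes f: "smooth_map A B f" and g: "smooth_map B C g"
  shows "smooth_map A C (\<lambda>x. g (f x))"
  unfolding smooth_map_iff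
proof (intro conjI ballI)
  show "(\<lambda>x. g (f x)) ` A \<subseteq> C" using f g by (auto dest: smooth_map_image)
  fix a assume a: "a \<in> A"
  obtain U F where U: "a \<in> U" "smooth_on U F" "\<And>x. x \<in> A \<Longrightarrow> x \<in> U \<Longrightarrow> F x = f x"
    using smooth_map_extension[OF f a] by metis
  obtain V G where V: "f a \<in> V" "smooth_on V G" "\<And>x. x \<in> B \<Longrightarrow> x \<in> V \<Longrightarrow> G x = g x"
    using smooth_map_extension[OF g smooth_map_image[OF f a]] by metis
  let ?U = "U \<inter> F -` V"
  have o: "open ?U"
    using continuous_on_open_vimage[OF smooth_on_open[OF U(2)], of F] smooth_on_imp_continuous[OF U(2)]
      smooth_on_open[OF V(2)] by (simp add: Int_commute)
  have "smooth_on ?U (\<lambda>x. G (F x))"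
    by (rule smooth_on_compose[OF smooth_on_subset[OF U(2) o] V(2)]) auto
  then show "\<exists>U F. a \<in> U \<and> smooth_on U F \<and> (\<forall>x\<in>A \<inter> U. F x = g (f x))"
    using U(1,3) V(1,3) a smooth_map_image[OF f]
    by (intro exI[of _ ?U] exI[of _ "\<lambda>x. G (F x)"]) auto
qed

lemma smooth_map_local:
  assumes "\<And>a. a \<in> A \<Longrightarrow> \<exists>V. openin (top_of_set A) V \<and> a \<in> V \<and> smooth_map V B f"
  shows "smooth_map A B f"
  unfolding smooth_map_iff
proof (intro conjI ballI)
  show "f ` A \<subseteq> B" using assms smooth_map_image by (metis image_subsetI)
  fix a assume "a \<in> A"
  then obtain V where V: "openin (top_of_set A) V" "a \<in> V" "smooth_map V B f" using assms by blast
  obtain Q where Q: "open Q" "V = A \<inter> Q" using V(1) by (auto simp: openin_open)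
  obtain U F where U: "a \<in> U" "smooth_on U F" "\<And>x. x \<in> V \<Longrightarrow> x \<in> U \<Longrightarrow> F x = f x"
    using smooth_map_extension[OF V(3,2)] by metis
  have "smooth_on (U \<inter> Q) F"
    by (rule smooth_on_subset[OF U(2)]) (use Q smooth_on_open[OF U(2)] in auto)
  then show "\<exists>U F. a \<in> U \<and> smooth_on U F \<and> (\<forall>x\<in>A \<inter> U. F x = f x)"
    using U V(2) Q(2) by (intro exI[of _ "U \<inter> Q"] exI[of _ F]) auto
qed

lemma smooth_map_ident: "smooth_map A A (\<lambda>x. x)"
  by (rule smooth_mapI_smooth_on[OF smooth_on_ident[OF open_UNIV]]) auto

lemma diffeoI:
  assumes "smooth_map A B f" "smooth_map B A g" "\<And>a. a \<in> A \<Longrightarrow> g (f a) = a" "\<And>b. b \<in> B \<Longrightarrow> f (g b) = b"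
  shows "diffeo A B f"
proof -
  have bij: "bij_betw f A B"
    by (rule bij_betw_byWitness[where f' = g]) (use assms in \<open>auto simp: smooth_map_def\<close>)
  have "smooth_map B A (inv_into A f)"
    by (rule smooth_map_cong[OF assms(2)])
      (use assms bij in \<open>metis bij_betw_imp_inj_on inv_into_f_f smooth_map_image\<close>)
  then show ?thesis using bij assms(1) by (simp add: diffeo_def)
qed

lemma diffeo_inverse:
  assumes "diffeo A B f"
  obtains g where "smooth_map A B f" "smooth_map B A g" "\<And>a. a \<in> A \<Longrightarrow> g (f a) = a"
    "\<And>b. b \<in> B \<Longrightarrow> f (g b) = b" "diffeo B A g"
proof -
  have *: "smooth_map A B f" "smooth_map B A (inv_into A f)" "\<And>a. a \<in> A \<Longrightarrow> inv_into A f (f a) = a"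
    "\<And>b. b \<in> B \<Longrightarrow> f (inv_into A f b) = b"
    using assms by (auto simp: diffeo_def bij_betw_inv_into_left bij_betw_inv_into_right)
  show ?thesis by (rule that[OF * diffeoI[OF *(2,1,4,3)]])
qed

lemma diffeo_image: "diffeo A B f \<Longrightarrow> f ` A = B"
  by (simp add: diffeo_def bij_betw_def)

lemma diffeo_inj_on: "diffeo A B f \<Longrightarrow> inj_on f A"
  by (simp add: diffeo_def bij_betw_def)

lemma diffeo_smooth_map: "diffeo A B f \<Longrightarrow> smooth_map A B f"
  by (simp add: diffeo_def)

lemma diffeo_ident: "diffeo A A (\<lambda>x. x)"
  by (rule diffeoI[where g = "\<lambda>x. x"]) (auto intro: smooth_map_ident)

lemma diffeo_compose:
  assumes "diffeo A B f" "diffeo B C g"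
  shows "diffeo A C (\<lambda>x. g (f x))"
proof -
  obtain f' where f: "smooth_map A B f" "smooth_map B A f'" "\<And>a. a \<in> A \<Longrightarrow> f' (f a) = a" "\<And>b. b \<in> B \<Longrightarrow> f (f' b) = b"
    using diffeo_inverse[OF assms(1)] by metis
  obtain g' where g: "smooth_map B C g" "smooth_map C B g'" "\<And>a. a \<in> B \<Longrightarrow> g' (g a) = a" "\<And>b. b \<in> C \<Longrightarrow> g (g' b) = b"
    using diffeo_inverse[OF assms(2)] by metis
  show ?thesis
    by (rule diffeoI[OF smooth_map_compose[OF f(1) g(1)] smooth_map_compose[OF g(2) f(2)]])
      (use f g smooth_map_image in metis)+
qed

lemma diffeo_cong:
  assumes "diffeo A B f" "\<And>x. x \<in> A \<Longrightarrow> f x = g x"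
  shows "diffeo A B g"
proof -
  obtain f' where f: "smooth_map A B f" "smooth_map B A f'" "\<And>a. a \<in> A \<Longrightarrow> f' (f a) = a" "\<And>b. b \<in> B \<Longrightarrow> f (f' b) = b"
    using diffeo_inverse[OF assms(1)] by metis
  show ?thesis
    by (rule diffeoI[OF smooth_map_cong[OF f(1) assms(2)] f(2)])
      (use f assms(2) smooth_map_image[OF f(2)] in auto)
qed

lemma diffeo_restrict:
  assumes "diffeo A B f" "A' \<subseteq> A"
  shows "diffeo A' (f ` A') f"
proof -
  obtain f' where f: "smooth_map A B f" "smooth_map B A f'" "\<And>a. a \<in> A \<Longrightarrow> f' (f a) = a" "\<And>b. b \<in> B \<Longrightarrow> f (f' b) = b"
    using diffeo_inverse[OF assms(1)] by metis
  show ?thesis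
    by (rule diffeoI[where g = f']; (rule smooth_map_subset[OF f(1)] smooth_map_subset[OF f(2)])?)
      (use assms(2) f smooth_map_image[OF f(1)] in \<open>auto simp: subset_eq\<close>)
qed

lemma diffeo_openin:
  assumes "diffeo A B f" "openin (top_of_set A) V"
  shows "openin (top_of_set B) (f ` V)"
proof -
  obtain f' where f: "smooth_map A B f" "smooth_map B A f'" "\<And>a. a \<in> A \<Longrightarrow> f' (f a) = a" "\<And>b. b \<in> B \<Longrightarrow> f (f' b) = b"
    using diffeo_inverse[OF assms(1)] by metis
  have "f ` V = B \<inter> f' -` V"
    using openin_imp_subset[OF assms(2)] f smooth_map_image by (force simp: image_iff)
  then show ?thesis
    using continuous_openin_preimage[OF smooth_map_continuous_on[OF f(2)], of A V] smooth_map_image[OF f(2)] assms(2)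
    by auto
qed

lemma diffeo_local:
  assumes "bij_betw f A B" "smooth_map A B f"
    "\<And>b. b \<in> B \<Longrightarrow> \<exists>V. openin (top_of_set B) V \<and> b \<in> V \<and> diffeo (A \<inter> f -` V) V f"
  shows "diffeo A B f"
proof -
  have "smooth_map B A (inv_into A f)"
  proof (rule smooth_map_local)
    fix b assume "b \<in> B"
    then obtain V where V: "openin (top_of_set B) V" "b \<in> V" "diffeo (A \<inter> f -` V) V f" using assms(3) by blast
    obtain g where g: "smooth_map V (A \<inter> f -` V) g" "\<And>b. b \<in> V \<Longrightarrow> f (g b) = b"
      using diffeo_inverse[OF V(3)] by metis
    have "smooth_map V A (inv_into A f)"
    proof (rule smooth_map_cong[of V A g])
      show "smooth_map V A g" by (rule smooth_map_subset[OF g(1)]) (use smooth_map_image[OF g(1)] in auto)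
      show "g x = inv_into A f x" if "x \<in> V" for x
        using g(2)[OF that] smooth_map_image[OF g(1) that] assms(1)
        by (metis IntD1 bij_betw_inv_into_left)
    qed
    then show "\<exists>V. openin (top_of_set B) V \<and> b \<in> V \<and> smooth_map V A (inv_into A f)" using V by blast
  qed
  then show ?thesis using assms by (simp add: diffeo_def)
qed

section \<open>Orthogonal projection modulo a subspace, and linear blowups\<close>

definition operp :: "'a::euclidean_space set \<Rightarrow> 'a \<Rightarrow> 'a" where
  "operp S x = (SOME u. x - u \<in> S \<and> (\<forall>s\<in>S. orthogonal u s))"

lemma
  assumes "subspace S"
  shows operp_diff: "x - operp S x \<in> S"
    and operp_orthogonal: "s \<in> S \<Longrightarrow> orthogonal (operp S x) s"
proof -
  obtain y z where yz: "y \<in> span S" "\<And>w. w \<in> span S \<Longrightarrow> orthogonal z w" "x = y + z"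
    using orthogonal_subspace_decomp_exists[of S x] by metis
  then have "x - z \<in> S \<and> (\<forall>s\<in>S. orthogonal z s)"
    using assms by (simp add: span_eq_iff[THEN iffD2])
  then have *: "x - operp S x \<in> S \<and> (\<forall>s\<in>S. orthogonal (operp S x) s)"
    unfolding operp_def by (rule someI)
  show "x - operp S x \<in> S" using * by simp
  show "orthogonal (operp S x) s" if "s \<in> S" using * that by simp
qed

lemma operp_unique:
  assumes "subspace S" "x - u \<in> S" "\<And>s. s \<in> S \<Longrightarrow> orthogonal u s"
  shows "operp S x = u"
proof -
  have "(x - u) - (x - operp S x) \<in> S"
    by (rule subspace_diff[OF assms(1,2) operp_diff[OF assms(1)]])
  then have S: "operp S x - u \<in> S" by simp
  then have "orthogonal (operp S x - u) (operp S x - u)"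
    using operp_orthogonal[OF assms(1) S, of x] assms(3)[OF S] by (simp add: orthogonal_def inner_diff_left)
  then show ?thesis by (simp add: orthogonal_def)
qed

lemma operp_scaleR: "subspace S \<Longrightarrow> operp S (c *\<^sub>R x) = c *\<^sub>R operp S x"
  by (rule operp_unique)
    (auto simp: scaleR_diff_right[symmetric] orthogonal_clauses operp_orthogonal intro!: subspace_scale operp_diff)

lemma operp_add:
  assumes "subspace S"
  shows "operp S (x + y) = operp S x + operp S y"
proof (rule operp_unique[OF assms])
  have "x + y - (operp S x + operp S y) = (x - operp S x) + (y - operp S y)" by simp
  then show "x + y - (operp S x + operp S y) \<in> S"
    using subspace_add[OF assms operp_diff[OF assms] operp_diff[OF assms]] by metis
qed (simp add: orthogonal_clauses operp_orthogonal assms)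

lemma bounded_linear_operp: "subspace S \<Longrightarrow> bounded_linear (operp S)"
  unfolding linear_conv_bounded_linear[symmetric] by (rule linearI) (simp_all add: operp_add operp_scaleR)

lemma operp_sub: "subspace S \<Longrightarrow> operp S (x - y) = operp S x - operp S y"
  using bounded_linear.linear[OF bounded_linear_operp, of S] by (rule linear_diff)

lemma operp_eq_0_iff: "subspace S \<Longrightarrow> operp S x = 0 \<longleftrightarrow> x \<in> S"
  by (metis diff_zero operp_diff operp_unique orthogonal_clauses(1) orthogonal_commute orthogonal_def inner_zero_left)

lemma operp_ident: "subspace S \<Longrightarrow> (\<And>s. s \<in> S \<Longrightarrow> orthogonal u s) \<Longrightarrow> operp S u = u"
  by (rule operp_unique) (auto simp: subspace_0)

lemma operp_mem: "subspace S \<Longrightarrow> subspace T \<Longrightarrow> S \<subseteq> T \<Longrightarrow> x \<in> T \<Longrightarrow> operp S x \<in> T"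
  using subspace_diff[of T x "x - operp S x"] operp_diff[of S x] by auto

lemma operp_operp: "subspace S \<Longrightarrow> operp S (operp S x) = operp S x"
  by (rule operp_ident) (auto intro: operp_orthogonal)

text \<open>Both defining conditions become equations for the linear map \<open>operp S\<close>: it
  fixes exactly the vectors orthogonal to S, and w - c u lies in S iff w and c u have the same
  image.\<close>

lemma linear_blowup_iff:
  assumes "subspace T" "subspace S" "S \<subseteq> T"
  shows "(w, M) \<in> linear_blowup T S \<longleftrightarrow>
    w \<in> T \<and> (\<exists>u c. M = proj_point u \<and> u \<in> T \<and> u \<noteq> 0 \<and> operp S u = u \<and> operp S w = c *\<^sub>R u)"
proof -
  have *: "(\<forall>s\<in>S. orthogonal u s) \<longleftrightarrow> operp S u = u" for u
    using operp_ident[OF assms(2)] operp_orthogonal[OF assms(2)] by metis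
  have "w - c *\<^sub>R u \<in> S \<longleftrightarrow> operp S w = c *\<^sub>R u" if "operp S u = u" for u c
    using operp_eq_0_iff[OF assms(2), of "w - c *\<^sub>R u"] that
    by (simp add: operp_sub[OF assms(2)] operp_scaleR[OF assms(2)])
  then show ?thesis unfolding linear_blowup_def * by auto
qed

lemma proj_point_scaleR: "k \<noteq> 0 \<Longrightarrow> proj_point (k *\<^sub>R u) = proj_point u"
  by (simp add: proj_point_def)

lemma proj_point_mult_self: "u \<noteq> 0 \<Longrightarrow> proj_point u *v u = u"
  by (simp add: proj_point_mult)

text \<open>Off the centre the component of w normal to S is non-zero and spans the line, so the
  point w determines the line.\<close>

lemma linear_blowup_unique:
  assumes "subspace T" "subspace S" "S \<subseteq> T" "q \<in> linear_blowup T S" "q' \<in> linear_blowup T S"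
    "fst q = fst q'" "fst q \<notin> S"
  shows "q = q'"
proof -
  have "snd q = proj_point (operp S (fst q))" if q: "q \<in> linear_blowup T S" "fst q \<notin> S" for q
  proof -
    obtain u c where u: "snd q = proj_point u" "operp S (fst q) = c *\<^sub>R u"
      using q(1) linear_blowup_iff[OF assms(1-3), of "fst q" "snd q"] by auto
    have "c \<noteq> 0" using q(2) u(2) operp_eq_0_iff[OF assms(2), of "fst q"] by auto
    then show ?thesis using u by (simp add: proj_point_scaleR)
  qed
  then show ?thesis using assms by (metis prod_eqI)
qed

abbreviation blowup_over :: "(real^'m) set \<Rightarrow> (real^'m) set \<Rightarrow> (real^'m) set \<Rightarrow> ((real^'m) \<times> (real^'m^'m)) set" where
  "blowup_over T S W \<equiv> {q \<in> linear_blowup T S. fst q \<in> W}"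

lemma openin_subspace_eventually:
  fixes w u :: "'a::euclidean_space"
  assumes "openin (top_of_set T) W" "subspace T" "w \<in> W" "u \<in> T"
  shows "\<forall>\<^sub>F t in nhds (0::real). w + t *\<^sub>R u \<in> W"
proof -
  obtain Q where Q: "open Q" "W = T \<inter> Q" using assms(1) by (auto simp: openin_open)
  have "((\<lambda>t. w + t *\<^sub>R u) \<longlongrightarrow> w + 0 *\<^sub>R u) (nhds (0::real))"
    by (intro tendsto_intros filterlim_ident)
  then have "\<forall>\<^sub>F t in nhds (0::real). w + t *\<^sub>R u \<in> Q"
    using topological_tendstoD[OF _ Q(1)] assms(3) Q(2) by force
  then show ?thesis
    by (rule eventually_mono) (use Q assms in \<open>auto intro: subspace_add subspace_scale\<close>)
qed

text \<open>Smoothness on W is only given through local extensions F. In directions tangent to T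
  their derivatives are determined by f alone, so any extension may be used to compute them.\<close>

lemma has_vector_derivative_extension:
  fixes F :: "'a::euclidean_space \<Rightarrow> 'b::euclidean_space"
  assumes "openin (top_of_set T) W" "subspace T" "w \<in> W" "u \<in> T"
    and "smooth_on U F" "w \<in> U" "\<And>x. x \<in> W \<Longrightarrow> x \<in> U \<Longrightarrow> F x = f x"
  shows "((\<lambda>t. f (w + t *\<^sub>R u)) has_vector_derivative frechet_derivative F (at w) u) (at 0)"
proof -
  have "((\<lambda>t. w + t *\<^sub>R u) \<longlongrightarrow> w + 0 *\<^sub>R u) (nhds (0::real))"
    by (intro tendsto_intros filterlim_ident)
  then have "\<forall>\<^sub>F t in nhds (0::real). w + t *\<^sub>R u \<in> U"
    using topological_tendstoD[OF _ smooth_on_open[OF assms(5)]] assms(6) by force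
  then have ev: "\<forall>\<^sub>F t in nhds (0::real). f (w + t *\<^sub>R u) = F (w + t *\<^sub>R u)"
    using openin_subspace_eventually[OF assms(1-4)] by eventually_elim (use assms(7) in auto)
  have 1: "((\<lambda>t. w + t *\<^sub>R u) has_derivative (\<lambda>t. t *\<^sub>R u)) (at (0::real))"
    by (auto intro!: derivative_eq_intros)
  have 2: "(F has_derivative frechet_derivative F (at w)) (at (w + 0 *\<^sub>R u))"
    using smooth_on_has_derivative[OF assms(5,6)] by simp
  have lin: "linear (frechet_derivative F (at w))"
    using smooth_on_has_derivative[OF assms(5,6)] by (rule has_derivative_linear)
  have "((\<lambda>t. F (w + t *\<^sub>R u)) has_vector_derivative frechet_derivative F (at w) u) (at 0)"
    using has_derivative_compose[OF 1 2] by (simp add: has_vector_derivative_def linear_scale[OF lin])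
  moreover have "\<forall>\<^sub>F t in nhds (0::real). t \<in> UNIV \<longrightarrow> F (w + t *\<^sub>R u) = f (w + t *\<^sub>R u)"
    using ev by eventually_elim simp
  moreover have "F (w + 0 *\<^sub>R u) = f (w + 0 *\<^sub>R u)" using assms(3,6,7) by simp
  ultimately show ?thesis
    using has_vector_derivative_cong_ev[of UNIV "\<lambda>t. F (w + t *\<^sub>R u)" "\<lambda>t. f (w + t *\<^sub>R u)" 0] by blast
qed

text \<open>S is the kernel of the linear map \<open>operp S\<close>, which annihilates the curve
  near 0 and hence also its velocity.\<close>

lemma derivative_in_subspace:
  fixes \<gamma> :: "real \<Rightarrow> 'a::euclidean_space"
  assumes "(\<gamma> has_vector_derivative v) (at 0)" "subspace S" "\<forall>\<^sub>F t in nhds 0. \<gamma> t \<in> S"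
  shows "v \<in> S"
proof -
  have "((\<lambda>t. operp S (\<gamma> t)) has_vector_derivative operp S v) (at 0)"
    by (rule bounded_linear.has_vector_derivative[OF bounded_linear_operp[OF assms(2)] assms(1)])
  moreover have "\<forall>\<^sub>F t in nhds (0::real). t \<in> UNIV \<longrightarrow> operp S (\<gamma> t) = 0"
    using assms(3) by eventually_elim (simp add: operp_eq_0_iff[OF assms(2)])
  moreover have "operp S (\<gamma> 0) = 0"
    using eventually_nhds_x_imp_x[OF assms(3)] by (simp add: operp_eq_0_iff[OF assms(2)])
  ultimately have "((\<lambda>t. 0) has_vector_derivative operp S v) (at 0)"
    using has_vector_derivative_cong_ev[of UNIV "\<lambda>t. operp S (\<gamma> t)" "\<lambda>t. 0" 0] by blast
  then have "operp S v = 0"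
    using vector_derivative_unique_at has_vector_derivative_const by blast
  then show ?thesis by (simp add: operp_eq_0_iff[OF assms(2)])
qed

text \<open>The chain rule for g (f (w + t u)) = w + t u, with g replaced by its extension G near f
  w. Working along a curve avoids any differential structure on B.\<close>

lemma derivative_left_inverse:
  fixes f :: "'a::euclidean_space \<Rightarrow> 'b::euclidean_space"
  assumes "openin (top_of_set T) W" "subspace T" "w \<in> W" "u \<in> T"
    and "f ` W \<subseteq> B" "\<And>x. x \<in> W \<Longrightarrow> g (f x) = x"
    and "((\<lambda>t. f (w + t *\<^sub>R u)) has_vector_derivative v) (at 0)"
    and "smooth_on U G" "f w \<in> U" "\<And>y. y \<in> B \<Longrightarrow> y \<in> U \<Longrightarrow> G y = g y"
  shows "frechet_derivative G (at (f w)) v = u"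
proof -
  let ?c = "\<lambda>t. f (w + t *\<^sub>R u)"
  have "continuous (at 0) ?c"
    using has_vector_derivative_continuous[OF assms(7)] .
  then have "(?c \<longlongrightarrow> ?c 0) (nhds 0)"
    unfolding continuous_at tendsto_at_iff_tendsto_nhds[of ?c 0] .
  then have "\<forall>\<^sub>F t in nhds 0. ?c t \<in> U"
    by (rule topological_tendstoD[OF _ smooth_on_open[OF assms(8)]]) (use assms(9) in simp)
  then have "\<forall>\<^sub>F t in nhds (0::real). t \<in> UNIV \<longrightarrow> G (?c t) = w + t *\<^sub>R u"
    using openin_subspace_eventually[OF assms(1-4)] by eventually_elim (use assms(5,6,10) in auto)
  moreover have "G (?c 0) = w + 0 *\<^sub>R u" using assms(3,5,6,9,10) by auto
  moreover have "((\<lambda>t. G (?c t)) has_vector_derivative frechet_derivative G (at (f w)) v) (at 0)"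
  proof -
    have G: "(G has_derivative frechet_derivative G (at (f w))) (at (?c 0))"
      using smooth_on_has_derivative[OF assms(8,9)] by simp
    have "linear (frechet_derivative G (at (f w)))"
      using smooth_on_has_derivative[OF assms(8,9)] by (rule has_derivative_linear)
    then show ?thesis
      using has_derivative_compose[OF assms(7)[unfolded has_vector_derivative_def] G]
      by (simp add: has_vector_derivative_def linear_scale)
  qed
  ultimately have "((\<lambda>t. w + t *\<^sub>R u) has_vector_derivative frechet_derivative G (at (f w)) v) (at 0)"
    using has_vector_derivative_cong_ev[of UNIV "\<lambda>t. G (?c t)" "\<lambda>t. w + t *\<^sub>R u" 0] by blast
  moreover have "((\<lambda>t. w + t *\<^sub>R u) has_vector_derivative u) (at 0)"
    by (auto intro!: derivative_eq_intros simp: has_vector_derivative_def)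
  ultimately show ?thesis by (rule vector_derivative_unique_at)
qed

text \<open>The differential of the inverse chart at w has a left inverse on T, so it embeds T into
  the ambient space of V. This guarantees room for a linear model of the right dimension in the
  space that contains the manifold.\<close>

lemma diffeo_dim_le:
  fixes \<phi> :: "'a::euclidean_space \<Rightarrow> 'b::euclidean_space"
  assumes T: "subspace T" "openin (top_of_set T) W" "w \<in> W" and d: "diffeo V W \<phi>"
  shows "dim T \<le> DIM('a)"
proof -
  obtain g where g: "smooth_map V W \<phi>" "smooth_map W V g" "\<And>b. b \<in> W \<Longrightarrow> \<phi> (g b) = b"
    by (rule diffeo_inverse[OF d]; (rule that)?)
  obtain U G where G: "w \<in> U" "smooth_on U G" "\<And>x. x \<in> W \<Longrightarrow> x \<in> U \<Longrightarrow> G x = g x"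
    by (rule smooth_map_extension[OF g(2) T(3)], rule that)
  obtain U' F where F: "g w \<in> U'" "smooth_on U' F" "\<And>x. x \<in> V \<Longrightarrow> x \<in> U' \<Longrightarrow> F x = \<phi> x"
    by (rule smooth_map_extension[OF g(1) smooth_map_image[OF g(2) T(3)]], rule that)
  let ?D = "frechet_derivative G (at w)"
  have lin: "linear ?D" using smooth_on_has_derivative[OF G(2,1)] by (rule has_derivative_linear)
  have left: "frechet_derivative F (at (g w)) (?D u) = u" if "u \<in> T" for u
    by (rule derivative_left_inverse[OF T(2,1,3) that _ g(3) has_vector_derivative_extension[OF T(2,1,3) that G(2,1,3)] F(2,1,3)])
      (use smooth_map_image[OF g(2)] in auto)
  have "span T = T" using T(1) by (simp add: span_eq_iff)
  then have "inj_on ?D (span T)" using left by (metis inj_on_inverseI)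
  then have "dim (?D ` T) = dim T" by (rule dim_image_eq[OF lin])
  then show ?thesis using dim_subset_UNIV[of "?D ` T"] by simp
qed

text \<open>Moving a point of the exceptional divisor along its own direction u leaves the centre
  and keeps the line. Hence identities between continuous maps need only be checked off the
  centre.\<close>

lemma linear_blowup_dense:
  assumes "subspace T" "subspace S" "S \<subseteq> T" "openin (top_of_set T) W" "q \<in> blowup_over T S W"
  obtains \<sigma> where "\<And>k::nat. \<sigma> k \<in> blowup_over T S W" "\<And>k. fst (\<sigma> k) \<notin> S" "\<sigma> \<longlonglongrightarrow> q"
proof -
  obtain w u c where q: "q = (w, proj_point u)" "w \<in> T" "u \<in> T" "u \<noteq> 0" "operp S u = u" "operp S w = c *\<^sub>R u" "w \<in> W"
    using assms(5) linear_blowup_iff[OF assms(1-3), of "fst q" "snd q"] by (cases q) auto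
  show ?thesis
  proof (cases "w \<in> S")
    case False
    then show ?thesis using that[of "\<lambda>_. q"] assms(5) q(1) by auto
  next
    case True
    have lim: "(\<lambda>k. inverse (real (Suc k))) \<longlonglongrightarrow> 0" by (rule LIMSEQ_inverse_real_of_nat)
    have "\<forall>\<^sub>F k in sequentially. w + inverse (real (Suc k)) *\<^sub>R u \<in> W"
      by (rule eventually_compose_filterlim[OF openin_subspace_eventually[OF assms(4,1) q(7,3)] lim])
    then obtain N where N: "\<And>k. k \<ge> N \<Longrightarrow> w + inverse (real (Suc k)) *\<^sub>R u \<in> W"
      by (auto simp: eventually_sequentially)
    \<comment> \<open>The shift by N keeps all terms in W, and \<open>Suc\<close> keeps the
      coefficients of u non-zero.\<close>
    let ?s = "\<lambda>k. (w + inverse (real (Suc (k + N))) *\<^sub>R u, proj_point u)"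
    have "?s \<longlonglongrightarrow> (w + 0 *\<^sub>R u, proj_point u)"
      by (intro tendsto_intros LIMSEQ_ignore_initial_segment[OF lim])
    then have lim': "?s \<longlonglongrightarrow> q" using q(1) by simp
    have op: "operp S (w + a *\<^sub>R u) = a *\<^sub>R u" for a
      using True q(5) by (simp add: operp_add operp_scaleR assms(2) operp_eq_0_iff[THEN iffD2])
    have "?s k \<in> linear_blowup T S" for k
    proof -
      have "w + inverse (real (Suc (k + N))) *\<^sub>R u \<in> T"
        by (intro subspace_add subspace_scale assms(1) q)
      then show ?thesis
        unfolding linear_blowup_iff[OF assms(1-3)] using q(3-5) op by blast
    qed
    then have 1: "?s k \<in> blowup_over T S W" for k using N[of "k + N"] by simp
    have 2: "fst (?s k) \<notin> S" for k
      using op[of "inverse (real (Suc (k + N)))"] q(4) operp_eq_0_iff[OF assms(2), of "fst (?s k)"] by auto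
    show ?thesis by (rule that[OF 1 2 lim'])
  qed
qed

section \<open>Lifting diffeomorphisms to blowups\<close>

lemma blowup_over_cases:
  assumes "subspace T" "subspace S" "S \<subseteq> T" "q \<in> blowup_over T S W"
  obtains w u c where "q = (w, proj_point u)" "w \<in> W" "w \<in> T" "u \<in> T" "u \<noteq> 0" "operp S u = u" "operp S w = c *\<^sub>R u"
  using assms(4) linear_blowup_iff[OF assms(1-3), of "fst q" "snd q"] by (cases q) auto

lemma blowup_overI:
  assumes "subspace T" "subspace S" "S \<subseteq> T"
    "w \<in> W" "w \<in> T" "u \<in> T" "u \<noteq> 0" "operp S u = u" "operp S w = c *\<^sub>R u"
  shows "(w, proj_point u) \<in> blowup_over T S W"
  using assms linear_blowup_iff[OF assms(1-3), of w "proj_point u"] by auto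

text \<open>Over the centre, the lift sends a normal direction to its image under the differential; that this
  glues smoothly with \<open>f\<close> off the centre is Hadamard's lemma: the component of \<open>f (s + t u)\<close> normal to
  \<open>S'\<close> is \<open>t\<close> times a smooth function.\<close>

lemma blowup_lift_smooth:
  fixes f :: "real^'m \<Rightarrow> real^'k"
  assumes T: "subspace T" "subspace S" "S \<subseteq> T" "openin (top_of_set T) W"
    and T': "subspace T'" "subspace S'" "S' \<subseteq> T'" "openin (top_of_set T') W'"
    and f: "smooth_map W W' f" and g: "smooth_map W' W g"
    and gf: "\<And>x. x \<in> W \<Longrightarrow> g (f x) = x" and fg: "\<And>y. y \<in> W' \<Longrightarrow> f (g y) = y"
    and iff: "\<And>x. x \<in> W \<Longrightarrow> f x \<in> S' \<longleftrightarrow> x \<in> S"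
  obtains \<Lambda> where "smooth_map (blowup_over T S W) (blowup_over T' S' W') \<Lambda>"
    "\<And>q. q \<in> blowup_over T S W \<Longrightarrow> fst (\<Lambda> q) = f (fst q)"
proof -
  have WT: "W \<subseteq> T" and WT': "W' \<subseteq> T'" using T(4) T'(4) by (auto dest: openin_imp_subset)
  have fW: "f x \<in> W'" if "x \<in> W" for x using smooth_map_image[OF f that] .
  \<comment> \<open>The directional derivative computed from f itself, so that it does not depend on
    the local extension chosen at a point.\<close>
  define D where "D w u = vector_derivative (\<lambda>t. f (w + t *\<^sub>R u)) (at 0)" for w u
  have D: "frechet_derivative F (at w) u = D w u" "((\<lambda>t. f (w + t *\<^sub>R u)) has_vector_derivative D w u) (at 0)"
    if "w \<in> W" "u \<in> T" "smooth_on U F" "w \<in> U" "\<And>x. x \<in> W \<Longrightarrow> x \<in> U \<Longrightarrow> F x = f x" for w u U F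
  proof -
    have *: "((\<lambda>t. f (w + t *\<^sub>R u)) has_vector_derivative frechet_derivative F (at w) u) (at 0)"
      by (rule has_vector_derivative_extension[OF T(4,1) that])
    then show "frechet_derivative F (at w) u = D w u" unfolding D_def by (rule vector_derivative_at[symmetric])
    with * show "((\<lambda>t. f (w + t *\<^sub>R u)) has_vector_derivative D w u) (at 0)" by simp
  qed
  have D': "((\<lambda>t. f (w + t *\<^sub>R u)) has_vector_derivative D w u) (at 0)" if wu: "w \<in> W" "u \<in> T" for w u
    by (rule smooth_map_extension[OF f wu(1)]) (rule D(2)[OF wu])
  have DT': "D w u \<in> T'" if wu: "w \<in> W" "u \<in> T" for w u
    by (rule derivative_in_subspace[OF D'[OF wu] T'(1)])
      (rule eventually_mono[OF openin_subspace_eventually[OF T(4,1) wu]], use fW WT' in auto)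
  \<comment> \<open>If \<open>D w u\<close> were tangent to S', the line through f w in this
    direction would stay in S' and g would carry it into S. Its image has velocity u, so u would lie
    in S, although it is normal to S and non-zero.\<close>
  have D_nz: "operp S' (D w u) \<noteq> 0" if wu: "w \<in> W" "w \<in> S" "u \<in> T" "u \<noteq> 0" "operp S u = u" for w u
  proof
    assume "operp S' (D w u) = 0"
    then have DS': "D w u \<in> S'" by (simp add: operp_eq_0_iff T')
    obtain V G where V: "f w \<in> V" "smooth_on V G" "\<And>x. x \<in> W' \<Longrightarrow> x \<in> V \<Longrightarrow> G x = g x"
      using smooth_map_extension[OF g fW[OF wu(1)]] by metis
    have u: "frechet_derivative G (at (f w)) (D w u) = u"
      by (rule derivative_left_inverse[OF T(4,1) wu(1,3) _ gf D'[OF wu(1,3)] V(2,1,3)]) (use fW in auto)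
    have DT: "D w u \<in> T'" using DS' T'(3) by auto
    have "((\<lambda>t. g (f w + t *\<^sub>R D w u)) has_vector_derivative u) (at 0)"
      using has_vector_derivative_extension[OF T'(4,1) fW[OF wu(1)] DT V(2,1,3)] u by simp
    moreover have "\<forall>\<^sub>F t in nhds 0. g (f w + t *\<^sub>R D w u) \<in> S"
      using openin_subspace_eventually[OF T'(4,1) fW[OF wu(1)] DT]
    proof eventually_elim
      case (elim t)
      have "f w + t *\<^sub>R D w u \<in> S'"
        using iff[OF wu(1)] wu(2) DS' by (intro subspace_add subspace_scale T') auto
      then show ?case using iff[of "g (f w + t *\<^sub>R D w u)"] fg[OF elim] smooth_map_image[OF g elim] by simp
    qed
    ultimately have "u \<in> S" by (rule derivative_in_subspace[OF _ T(2)])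
    then show False using wu(4,5) operp_eq_0_iff[OF T(2), of u] by simp
  qed
  \<comment> \<open>An arbitrary spanning vector of the line, chosen without any continuity. Only
    the line through \<open>d q\<close> enters the lift, and rescaling \<open>rep q\<close> does not
    change it.\<close>
  define rep where "rep q = (SOME u. snd q = proj_point u \<and> u \<in> T \<and> u \<noteq> 0 \<and> operp S u = u)" for q :: "(real^'m) \<times> (real^'m^'m)"
  have rep: "snd q = proj_point (rep q) \<and> rep q \<in> T \<and> rep q \<noteq> 0 \<and> operp S (rep q) = rep q"
    if q: "q \<in> blowup_over T S W" for q
  proof -
    obtain w u c where "q = (w, proj_point u)" "w \<in> W" "w \<in> T" "u \<in> T" "u \<noteq> 0" "operp S u = u" "operp S w = c *\<^sub>R u"
      by (rule blowup_over_cases[OF T(1-3) q])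
    then have "snd q = proj_point u \<and> u \<in> T \<and> u \<noteq> 0 \<and> operp S u = u" by simp
    then show ?thesis unfolding rep_def by (rule someI)
  qed
  define d where "d q = (if fst q \<in> S then operp S' (D (fst q) (rep q)) else operp S' (f (fst q)))" for q
  define \<Lambda> where "\<Lambda> q = (f (fst q), proj_point (d q))" for q
  have mem: "\<Lambda> q \<in> blowup_over T' S' W'" if q: "q \<in> blowup_over T S W" for q
  proof -
    obtain w u c where wu: "q = (w, proj_point u)" "w \<in> W" "w \<in> T" "u \<in> T" "u \<noteq> 0" "operp S u = u" "operp S w = c *\<^sub>R u"
      by (rule blowup_over_cases[OF T(1-3) q])
    have fw: "f w \<in> W'" "f w \<in> T'" using fW wu WT' by auto
    note r = rep[OF q]
    have dT: "d q \<in> T'"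
      using fw(2) DT'[OF wu(2), of "rep q"] r wu(1) by (auto simp: d_def intro!: operp_mem T')
    have dd: "operp S' (d q) = d q" by (simp add: d_def operp_operp[OF T'(2)])
    have dnz: "d q \<noteq> 0"
      using D_nz[OF wu(2), of "rep q"] r wu(1) iff[OF wu(2)] by (auto simp: d_def operp_eq_0_iff[OF T'(2)])
    have "operp S' (f w) = (if w \<in> S then 0 else 1) *\<^sub>R d q"
      using wu(1) iff[OF wu(2)] by (auto simp: d_def operp_eq_0_iff[OF T'(2)])
    from blowup_overI[OF T'(1-3) fw dT dnz dd this] show ?thesis
      by (simp add: \<Lambda>_def wu(1))
  qed
  have "\<exists>U F. q \<in> U \<and> smooth_on U F \<and> (\<forall>p\<in>blowup_over T S W \<inter> U. F p = \<Lambda> p)" if q: "q \<in> blowup_over T S W" for q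
  proof -
    obtain w0 u0 c0 where q0: "q = (w0, proj_point u0)" "w0 \<in> W" "w0 \<in> T" "u0 \<in> T" "u0 \<noteq> 0" "operp S u0 = u0" "operp S w0 = c0 *\<^sub>R u0"
      by (rule blowup_over_cases[OF T(1-3) q])
    obtain U F where U: "w0 \<in> U" "smooth_on U F" "\<And>x. x \<in> W \<Longrightarrow> x \<in> U \<Longrightarrow> F x = f x"
      using smooth_map_extension[OF f q0(2)] by metis
    have bl': "bounded_linear (operp S')" by (rule bounded_linear_operp[OF T'(2)])
    show ?thesis
    proof (cases "w0 \<in> S")
      case False
      have sF: "smooth_on U (\<lambda>x. operp S' (F x))" by (rule smooth_on_bounded_linear[OF bl' U(2)])
      define U2 where "U2 = U \<inter> (\<lambda>x. operp S' (F x)) -` (- {0})"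
      have oU2: "open U2"
        unfolding U2_def by (rule smooth_on_open_vimage[OF sF]) auto
      have o: "open (fst -` U2 :: ((real^'m) \<times> (real^'m^'m)) set)" by (intro open_vimage oU2 continuous_intros)
      have s2: "smooth_on U2 F" "smooth_on U2 (\<lambda>x. operp S' (F x))"
        by (rule smooth_on_subset[OF U(2) oU2], force simp: U2_def) (rule smooth_on_subset[OF sF oU2], force simp: U2_def)
      have s3: "smooth_on U2 (\<lambda>x. (F x, proj_point (operp S' (F x))))"
        by (rule smooth_on_Pair[OF s2(1) smooth_on_proj_point[OF s2(2)]]) (auto simp: U2_def)
      have s4: "smooth_on (fst -` U2) (\<lambda>p::(real^'m) \<times> (real^'m^'m). (F (fst p), proj_point (operp S' (F (fst p)))))"
        by (rule smooth_on_compose[OF smooth_on_fst[OF smooth_on_ident[OF o]] s3]) auto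
      have "operp S' (F w0) \<noteq> 0" using U(1,3) q0(2) iff[OF q0(2)] False by (simp add: operp_eq_0_iff[OF T'(2)])
      then have "q \<in> fst -` U2" using U(1) q0(1) by (simp add: U2_def)
      moreover have "(F (fst p), proj_point (operp S' (F (fst p)))) = \<Lambda> p" if "p \<in> blowup_over T S W" "p \<in> fst -` U2" for p
      proof -
        have *: "fst p \<in> W" "fst p \<in> U" "operp S' (F (fst p)) \<noteq> 0" using that by (auto simp: U2_def)
        then have "F (fst p) = f (fst p)" "fst p \<notin> S" using U(3) iff[of "fst p"] operp_eq_0_iff[OF T'(2)] by auto
        then show ?thesis by (simp add: \<Lambda>_def d_def)
      qed
      ultimately show ?thesis
        using s4 by (intro exI[of _ "fst -` U2"] exI[of _ "\<lambda>p. (F (fst p), proj_point (operp S' (F (fst p))))"]) auto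
    next
      case True
      obtain Q where Q: "open Q" "W = T \<inter> Q" using T(4) by (auto simp: openin_open)
      obtain e where e: "e > 0" "ball w0 e \<subseteq> U \<inter> Q"
        using open_contains_ball[of "U \<inter> Q"] smooth_on_open[OF U(2)] Q U(1) q0(2) by (metis IntI IntD2 open_Int)
      let ?B = "ball w0 e"
      have sF: "smooth_on ?B F" by (rule smooth_on_subset[OF U(2)]) (use e in auto)
      have FB: "F x = f x" "x \<in> W" if "x \<in> T" "x \<in> ?B" for x
        using that subsetD[OF e(2), of x] Q(2) U(3)[of x] by auto
      obtain h where h: "smooth_on {(s, t, u). s \<in> ?B \<and> s + t *\<^sub>R u \<in> ?B} h"
        "\<And>s t u. s \<in> ?B \<Longrightarrow> s + t *\<^sub>R u \<in> ?B \<Longrightarrow> F (s + t *\<^sub>R u) - F s = t *\<^sub>R h (s, t, u)"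
        "\<And>s u. s \<in> ?B \<Longrightarrow> h (s, 0, u) = frechet_derivative F (at s) u"
        by (rule hadamard[OF sF convex_ball], rule that)
      \<comment> \<open>Projecting the fixed vector \<open>u0\<close> to the line of p gives a
        spanning vector that depends smoothly on p and is non-zero near q. With it, the point of p
        decomposes as s p + t p u p, with s p in S.\<close>
      define u where "u p = snd p *v u0" for p :: "(real^'m) \<times> (real^'m^'m)"
      define s where "s p = fst p - operp S (fst p)" for p :: "(real^'m) \<times> (real^'m^'m)"
      define t where "t p = (operp S (fst p) \<bullet> u p) / (u p \<bullet> u p)" for p
      \<comment> \<open>The normal component of Hadamard's quotient: it spans the image line both
        off the centre, where it is a multiple of the normal component of f, and on it, where it is
        that of the differential.\<close>
      define k where "k p = operp S' (h (s p, t p, u p))" for p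
      have su: "smooth_on UNIV u" and ss: "smooth_on UNIV s"
        unfolding u_def s_def
        by (intro smooth_on_matrix_vector_mult smooth_on_diff smooth_on_fst smooth_on_snd smooth_on_ident
            smooth_on_const smooth_on_bounded_linear[OF bounded_linear_operp[OF T(2)]] open_UNIV)+
      define Q1 where "Q1 = u -` (- {0})"
      have oQ1: "open Q1"
        unfolding Q1_def using smooth_on_imp_continuous[OF su] by (intro open_vimage) auto
      have s1: "smooth_on Q1 s" "smooth_on Q1 u" using su ss oQ1 smooth_on_subset by blast+
      have st: "smooth_on Q1 t" unfolding t_def
        by (intro smooth_on_divide smooth_on_inner s1 smooth_on_fst smooth_on_ident oQ1
            smooth_on_bounded_linear[OF bounded_linear_operp[OF T(2)]]) (auto simp: Q1_def)
      have sc: "smooth_on Q1 (\<lambda>p. (s p, t p, u p))" by (intro smooth_on_Pair s1 st)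
      define Q2 where "Q2 = Q1 \<inter> (\<lambda>p. (s p, t p, u p)) -` {(s, t, u). s \<in> ?B \<and> s + t *\<^sub>R u \<in> ?B}"
      have oQ2: "open Q2"
        unfolding Q2_def by (rule smooth_on_open_vimage[OF sc smooth_on_open[OF h(1)]])
      have sc2: "smooth_on Q2 (\<lambda>p. (s p, t p, u p))" by (rule smooth_on_subset[OF sc oQ2]) (auto simp: Q2_def)
      have sh: "smooth_on Q2 (\<lambda>p. h (s p, t p, u p))"
        by (rule smooth_on_compose[OF sc2 h(1)]) (auto simp: Q2_def)
      have sk: "smooth_on Q2 k"
        unfolding k_def by (rule smooth_on_bounded_linear[OF bl' sh])
      \<comment> \<open>Here the line of \<open>k p\<close> is defined. The point q belongs to this
        set because \<open>k q\<close> is the normal component of \<open>D w0 u0\<close>, which does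
        not vanish by \<open>D_nz\<close>.\<close>
      define Q3 where "Q3 = Q2 \<inter> k -` (- {0}) \<inter> fst -` ?B"
      have "open (Q2 \<inter> k -` (- {0}))"
        by (rule smooth_on_open_vimage[OF sk]) auto
      then have oQ3: "open Q3" unfolding Q3_def by (rule open_Int) (intro open_vimage open_ball continuous_intros)
      have sk3: "smooth_on Q3 k" by (rule smooth_on_subset[OF sk oQ3]) (auto simp: Q3_def)
      have sF3: "smooth_on Q3 (\<lambda>p. F (fst p))"
        by (rule smooth_on_compose[OF smooth_on_fst[OF smooth_on_ident[OF oQ3]] sF]) (auto simp: Q3_def)
      have sG: "smooth_on Q3 (\<lambda>p. (F (fst p), proj_point (k p)))"
        by (rule smooth_on_Pair[OF sF3 smooth_on_proj_point[OF sk3]]) (auto simp: Q3_def)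
      have w00: "operp S w0 = 0" using True by (simp add: operp_eq_0_iff[OF T(2)])
      have uq: "u q = u0" "s q = w0" "t q = 0"
        using q0(1,5) w00 by (simp_all add: u_def s_def t_def proj_point_mult_self)
      have kq: "k q = operp S' (D w0 u0)"
        using D(1)[OF q0(2,4) U(2,1,3)] h(3)[of w0 u0] e(1) by (simp add: k_def uq)
      have "q \<in> Q3"
        using q0 uq e(1) D_nz[OF q0(2) True q0(4-6)] kq by (auto simp: Q3_def Q2_def Q1_def)
      moreover have "(F (fst p), proj_point (k p)) = \<Lambda> p" if p: "p \<in> blowup_over T S W" "p \<in> Q3" for p
      proof -
        have p3: "u p \<noteq> 0" "s p \<in> ?B" "s p + t p *\<^sub>R u p \<in> ?B" "k p \<noteq> 0" "fst p \<in> ?B" "fst p \<in> W" "fst p \<in> T"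
          using p(2) p(1) WT by (auto simp: Q3_def Q2_def Q1_def)
        define v where "v = rep p"
        have v: "snd p = proj_point v" "v \<in> T" "v \<noteq> 0" "operp S v = v" using rep[OF p(1)] by (auto simp: v_def)
        obtain a where a: "u p = a *\<^sub>R v" using v(1) by (auto simp: u_def proj_point_mult)
        have a0: "a \<noteq> 0" using p3(1) a by auto
        have uT: "u p \<in> T" using a v by (simp add: subspace_scale T)
        obtain w1 u1 c1 where c1: "p = (w1, proj_point u1)" "u1 \<noteq> 0" "operp S w1 = c1 *\<^sub>R u1"
          using blowup_over_cases[OF T(1-3) p(1)] by metis
        obtain b where b: "u1 = b *\<^sub>R v"
          using v(1,3) c1(1,2) proj_point_eq_iff[of v u1] by auto
        have op: "operp S (fst p) = t p *\<^sub>R u p"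
        proof -
          have "operp S (fst p) = (c1 * b / a) *\<^sub>R u p" using c1 b a a0 by simp
          then show ?thesis using p3(1) by (simp add: t_def)
        qed
        have fp: "fst p = s p + t p *\<^sub>R u p" by (simp add: s_def op)
        have sS: "s p \<in> S" unfolding s_def by (rule operp_diff[OF T(2)])
        then have sW: "s p \<in> W" "F (s p) = f (s p)" using FB[OF _ p3(2)] T(3) by auto
        have Ff: "F (fst p) = f (fst p)" using FB(1)[OF p3(7,5)] .
        have Fs: "operp S' (F (s p)) = 0" using iff[OF sW(1)] sS sW(2) by (simp add: operp_eq_0_iff[OF T'(2)])
        have "operp S' (F (fst p) - F (s p)) = t p *\<^sub>R k p"
          using h(2)[OF p3(2,3)] fp by (simp add: k_def operp_scaleR[OF T'(2)])
        then have tk: "operp S' (f (fst p)) = t p *\<^sub>R k p"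
          using Fs Ff by (simp add: operp_sub[OF T'(2)])
        \<comment> \<open>Off the centre \<open>k p\<close> and \<open>d p\<close> differ by the
          factor t p; on the centre t p = 0 and they differ by the factor a between
          \<open>u p\<close> and the chosen representative.\<close>
        have "proj_point (k p) = proj_point (d p)"
        proof (cases "fst p \<in> S")
          case False
          then have "operp S' (f (fst p)) \<noteq> 0" using iff[OF p3(6)] by (simp add: operp_eq_0_iff[OF T'(2)])
          then have "t p \<noteq> 0" using tk by auto
          then show ?thesis using False tk by (simp add: d_def proj_point_scaleR)
        next
          case inS: True
          then have "operp S (fst p) = 0" by (simp add: operp_eq_0_iff[OF T(2)])
          then have t0: "t p = 0" by (simp add: t_def)
          then have sp: "s p = fst p" using fp by simp
          have pU: "fst p \<in> U" using subsetD[OF e(2) p3(5)] by simp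
          have lin: "linear (frechet_derivative F (at (fst p)))"
            using smooth_on_has_derivative[OF U(2) pU] by (rule has_derivative_linear)
          have "k p = operp S' (frechet_derivative F (at (fst p)) (a *\<^sub>R v))"
            using h(3)[OF p3(2), of "u p"] t0 sp a by (simp add: k_def)
          also have "\<dots> = a *\<^sub>R operp S' (D (fst p) v)"
            using D(1)[OF p3(6) v(2) U(2) pU U(3)] by (simp add: linear_scale[OF lin] operp_scaleR[OF T'(2)])
          finally show ?thesis using inS a0 by (simp add: d_def v_def proj_point_scaleR)
        qed
        then show ?thesis by (simp add: \<Lambda>_def Ff)
      qed
      ultimately show ?thesis
        using sG by (intro exI[of _ Q3] exI[of _ "\<lambda>p. (F (fst p), proj_point (k p))"]) auto
    qed
  qed
  then have "smooth_map (blowup_over T S W) (blowup_over T' S' W') \<Lambda>"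
    unfolding smooth_map_iff using mem by (intro conjI ballI) auto
  then show ?thesis by (rule that) (simp add: \<Lambda>_def)
qed

text \<open>Both f and its inverse lift. Off the centre the composites of the lifts are the identity
  because the line is determined by the point, and density extends this over the exceptional
  divisor.\<close>

lemma blowup_lift_diffeo:
  fixes f :: "real^'m \<Rightarrow> real^'k"
  assumes T: "subspace T" "subspace S" "S \<subseteq> T" "openin (top_of_set T) W"
    and T': "subspace T'" "subspace S'" "S' \<subseteq> T'" "openin (top_of_set T') W'"
    and f: "diffeo W W' f" and iff: "\<And>x. x \<in> W \<Longrightarrow> f x \<in> S' \<longleftrightarrow> x \<in> S"
  obtains \<Lambda> where "diffeo (blowup_over T S W) (blowup_over T' S' W') \<Lambda>"
    "\<And>q. q \<in> blowup_over T S W \<Longrightarrow> fst (\<Lambda> q) = f (fst q)"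
proof -
  have ident: "M (L q) = q" if T: "subspace T" "subspace S" "S \<subseteq> T" "openin (top_of_set T) W"
    and L: "smooth_map (blowup_over T S W) B L" and M: "smooth_map B (blowup_over T S W) M"
    and id: "\<And>q. q \<in> blowup_over T S W \<Longrightarrow> fst (M (L q)) = fst q" and q: "q \<in> blowup_over T S W"
    for T S W :: "(real^'a) set" and B :: "((real^'b) \<times> (real^'b^'b)) set" and L M q
  proof -
    obtain \<sigma> where \<sigma>: "\<And>k::nat. \<sigma> k \<in> blowup_over T S W" "\<And>k. fst (\<sigma> k) \<notin> S" "\<sigma> \<longlonglongrightarrow> q"
      by (rule linear_blowup_dense[OF T q], rule that)
    have LM: "smooth_map (blowup_over T S W) (blowup_over T S W) (\<lambda>q. M (L q))"
      by (rule smooth_map_compose[OF L M])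
    have "(\<lambda>k. M (L (\<sigma> k))) \<longlonglongrightarrow> M (L q)"
      by (rule continuous_on_tendsto_compose[OF smooth_map_continuous_on[OF LM] \<sigma>(3) q]) (use \<sigma>(1) in auto)
    moreover have "M (L (\<sigma> k)) = \<sigma> k" for k
      using smooth_map_image[OF LM \<sigma>(1)[of k]] \<sigma>(1)[of k] id[OF \<sigma>(1)[of k]] \<sigma>(2)[of k]
      by (intro linear_blowup_unique[OF T(1-3)]) auto
    ultimately have "\<sigma> \<longlonglongrightarrow> M (L q)" by simp
    then show ?thesis using \<sigma>(3) by (rule LIMSEQ_unique)
  qed
  obtain g where g: "smooth_map W W' f" "smooth_map W' W g" "\<And>a. a \<in> W \<Longrightarrow> g (f a) = a" "\<And>b. b \<in> W' \<Longrightarrow> f (g b) = b"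
    using diffeo_inverse[OF f] by metis
  have iff': "g y \<in> S \<longleftrightarrow> y \<in> S'" if "y \<in> W'" for y
    using iff[OF smooth_map_image[OF g(2) that]] g(4)[OF that] by simp
  obtain L where L: "smooth_map (blowup_over T S W) (blowup_over T' S' W') L"
    "\<And>q. q \<in> blowup_over T S W \<Longrightarrow> fst (L q) = f (fst q)"
    by (rule blowup_lift_smooth[OF T T' g iff]; (rule that)?)
  obtain M where M: "smooth_map (blowup_over T' S' W') (blowup_over T S W) M"
    "\<And>q. q \<in> blowup_over T' S' W' \<Longrightarrow> fst (M q) = g (fst q)"
    by (rule blowup_lift_smooth[OF T' T g(2,1,4,3) iff']; (rule that)?)
  have "diffeo (blowup_over T S W) (blowup_over T' S' W') L"
  proof (rule diffeoI[OF L(1) M(1)])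
    show "M (L q) = q" if "q \<in> blowup_over T S W" for q
      by (rule ident[OF T L(1) M(1) _ that]) (use L(2) M(2) g(3) smooth_map_image[OF L(1)] in auto)
    show "L (M q) = q" if "q \<in> blowup_over T' S' W'" for q
      by (rule ident[OF T' M(1) L(1) _ that]) (use L(2) M(2) g(4) smooth_map_image[OF M(1)] in auto)
  qed
  then show ?thesis by (rule that[OF _ L(2)])
qed

section \<open>Proper transforms of flat arrangements\<close>

lemma linear_blowup_cases:
  assumes "subspace T" "subspace S" "S \<subseteq> T" "q \<in> linear_blowup T S"
  obtains w u c where "q = (w, proj_point u)" "w \<in> T" "u \<in> T" "u \<noteq> 0" "operp S u = u" "operp S w = c *\<^sub>R u"
  using assms(4) linear_blowup_iff[OF assms(1-3), of "fst q" "snd q"] by (cases q) auto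

lemma linear_blowupI:
  assumes "subspace T" "subspace S" "S \<subseteq> T"
    "w \<in> T" "u \<in> T" "u \<noteq> 0" "operp S u = u" "operp S w = c *\<^sub>R u"
  shows "(w, proj_point u) \<in> linear_blowup T S"
  using assms linear_blowup_iff[OF assms(1-3), of w "proj_point u"] by auto

text \<open>Writing \<open>x = s + t e + y\<close> with \<open>s \<in> S\<close> and \<open>y\<close> orthogonal to \<open>S\<close> and to the unit vector \<open>e\<close>, the
  chart is \<open>x \<mapsto> (s + t (e + y), [e + y])\<close>. The proper transform of a subspace \<open>R\<close> containing \<open>S\<close> and \<open>e\<close>
  is again \<open>R\<close> in this chart, so linear arrangements stay linear.\<close>

definition blowup_chart :: "(real^'m) set \<Rightarrow> real^'m \<Rightarrow> real^'m \<Rightarrow> (real^'m) \<times> (real^'m^'m)" where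
  "blowup_chart S e x =
     (let n = operp S x; t = n \<bullet> e; u = e + (n - t *\<^sub>R e) in (x - n + t *\<^sub>R u, proj_point u))"

text \<open>The inverse of the chart. On a line with projection matrix M that is not orthogonal to
  e, the vector M e / (e . M e) is the one whose inner product with e is 1; subtracting e returns y.
  Since S is orthogonal to e, the product of the point with e returns t.\<close>

definition blowup_coords :: "(real^'m) set \<Rightarrow> real^'m \<Rightarrow> (real^'m) \<times> (real^'m^'m) \<Rightarrow> real^'m" where
  "blowup_coords S e q =
     fst q - operp S (fst q) + (fst q \<bullet> e) *\<^sub>R e + (inverse (e \<bullet> (snd q *v e)) *\<^sub>R (snd q *v e) - e)"

text \<open>The claims hold for every R containing S and e: taking R = T shows that this is a chart
  of the blowup, and taking R to be the model of another centre shows that the same chart flattens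
  its proper transform.\<close>

lemma
  assumes S: "subspace S" and e: "e \<bullet> e = 1" "operp S e = e"
  shows blowup_coords_chart: "blowup_coords S e (blowup_chart S e x) = x"
    and blowup_chart_dom: "e \<bullet> (snd (blowup_chart S e x) *v e) \<noteq> 0"
    and blowup_chart_mem: "subspace R \<Longrightarrow> S \<subseteq> R \<Longrightarrow> e \<in> R \<Longrightarrow> x \<in> R \<Longrightarrow> blowup_chart S e x \<in> linear_blowup R S"
    and blowup_coords_mem: "subspace R \<Longrightarrow> S \<subseteq> R \<Longrightarrow> e \<in> R \<Longrightarrow> q \<in> linear_blowup R S \<Longrightarrow>
      e \<bullet> (snd q *v e) \<noteq> 0 \<Longrightarrow> blowup_coords S e q \<in> R \<and> blowup_chart S e (blowup_coords S e q) = q"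
proof -
  have oe: "s \<bullet> e = 0" if "s \<in> S" for s
    using operp_orthogonal[OF S that, of e] e(2) by (simp add: orthogonal_def inner_commute)
  have ne: "operp S x \<bullet> e = x \<bullet> e" for x
    using oe[OF operp_diff[OF S, of x]] by (simp add: inner_diff_left)
  define n where "n = operp S x"
  define t where "t = n \<bullet> e"
  define u where "u = e + (n - t *\<^sub>R e)"
  have c: "blowup_chart S e x = (x - n + t *\<^sub>R u, proj_point u)"
    by (simp add: blowup_chart_def n_def t_def u_def Let_def)
  have nn: "operp S n = n" by (simp add: n_def operp_operp[OF S])
  have uu: "operp S u = u"
    by (simp add: u_def operp_add[OF S] operp_sub[OF S] operp_scaleR[OF S] nn e(2))
  have ue: "u \<bullet> e = 1"
    by (simp add: u_def inner_add_left inner_diff_left t_def e(1))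
  then have u0: "u \<noteq> 0" by auto
  have xn: "x - n \<in> S" unfolding n_def by (rule operp_diff[OF S])
  have "operp S (x - n) = 0" using xn by (simp add: operp_eq_0_iff[OF S])
  then have opw: "operp S (x - n + t *\<^sub>R u) = t *\<^sub>R u"
    by (simp add: operp_add[OF S] operp_scaleR[OF S] uu)
  have pe: "proj_point u *v e = (1 / (u \<bullet> u)) *\<^sub>R u" by (simp add: proj_point_mult ue)
  then have epe: "e \<bullet> (proj_point u *v e) = 1 / (u \<bullet> u)" using ue by (simp add: inner_commute)
  show "blowup_coords S e (blowup_chart S e x) = x"
  proof -
    have f1: "(x - n + t *\<^sub>R u) \<bullet> e = t" by (simp add: inner_add_left ue oe[OF xn])
    have f2: "inverse (e \<bullet> (proj_point u *v e)) *\<^sub>R (proj_point u *v e) = u"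
      unfolding pe using u0 ue by (simp add: inner_commute[of e u])
    have "x - n + t *\<^sub>R e + (u - e) = x" by (simp add: u_def)
    then show ?thesis unfolding blowup_coords_def c fst_conv snd_conv opw f1 f2 by simp
  qed
  show "e \<bullet> (snd (blowup_chart S e x) *v e) \<noteq> 0"
    unfolding c using epe u0 by simp
  show "blowup_chart S e x \<in> linear_blowup R S" if "subspace R" "S \<subseteq> R" "e \<in> R" "x \<in> R"
  proof -
    have "n \<in> R" unfolding n_def by (rule operp_mem[OF S that(1,2,4)])
    then have "u \<in> R" unfolding u_def using that by (intro subspace_add subspace_diff subspace_scale)
    moreover have "x - n + t *\<^sub>R u \<in> R"
      using xn that(2) \<open>u \<in> R\<close> that(1) by (intro subspace_add subspace_scale) auto
    ultimately show ?thesis unfolding c using u0 uu opw by (intro linear_blowupI[OF that(1) S that(2)])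
  qed
  show "blowup_coords S e q \<in> R \<and> blowup_chart S e (blowup_coords S e q) = q"
    if R: "subspace R" "S \<subseteq> R" "e \<in> R" and q: "q \<in> linear_blowup R S" "e \<bullet> (snd q *v e) \<noteq> 0"
  proof -
    obtain w v k where wv: "q = (w, proj_point v)" "w \<in> R" "v \<in> R" "v \<noteq> 0" "operp S v = v" "operp S w = k *\<^sub>R v"
      by (rule linear_blowup_cases[OF R(1) S R(2) q(1)])
    define a where "a = v \<bullet> e"
    have ea: "e \<bullet> (proj_point v *v e) = a * a / (v \<bullet> v)"
      by (simp add: proj_point_mult a_def inner_commute)
    have a0: "a \<noteq> 0" using q(2) ea wv(1) by auto
    have *: "inverse (e \<bullet> (proj_point v *v e)) *\<^sub>R (proj_point v *v e) = inverse a *\<^sub>R v"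
      using a0 wv(4) by (simp add: proj_point_mult a_def[symmetric] inner_commute[of e v] field_simps)
    define y where "y = w - operp S w + (w \<bullet> e) *\<^sub>R e + (inverse a *\<^sub>R v - e)"
    have co: "blowup_coords S e q = y"
      using * by (simp add: blowup_coords_def wv(1) y_def)
    have we: "w \<bullet> e = k * a" using ne[of w] wv(6) by (simp add: a_def)
    have "operp S (w - operp S w) = 0" by (simp add: operp_sub[OF S] operp_operp[OF S])
    then have ox: "operp S y = (w \<bullet> e) *\<^sub>R e + (inverse a *\<^sub>R v - e)"
      by (simp add: y_def operp_add[OF S] operp_sub[OF S] operp_scaleR[OF S] e(2) wv(5))
    have ox_e: "operp S y \<bullet> e = w \<bullet> e"
      using a0 by (simp add: ox inner_add_left inner_diff_left e(1) a_def[symmetric])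
    have "e + (operp S y - (operp S y \<bullet> e) *\<^sub>R e) = inverse a *\<^sub>R v"
      unfolding ox_e by (simp add: ox)
    moreover have "y - operp S y + (operp S y \<bullet> e) *\<^sub>R (inverse a *\<^sub>R v) = w"
    proof -
      have "y - operp S y = w - operp S w" unfolding ox by (simp add: y_def)
      then show ?thesis unfolding ox_e using a0 by (simp add: we wv(6))
    qed
    ultimately have "blowup_chart S e y = (w, proj_point (inverse a *\<^sub>R v))"
      by (simp add: blowup_chart_def Let_def)
    moreover have "y \<in> R"
      unfolding y_def using wv(2,3) R operp_mem[OF S R(1,2) wv(2)] by (intro subspace_add subspace_diff subspace_scale)
    ultimately show ?thesis unfolding co using a0 by (simp add: wv(1) proj_point_scaleR)
  qed
qed

lemma smooth_on_blowup_chart: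
  fixes S :: "(real^'m) set"
  assumes "subspace S" "e \<bullet> e = 1" "operp S e = e"
  shows "smooth_on UNIV (blowup_chart S e)"
proof -
  have op: "smooth_on UNIV (operp S)"
    by (rule smooth_on_linear[OF open_UNIV bounded_linear_operp[OF assms(1)]])
  have "e + (operp S x - (operp S x \<bullet> e) *\<^sub>R e) \<noteq> 0" for x
  proof
    assume "e + (operp S x - (operp S x \<bullet> e) *\<^sub>R e) = 0"
    then have "(e + (operp S x - (operp S x \<bullet> e) *\<^sub>R e)) \<bullet> e = 0" by simp
    then show False using assms(2) by (simp add: inner_add_left inner_diff_left)
  qed
  moreover have "smooth_on UNIV (\<lambda>x. e + (operp S x - (operp S x \<bullet> e) *\<^sub>R e))"
    by (intro smooth_on_add smooth_on_diff smooth_on_scaleR smooth_on_inner op smooth_on_const open_UNIV)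
  ultimately have "smooth_on UNIV (\<lambda>x. (x - operp S x + (operp S x \<bullet> e) *\<^sub>R (e + (operp S x - (operp S x \<bullet> e) *\<^sub>R e)),
      proj_point (e + (operp S x - (operp S x \<bullet> e) *\<^sub>R e))))"
    by (intro smooth_on_Pair smooth_on_proj_point smooth_on_add smooth_on_diff smooth_on_scaleR smooth_on_inner
        smooth_on_ident op smooth_on_const open_UNIV) auto
  then show ?thesis by (rule smooth_on_cong) (simp add: blowup_chart_def Let_def)
qed

lemma smooth_on_blowup_coords:
  fixes S :: "(real^'m) set"
  assumes "subspace S"
  shows "smooth_on {q. e \<bullet> (snd q *v e) \<noteq> 0} (blowup_coords S e)"
proof -
  have s: "smooth_on UNIV (\<lambda>q::(real^'m) \<times> (real^'m^'m). e \<bullet> (snd q *v e))"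
    by (intro smooth_on_inner smooth_on_matrix_vector_mult smooth_on_snd smooth_on_ident smooth_on_const open_UNIV)
  have o: "open {q::(real^'m) \<times> (real^'m^'m). e \<bullet> (snd q *v e) \<noteq> 0}" (is "open ?U")
    by (rule open_Collect_neq[OF smooth_on_imp_continuous[OF s] continuous_on_const])
  have "smooth_on ?U (\<lambda>q. fst q - operp S (fst q) + (fst q \<bullet> e) *\<^sub>R e + (inverse (e \<bullet> (snd q *v e)) *\<^sub>R (snd q *v e) - e))"
    by (intro smooth_on_add smooth_on_diff smooth_on_scaleR smooth_on_inner smooth_on_inverse smooth_on_matrix_vector_mult
        smooth_on_fst smooth_on_snd smooth_on_ident smooth_on_const smooth_on_bounded_linear[OF bounded_linear_operp[OF assms]] o)
      auto
  then show ?thesis by (rule smooth_on_cong) (simp add: blowup_coords_def)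
qed

text \<open>Off the centre u is a multiple of the normal component of w, which stays in R because S
  is contained in R.\<close>

lemma linear_blowup_restrict:
  assumes "subspace T" "subspace S" "S \<subseteq> R" "subspace R" "R \<subseteq> T" "q \<in> linear_blowup T S" "fst q \<in> R" "fst q \<notin> S"
  shows "q \<in> linear_blowup R S"
proof -
  obtain w u c where u: "q = (w, proj_point u)" "u \<noteq> 0" "operp S u = u" "operp S w = c *\<^sub>R u"
    by (rule linear_blowup_cases[OF assms(1,2) order_trans[OF assms(3,5)] assms(6)])
  have "c \<noteq> 0" using u(1,4) assms(8) operp_eq_0_iff[OF assms(2), of w] by auto
  then have "u = inverse c *\<^sub>R operp S w" using u(4) by simp
  moreover have "operp S w \<in> R" using operp_mem[OF assms(2,4,3)] assms(7) u(1) by simp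
  ultimately have "u \<in> R" using subspace_scale[OF assms(4)] by metis
  then show ?thesis
    unfolding u(1) using u assms(7) by (intro linear_blowupI[OF assms(4,2,3)]) auto
qed

lemma linear_blowup_mono:
  "R \<subseteq> T \<Longrightarrow> linear_blowup R S \<subseteq> linear_blowup T S"
  unfolding linear_blowup_def by blast

text \<open>Applying a projection matrix to a fixed vector is continuous, so lines inside the closed
  set R can only converge to a line inside R.\<close>

lemma linear_blowup_closed:
  assumes "subspace T" "subspace S" "S \<subseteq> R" "subspace R" "R \<subseteq> T"
    "\<And>k. \<sigma> k \<in> linear_blowup R S" "\<sigma> \<longlonglongrightarrow> q" "q \<in> linear_blowup T S"
  shows "q \<in> linear_blowup R S"
proof -
  obtain w u c where u: "q = (w, proj_point u)" "u \<noteq> 0" "operp S u = u" "operp S w = c *\<^sub>R u"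
    by (rule linear_blowup_cases[OF assms(1,2) order_trans[OF assms(3,5)] assms(8)])
  have cl: "closed R" by (rule closed_subspace[OF assms(4)])
  have \<sigma>: "fst (\<sigma> k) \<in> R" "snd (\<sigma> k) *v z \<in> R" for k z
  proof -
    obtain w u c where "\<sigma> k = (w, proj_point u)" "w \<in> R" "u \<in> R"
      by (rule linear_blowup_cases[OF assms(4,2,3) assms(6)])
    then show "fst (\<sigma> k) \<in> R" "snd (\<sigma> k) *v z \<in> R"
      by (auto simp: proj_point_mult intro: subspace_scale[OF assms(4)])
  qed
  have "fst q \<in> R"
    by (rule Lim_in_closed_set[OF cl _ sequentially_bot tendsto_fst[OF assms(7)]]) (use \<sigma> in auto)
  moreover have "u \<in> R"
  proof -
    have lim: "(\<lambda>k. snd (\<sigma> k) *v u) \<longlonglongrightarrow> snd q *v u"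
      by (rule bounded_linear.tendsto[OF _ tendsto_snd[OF assms(7)]])
        (auto simp: linear_conv_bounded_linear[symmetric] intro!: linearI
          simp: matrix_vector_mult_add_rdistrib scaleR_matrix_vector_assoc)
    have "snd q *v u \<in> R"
      by (rule Lim_in_closed_set[OF cl _ sequentially_bot lim]) (use \<sigma> in auto)
    then show ?thesis using u(1,2) by (simp add: proj_point_mult_self)
  qed
  ultimately show ?thesis unfolding u(1) using u by (intro linear_blowupI[OF assms(4,2,3)]) auto
qed

section \<open>Proper transforms in charts of a blowup\<close>

lemma chart_mem_iff:
  assumes "inj_on \<phi> V" "\<phi> ` V = W" "\<phi> ` (V \<inter> Z) = W \<inter> S" "v \<in> V"
  shows "\<phi> v \<in> S \<longleftrightarrow> v \<in> Z"
proof
  assume "\<phi> v \<in> S"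
  then have "\<phi> v \<in> \<phi> ` (V \<inter> Z)" using assms by auto
  then show "v \<in> Z" using assms(1,4) by (auto dest: inj_onD)
qed (use assms in auto)

lemma chart_restrict:
  assumes "diffeo V W \<phi>" "V' \<subseteq> V" "\<phi> ` (V \<inter> Z) = W \<inter> S"
  shows "\<phi> ` (V' \<inter> Z) = \<phi> ` V' \<inter> S"
  using chart_mem_iff[OF diffeo_inj_on[OF assms(1)] diffeo_image[OF assms(1)] assms(3)] assms(2) by auto

text \<open>This exchanges the chart that comes with the blowup for a prescribed chart
  \<open>\<phi>\<close>. On the overlap the transition map preserves the linear centre, so it lifts
  to the linear blowups; composing with the lift gives a blowup chart lying over
  \<open>\<phi>\<close>.\<close>

lemma blowup_over_chart:
  fixes \<phi> :: "real^'m \<Rightarrow> real^'m"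
  assumes bl: "is_blowup X Z B \<beta>" and x: "x \<in> V" "x \<in> Z"
    and V: "openin (top_of_set X) V" "openin (top_of_set T) W" "diffeo V W \<phi>"
    and T: "subspace T" "subspace S" "S \<subseteq> T" and S: "\<phi> ` (V \<inter> Z) = W \<inter> S"
  obtains V' \<psi> where "openin (top_of_set X) V'" "x \<in> V'" "V' \<subseteq> V"
    "diffeo (B \<inter> \<beta> -` V') (blowup_over T S (\<phi> ` V')) \<psi>"
    "\<And>y. y \<in> B \<Longrightarrow> \<beta> y \<in> V' \<Longrightarrow> fst (\<psi> y) = \<phi> (\<beta> y)"
proof -
  have "\<exists>V W T S (\<phi> :: real^'m \<Rightarrow> real^'m) \<psi>.
        openin (top_of_set X) V \<and> x \<in> V \<and>
        subspace T \<and> subspace S \<and> S \<subseteq> T \<and> openin (top_of_set T) W \<and>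
        diffeo V W \<phi> \<and> \<phi> ` (V \<inter> Z) = W \<inter> S \<and>
        diffeo (B \<inter> \<beta> -` V) {q \<in> linear_blowup T S. fst q \<in> W} \<psi> \<and>
        (\<forall>y\<in>B \<inter> \<beta> -` V. fst (\<psi> y) = \<phi> (\<beta> y))"
    using bl x(2) unfolding is_blowup_def by simp
  then obtain V1 W1 T1 S1 and \<phi>1 :: "real^'m \<Rightarrow> real^'m" and \<psi>1 where 0:
    "openin (top_of_set X) V1" "x \<in> V1" "subspace T1" "subspace S1" "S1 \<subseteq> T1" "openin (top_of_set T1) W1"
    "diffeo V1 W1 \<phi>1" "\<phi>1 ` (V1 \<inter> Z) = W1 \<inter> S1" "diffeo (B \<inter> \<beta> -` V1) (blowup_over T1 S1 W1) \<psi>1"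
    "\<forall>y\<in>B \<inter> \<beta> -` V1. fst (\<psi>1 y) = \<phi>1 (\<beta> y)"
    by (elim exE conjE) (rule that)
  note 1 = 0(1-9) 0(10)[rule_format]
  define V' where "V' = V \<inter> V1"
  have oV': "openin (top_of_set X) V'" unfolding V'_def using V(1) 1(1) by (rule openin_Int)
  obtain g where g: "smooth_map V1 W1 \<phi>1" "smooth_map W1 V1 g" "\<And>a. a \<in> V1 \<Longrightarrow> g (\<phi>1 a) = a"
    "\<And>b. b \<in> W1 \<Longrightarrow> \<phi>1 (g b) = b" "diffeo W1 V1 g"
    using diffeo_inverse[OF 1(7)] by metis
  have "g ` (\<phi>1 ` V') = V'" using g(3) by (force simp: V'_def image_image)
  moreover have "\<phi>1 ` V' \<subseteq> W1" using smooth_map_image[OF g(1)] by (auto simp: V'_def)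
  ultimately have "diffeo (\<phi>1 ` V') V' g" using diffeo_restrict[OF g(5), of "\<phi>1 ` V'"] by simp
  moreover have "diffeo V' (\<phi> ` V') \<phi>" by (rule diffeo_restrict[OF V(3)]) (simp add: V'_def)
  ultimately have df: "diffeo (\<phi>1 ` V') (\<phi> ` V') (\<lambda>w. \<phi> (g w))" by (rule diffeo_compose)
  have "openin (top_of_set V) V'" "openin (top_of_set V1) V'"
    using openin_subset_trans[OF oV' _ openin_imp_subset[OF V(1)]] openin_subset_trans[OF oV' _ openin_imp_subset[OF 1(1)]]
    by (simp_all add: V'_def)
  then have oW: "openin (top_of_set T) (\<phi> ` V')" "openin (top_of_set T1) (\<phi>1 ` V')"
    using openin_trans[OF diffeo_openin[OF V(3)] V(2)] openin_trans[OF diffeo_openin[OF 1(7)] 1(6)] by auto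
  have iff: "\<phi> (g w) \<in> S \<longleftrightarrow> w \<in> S1" if "w \<in> \<phi>1 ` V'" for w
  proof -
    obtain v where v: "v \<in> V" "v \<in> V1" "w = \<phi>1 v" using \<open>w \<in> \<phi>1 ` V'\<close> by (auto simp: V'_def)
    then show ?thesis
      using chart_mem_iff[OF diffeo_inj_on[OF V(3)] diffeo_image[OF V(3)] S v(1)]
        chart_mem_iff[OF diffeo_inj_on[OF 1(7)] diffeo_image[OF 1(7)] 1(8) v(2)] g(3) by simp
  qed
  obtain L where L: "diffeo (blowup_over T1 S1 (\<phi>1 ` V')) (blowup_over T S (\<phi> ` V')) L"
    "\<And>q. q \<in> blowup_over T1 S1 (\<phi>1 ` V') \<Longrightarrow> fst (L q) = \<phi> (g (fst q))"
    by (rule blowup_lift_diffeo[OF 1(3-5) oW(2) T oW(1) df iff]; (rule that)?)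
  have img: "\<psi>1 ` (B \<inter> \<beta> -` V') = blowup_over T1 S1 (\<phi>1 ` V')"
  proof (intro equalityI subsetI)
    fix q assume "q \<in> \<psi>1 ` (B \<inter> \<beta> -` V')"
    then obtain y where y: "q = \<psi>1 y" "y \<in> B" "\<beta> y \<in> V'" by auto
    then have "q \<in> blowup_over T1 S1 W1" using smooth_map_image[OF diffeo_smooth_map[OF 1(9)], of y] by (auto simp: V'_def)
    moreover have "fst q = \<phi>1 (\<beta> y)" using y 1(10)[of y] by (auto simp: V'_def)
    ultimately show "q \<in> blowup_over T1 S1 (\<phi>1 ` V')" using y by auto
  next
    fix q assume q: "q \<in> blowup_over T1 S1 (\<phi>1 ` V')"
    then obtain v where v: "fst q = \<phi>1 v" "v \<in> V'" by auto
    have "q \<in> blowup_over T1 S1 W1" using q v smooth_map_image[OF g(1)] by (auto simp: V'_def)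
    then have "q \<in> \<psi>1 ` (B \<inter> \<beta> -` V1)" using diffeo_image[OF 1(9)] by simp
    then obtain y where y: "y \<in> B" "\<beta> y \<in> V1" "q = \<psi>1 y" by auto
    then have "\<phi>1 (\<beta> y) = \<phi>1 v" using 1(10)[of y] v by simp
    then have "g (\<phi>1 (\<beta> y)) = g (\<phi>1 v)" by simp
    then have "\<beta> y = v" using g(3)[OF y(2)] g(3)[of v] v(2) by (simp add: V'_def)
    then show "q \<in> \<psi>1 ` (B \<inter> \<beta> -` V')" using y v by auto
  qed
  have d1: "diffeo (B \<inter> \<beta> -` V') (blowup_over T1 S1 (\<phi>1 ` V')) \<psi>1"
    using diffeo_restrict[OF 1(9), of "B \<inter> \<beta> -` V'"] img by (auto simp: V'_def)
  show ?thesis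
  proof (rule that[OF oV'])
    show "x \<in> V'" "V' \<subseteq> V" using x 1(2) by (auto simp: V'_def)
    show "diffeo (B \<inter> \<beta> -` V') (blowup_over T S (\<phi> ` V')) (\<lambda>y. L (\<psi>1 y))"
      by (rule diffeo_compose[OF d1 L(1)])
    show "fst (L (\<psi>1 y)) = \<phi> (\<beta> y)" if "y \<in> B" "\<beta> y \<in> V'" for y
    proof -
      have "\<psi>1 y \<in> blowup_over T1 S1 (\<phi>1 ` V')" using img that by auto
      then show ?thesis using L(2) 1(10)[of y] that g(3)[of "\<beta> y"] by (simp add: V'_def)
    qed
  qed
qed

lemma proper_transform_subset:
  assumes "smooth_map B X \<beta>" "closedin (top_of_set X) S"
  shows "proper_transform Z B \<beta> S \<subseteq> B \<inter> \<beta> -` S"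
proof -
  have "closedin (top_of_set B) (B \<inter> \<beta> -` S)"
    by (rule continuous_closedin_preimage_gen[OF smooth_map_continuous_on[OF assms(1)] _ assms(2)])
      (use smooth_map_image[OF assms(1)] in auto)
  then obtain C where "closed C" "B \<inter> \<beta> -` S = B \<inter> C" by (auto simp: closedin_closed)
  then have "closure (B \<inter> \<beta> -` (S - Z)) \<subseteq> C" by (intro closure_minimal) auto
  then show ?thesis using \<open>B \<inter> \<beta> -` S = B \<inter> C\<close> by (auto simp: proper_transform_def)
qed

lemma proper_transform_off:
  assumes "smooth_map B X \<beta>" "closedin (top_of_set X) S" "y \<in> B" "\<beta> y \<notin> Z"
  shows "y \<in> proper_transform Z B \<beta> S \<longleftrightarrow> \<beta> y \<in> S"
proof
  assume "\<beta> y \<in> S"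
  then have "y \<in> B \<inter> \<beta> -` (S - Z)" using assms(3,4) by auto
  then show "y \<in> proper_transform Z B \<beta> S"
    using closure_subset[of "B \<inter> \<beta> -` (S - Z)"] assms(3) by (auto simp: proper_transform_def)
qed (use proper_transform_subset[OF assms(1,2)] in auto)

text \<open>In the chart, the points over Z' - Z are those of the blowup of R that lie off the
  centre. Their closure is contained in the blowup of R because that set is closed, and contains it
  because they are dense in it.\<close>

lemma proper_transform_chart:
  assumes \<beta>: "smooth_map B X \<beta>" and V: "openin (top_of_set X) V" "inj_on \<phi> V" "openin (top_of_set T) (\<phi> ` V)"
    and T: "subspace T" "subspace S" "S \<subseteq> R" "subspace R" "R \<subseteq> T"
    and Z: "\<phi> ` (V \<inter> Z) = \<phi> ` V \<inter> S" and Z': "\<phi> ` (V \<inter> Z') = \<phi> ` V \<inter> R"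
    and \<psi>: "diffeo (B \<inter> \<beta> -` V) (blowup_over T S (\<phi> ` V)) \<psi>"
      "\<And>y. y \<in> B \<Longrightarrow> \<beta> y \<in> V \<Longrightarrow> fst (\<psi> y) = \<phi> (\<beta> y)"
    and y: "y \<in> B" "\<beta> y \<in> V"
  shows "y \<in> proper_transform Z B \<beta> Z' \<longleftrightarrow> \<psi> y \<in> linear_blowup R S"
proof
  have memZ: "\<phi> v \<in> S \<longleftrightarrow> v \<in> Z" and memZ': "\<phi> v \<in> R \<longleftrightarrow> v \<in> Z'" if "v \<in> V" for v
    using chart_mem_iff[OF V(2) refl Z that] chart_mem_iff[OF V(2) refl Z' that] by auto
  obtain \<psi>' where \<psi>': "smooth_map (B \<inter> \<beta> -` V) (blowup_over T S (\<phi> ` V)) \<psi>"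
    "smooth_map (blowup_over T S (\<phi> ` V)) (B \<inter> \<beta> -` V) \<psi>'"
    "\<And>a. a \<in> B \<inter> \<beta> -` V \<Longrightarrow> \<psi>' (\<psi> a) = a" "\<And>b. b \<in> blowup_over T S (\<phi> ` V) \<Longrightarrow> \<psi> (\<psi>' b) = b"
    by (rule diffeo_inverse[OF \<psi>(1)]; (rule that)?)
  {
    assume "y \<in> proper_transform Z B \<beta> Z'"
    then have "y \<in> closure (B \<inter> \<beta> -` (Z' - Z))" by (auto simp: proper_transform_def)
    then obtain c where c: "\<And>k. c k \<in> B \<inter> \<beta> -` (Z' - Z)" "c \<longlonglongrightarrow> y"
      by (auto simp: closure_sequential)
    have "openin (top_of_set B) (B \<inter> \<beta> -` V)"
      by (rule continuous_openin_preimage[OF smooth_map_continuous_on[OF \<beta>] _ V(1)])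
        (use smooth_map_image[OF \<beta>] in auto)
    then obtain Q where Q: "open Q" "B \<inter> \<beta> -` V = B \<inter> Q" by (auto simp: openin_open)
    have "y \<in> Q" using Q(2) y by auto
    then have "\<forall>\<^sub>F k in sequentially. c k \<in> Q"
      using c(2) Q(1) by (simp add: tendsto_def)
    then obtain N where N: "\<And>k. k \<ge> N \<Longrightarrow> c k \<in> Q" by (auto simp: eventually_sequentially)
    \<comment> \<open>A tail of the sequence lies over V, where the chart can be applied.\<close>
    define d where "d k = c (k + N)" for k
    have d: "d k \<in> B \<inter> \<beta> -` V" "\<beta> (d k) \<in> Z'" "\<beta> (d k) \<notin> Z" "\<beta> (d k) \<in> V" for k
    proof -
      have "d k \<in> B \<inter> Q" using c(1)[of "k + N"] N[of "k + N"] by (auto simp: d_def)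
      then show "d k \<in> B \<inter> \<beta> -` V" "\<beta> (d k) \<in> V" using Q(2) by auto
      show "\<beta> (d k) \<in> Z'" "\<beta> (d k) \<notin> Z" using c(1)[of "k + N"] by (auto simp: d_def)
    qed
    have "d \<longlonglongrightarrow> y" unfolding d_def by (rule LIMSEQ_ignore_initial_segment[OF c(2)])
    then have lim: "(\<lambda>k. \<psi> (d k)) \<longlonglongrightarrow> \<psi> y"
      by (rule continuous_on_tendsto_compose[OF smooth_map_continuous_on[OF \<psi>'(1)]])
        (use y d(1) in auto)
    have "\<psi> (d k) \<in> linear_blowup R S" for k
      by (rule linear_blowup_restrict[OF T(1-5)])
        (use smooth_map_image[OF \<psi>'(1) d(1)[of k]] \<psi>(2)[of "d k"] d[of k] memZ[of "\<beta> (d k)"] memZ'[of "\<beta> (d k)"] in auto)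
    then show "\<psi> y \<in> linear_blowup R S"
      using linear_blowup_closed[OF T(1-5) _ lim] smooth_map_image[OF \<psi>'(1), of y] y by auto
  }
  {
    assume qR: "\<psi> y \<in> linear_blowup R S"
    have "fst (\<psi> y) \<in> R" by (rule linear_blowup_cases[OF T(4,2,3) qR]) simp
    then have q: "\<psi> y \<in> blowup_over R S (R \<inter> \<phi> ` V)"
      using qR smooth_map_image[OF \<psi>'(1), of y] y by simp
    have oR: "openin (top_of_set R) (R \<inter> \<phi> ` V)"
      using V(3) T(5) by (auto simp: openin_open)
    obtain \<sigma> where \<sigma>: "\<And>k::nat. \<sigma> k \<in> blowup_over R S (R \<inter> \<phi> ` V)" "\<And>k. fst (\<sigma> k) \<notin> S" "\<sigma> \<longlonglongrightarrow> \<psi> y"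
      by (rule linear_blowup_dense[OF T(4,2,3) oR q], rule that)
    have \<sigma>T: "\<sigma> k \<in> blowup_over T S (\<phi> ` V)" for k
      using \<sigma>(1)[of k] linear_blowup_mono[OF T(5), of S] by auto
    have "(\<lambda>k. \<psi>' (\<sigma> k)) \<longlonglongrightarrow> \<psi>' (\<psi> y)"
      by (rule continuous_on_tendsto_compose[OF smooth_map_continuous_on[OF \<psi>'(2)] \<sigma>(3)])
        (use \<sigma>T smooth_map_image[OF \<psi>'(1), of y] y in auto)
    then have lim: "(\<lambda>k. \<psi>' (\<sigma> k)) \<longlonglongrightarrow> y" using \<psi>'(3)[of y] y by simp
    have "\<psi>' (\<sigma> k) \<in> B \<inter> \<beta> -` (Z' - Z)" for k
    proof -
      have 1: "\<psi>' (\<sigma> k) \<in> B" "\<beta> (\<psi>' (\<sigma> k)) \<in> V" using smooth_map_image[OF \<psi>'(2) \<sigma>T[of k]] by auto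
      have "\<phi> (\<beta> (\<psi>' (\<sigma> k))) = fst (\<sigma> k)" using \<psi>(2)[OF 1] \<psi>'(4)[OF \<sigma>T] by simp
      then show ?thesis
        using 1 memZ[OF 1(2)] memZ'[OF 1(2)] \<sigma>(1)[of k] \<sigma>(2)[of k] by simp
    qed
    then have "y \<in> closure (B \<inter> \<beta> -` (Z' - Z))"
      unfolding closure_sequential using lim by (intro exI[of _ "\<lambda>k. \<psi>' (\<sigma> k)"] conjI allI)
    then show "y \<in> proper_transform Z B \<beta> Z'"
      unfolding proper_transform_def using y(1) by (rule IntI[rotated])
  }
qed

text \<open>The predicate \<open>P\<close> carries along a property of the local linear models, which the blowup charts do
  not change; it is used to remember their codimension.\<close>

definition flat_at ::
    "(real^'m) set \<Rightarrow> ('i \<Rightarrow> (real^'m) set \<Rightarrow> bool) \<Rightarrow> 'i set \<Rightarrow> ('i \<Rightarrow> (real^'m) set) \<Rightarrow> (real^'m) set \<Rightarrow> real^'m \<Rightarrow> bool" where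
  "flat_at T P I Z X x \<longleftrightarrow> (\<exists>V W (\<phi> :: real^'m \<Rightarrow> real^'m).
     openin (top_of_set X) V \<and> x \<in> V \<and> openin (top_of_set T) W \<and> diffeo V W \<phi> \<and>
     (\<forall>i\<in>I. x \<in> Z i \<longrightarrow> (\<exists>S. subspace S \<and> S \<subseteq> T \<and> P i S \<and> \<phi> ` (V \<inter> Z i) = W \<inter> S)))"

text \<open>The indices are sets only so that \<open>i \<inter> j\<close> can name an intersection
  of members; they stay the same while \<open>Z\<close> is replaced by proper transforms. Members
  whose intersection index is no longer listed are required to be disjoint, which is what blowing up
  that intersection achieves.\<close>

definition flat_arrangement ::
    "(real^'m) set \<Rightarrow> ('e set \<Rightarrow> (real^'m) set \<Rightarrow> bool) \<Rightarrow> 'e set set \<Rightarrow> ('e set \<Rightarrow> (real^'m) set) \<Rightarrow> (real^'m) set \<Rightarrow> bool" where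
  "flat_arrangement T P I Z X \<longleftrightarrow> subspace T \<and>
     (\<forall>i\<in>I. closedin (top_of_set X) (Z i)) \<and>
     (\<forall>i\<in>I. \<forall>j\<in>I. Z i \<inter> Z j = (if i \<inter> j \<in> I then Z (i \<inter> j) else {})) \<and>
     (\<forall>x\<in>X. flat_at T P I Z X x)"

text \<open>For s in S a small multiple can be added to w without leaving W. Both the old and the
  new point lie in R, hence so does their difference.\<close>

lemma subspace_subset_local:
  fixes w :: "'a::euclidean_space"
  assumes "subspace T" "openin (top_of_set T) W" "w \<in> W" "w \<in> S" "subspace S" "S \<subseteq> T" "subspace R" "W \<inter> S \<subseteq> R"
  shows "S \<subseteq> R"
proof
  fix s assume s: "s \<in> S"
  have "\<forall>\<^sub>F t in nhds (0::real). w + t *\<^sub>R s \<in> W"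
    by (rule openin_subspace_eventually[OF assms(2,1,3)]) (use s assms(6) in auto)
  then obtain e where e: "e > 0" "\<And>t. dist t 0 < e \<Longrightarrow> w + t *\<^sub>R s \<in> W"
    by (auto simp: eventually_nhds_metric)
  have "w + (e / 2) *\<^sub>R s \<in> W" using e(2)[of "e / 2"] e(1) by simp
  moreover have "w + (e / 2) *\<^sub>R s \<in> S" by (intro subspace_add subspace_scale assms s)
  ultimately have "w + (e / 2) *\<^sub>R s \<in> R" "w \<in> R" using assms(3,4,8) by auto
  from subspace_diff[OF assms(7) this] have "(e / 2) *\<^sub>R s \<in> R" by simp
  then have "inverse (e / 2) *\<^sub>R (e / 2) *\<^sub>R s \<in> R" by (rule subspace_scale[OF assms(7)])
  then show "s \<in> R" using e(1) by simp
qed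

lemma flat_atI:
  fixes \<phi> :: "real^'m \<Rightarrow> real^'m"
  assumes "openin (top_of_set X) V" "x \<in> V" "openin (top_of_set T) W" "diffeo V W \<phi>"
    "\<And>i. i \<in> I \<Longrightarrow> x \<in> Z i \<Longrightarrow> \<exists>S. subspace S \<and> S \<subseteq> T \<and> P i S \<and> \<phi> ` (V \<inter> Z i) = W \<inter> S"
  shows "flat_at T P I Z X x"
  unfolding flat_at_def
  by (rule exI[of _ V], rule exI[of _ W], rule exI[of _ \<phi>]) (use assms in auto)

lemma flat_atE:
  assumes "flat_at T P I Z X x"
  obtains V W and \<phi> :: "real^'m \<Rightarrow> real^'m" where
    "openin (top_of_set X) V" "x \<in> V" "openin (top_of_set T) W" "diffeo V W \<phi>"
    "\<forall>i\<in>I. x \<in> Z i \<longrightarrow> (\<exists>S. subspace S \<and> S \<subseteq> T \<and> P i S \<and> \<phi> ` (V \<inter> Z i) = W \<inter> S)"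
  using assms unfolding flat_at_def by (elim exE conjE) (rule that)

lemma proper_transform_mono: "S \<subseteq> S' \<Longrightarrow> proper_transform Z B \<beta> S \<subseteq> proper_transform Z B \<beta> S'"
  unfolding proper_transform_def by (intro Int_mono closure_mono order_refl) auto

lemma is_blowup_smooth_map: "is_blowup X Z B \<beta> \<Longrightarrow> smooth_map B X \<beta>"
  by (simp add: is_blowup_def)

text \<open>The chart of the arrangement is shrunk until the blowup has a chart over it. Since every
  other member through x contains the centre, so do the linear models, because containment of germs
  at a common point is enough for subspaces.\<close>

lemma blowup_center_chart:
  fixes Z :: "'i \<Rightarrow> (real^'m) set"
  assumes flat: "flat_at T P (insert a I) Z X x" and bl: "is_blowup X (Z a) B \<beta>" and x: "x \<in> Z a"
    and T: "subspace T" and sub: "\<And>i. i \<in> I \<Longrightarrow> x \<in> Z i \<Longrightarrow> Z a \<subseteq> Z i"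
  obtains V S R \<psi> and \<phi> :: "real^'m \<Rightarrow> real^'m" where
    "openin (top_of_set X) V" "x \<in> V" "openin (top_of_set T) (\<phi> ` V)" "diffeo V (\<phi> ` V) \<phi>"
    "subspace S" "S \<subseteq> T" "\<phi> ` (V \<inter> Z a) = \<phi> ` V \<inter> S"
    "diffeo (B \<inter> \<beta> -` V) (blowup_over T S (\<phi> ` V)) \<psi>"
    "\<And>y. y \<in> B \<Longrightarrow> \<beta> y \<in> V \<Longrightarrow> fst (\<psi> y) = \<phi> (\<beta> y)"
    "\<And>i. i \<in> I \<Longrightarrow> x \<in> Z i \<Longrightarrow> subspace (R i) \<and> R i \<subseteq> T \<and> P i (R i) \<and> \<phi> ` (V \<inter> Z i) = \<phi> ` V \<inter> R i \<and> S \<subseteq> R i"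
proof -
  obtain V0 W0 and \<phi> :: "real^'m \<Rightarrow> real^'m" where V0: "openin (top_of_set X) V0" "x \<in> V0" "openin (top_of_set T) W0" "diffeo V0 W0 \<phi>"
    "\<forall>i\<in>insert a I. x \<in> Z i \<longrightarrow> (\<exists>S. subspace S \<and> S \<subseteq> T \<and> P i S \<and> \<phi> ` (V0 \<inter> Z i) = W0 \<inter> S)"
    by (rule flat_atE[OF flat], rule that)
  have "\<exists>S. subspace S \<and> S \<subseteq> T \<and> P a S \<and> \<phi> ` (V0 \<inter> Z a) = W0 \<inter> S" using V0(5) x by simp
  then obtain S where S: "subspace S" "S \<subseteq> T" "\<phi> ` (V0 \<inter> Z a) = W0 \<inter> S" by auto
  define R where "R i = (SOME S. subspace S \<and> S \<subseteq> T \<and> P i S \<and> \<phi> ` (V0 \<inter> Z i) = W0 \<inter> S)" for i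
  have R: "subspace (R i) \<and> R i \<subseteq> T \<and> P i (R i) \<and> \<phi> ` (V0 \<inter> Z i) = W0 \<inter> R i" if "i \<in> I" "x \<in> Z i" for i
  proof -
    have "\<exists>S. subspace S \<and> S \<subseteq> T \<and> P i S \<and> \<phi> ` (V0 \<inter> Z i) = W0 \<inter> S" using V0(5) that by simp
    then show ?thesis unfolding R_def by (rule someI_ex)
  qed
  obtain V \<psi> where V: "openin (top_of_set X) V" "x \<in> V" "V \<subseteq> V0"
    "diffeo (B \<inter> \<beta> -` V) (blowup_over T S (\<phi> ` V)) \<psi>"
    "\<And>y. y \<in> B \<Longrightarrow> \<beta> y \<in> V \<Longrightarrow> fst (\<psi> y) = \<phi> (\<beta> y)"
    by (rule blowup_over_chart[OF bl V0(2) x V0(1,3,4) T S], rule that)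
  have oV: "openin (top_of_set V0) V"
    by (rule openin_subset_trans[OF V(1,3) openin_imp_subset[OF V0(1)]])
  have oW: "openin (top_of_set T) (\<phi> ` V)"
    by (rule openin_trans[OF diffeo_openin[OF V0(4) oV] V0(3)])
  have RS: "S \<subseteq> R i" if i: "i \<in> I" "x \<in> Z i" for i
  proof -
    have w: "\<phi> x \<in> W0 \<inter> S" using S(3) V0(2) x by auto
    have "\<phi> ` (V0 \<inter> Z a) \<subseteq> \<phi> ` (V0 \<inter> Z i)" using sub[OF i] by (intro image_mono Int_mono) auto
    then have "W0 \<inter> S \<subseteq> R i" using S(3) R[OF i] by simp
    then show ?thesis using subspace_subset_local[OF T V0(3) _ _ S(1,2)] w R[OF i] by auto
  qed
  show ?thesis
  proof (rule that[OF V(1,2) oW diffeo_restrict[OF V0(4) V(3)] S(1,2) chart_restrict[OF V0(4) V(3) S(3)] V(4,5)])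
    show "subspace (R i) \<and> R i \<subseteq> T \<and> P i (R i) \<and> \<phi> ` (V \<inter> Z i) = \<phi> ` V \<inter> R i \<and> S \<subseteq> R i"
      if i: "i \<in> I" "x \<in> Z i" for i
      using R[OF i] RS[OF i] chart_restrict[OF V0(4) V(3), of "Z i" "R i"] by simp
  qed
qed

text \<open>Away from the centre \<open>\<beta>\<close> is a diffeomorphism and proper transforms
  are preimages, so a chart that avoids the centre can be pulled back.\<close>

lemma flat_at_blowup_off:
  fixes Z :: "'i \<Rightarrow> (real^'m) set"
  assumes flat: "flat_at T P I Z X (\<beta> y)" and bl: "is_blowup X C B \<beta>" and y: "y \<in> B" "\<beta> y \<notin> C"
    and cl: "\<And>i. i \<in> I \<Longrightarrow> closedin (top_of_set X) (Z i)"
  shows "flat_at T P I (\<lambda>i. proper_transform C B \<beta> (Z i)) B y"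
proof -
  note \<beta> = is_blowup_smooth_map[OF bl]
  have clC: "closedin (top_of_set X) C" and d\<beta>: "diffeo (B - \<beta> -` C) (X - C) \<beta>" using bl by (auto simp: is_blowup_def)
  obtain V0 W0 and \<phi> :: "real^'m \<Rightarrow> real^'m" where V0: "openin (top_of_set X) V0" "\<beta> y \<in> V0" "openin (top_of_set T) W0" "diffeo V0 W0 \<phi>"
    "\<forall>i\<in>I. \<beta> y \<in> Z i \<longrightarrow> (\<exists>S. subspace S \<and> S \<subseteq> T \<and> P i S \<and> \<phi> ` (V0 \<inter> Z i) = W0 \<inter> S)"
    by (rule flat_atE[OF flat], rule that)
  have oXC: "openin (top_of_set X) (X - C)" by (rule openin_diff[OF _ clC]) simp
  define V where "V = V0 \<inter> (X - C)"
  have oV: "openin (top_of_set X) V" unfolding V_def by (rule openin_Int[OF V0(1) oXC])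
  have VV0: "V \<subseteq> V0" by (auto simp: V_def)
  have oVV: "openin (top_of_set V0) V"
    by (rule openin_subset_trans[OF oV VV0 openin_imp_subset[OF V0(1)]])
  have oW: "openin (top_of_set T) (\<phi> ` V)"
    by (rule openin_trans[OF diffeo_openin[OF V0(4) oVV] V0(3)])
  have img: "\<beta> ` (B \<inter> \<beta> -` V) = V"
  proof -
    have "V \<subseteq> \<beta> ` (B - \<beta> -` C)" using diffeo_image[OF d\<beta>] by (auto simp: V_def)
    then show ?thesis by (auto simp: V_def)
  qed
  have d: "diffeo (B \<inter> \<beta> -` V) V \<beta>"
    using diffeo_restrict[OF d\<beta>, of "B \<inter> \<beta> -` V"] img by (auto simp: V_def)
  have dd: "diffeo (B \<inter> \<beta> -` V) (\<phi> ` V) (\<lambda>y. \<phi> (\<beta> y))"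
    by (rule diffeo_compose[OF d diffeo_restrict[OF V0(4) VV0]])
  have oB: "openin (top_of_set B) (B \<inter> \<beta> -` V)"
    by (rule continuous_openin_preimage[OF smooth_map_continuous_on[OF \<beta>] _ oV])
      (use smooth_map_image[OF \<beta>] in auto)
  show ?thesis
  proof (rule flat_atI[OF oB _ oW dd])
    show "y \<in> B \<inter> \<beta> -` V" using y V0(2) smooth_map_image[OF \<beta>] by (auto simp: V_def)
    fix i assume i: "i \<in> I" "y \<in> proper_transform C B \<beta> (Z i)"
    have "\<beta> y \<in> Z i" using proper_transform_subset[OF \<beta> cl[OF i(1)]] i(2) by auto
    then obtain S where S: "subspace S" "S \<subseteq> T" "P i S" "\<phi> ` (V0 \<inter> Z i) = W0 \<inter> S" using V0(5) i(1) by auto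
    have "(B \<inter> \<beta> -` V) \<inter> proper_transform C B \<beta> (Z i) = B \<inter> \<beta> -` (V \<inter> Z i)"
      using proper_transform_off[OF \<beta> cl[OF i(1)]] by (auto simp: V_def)
    moreover have "\<beta> ` (B \<inter> \<beta> -` (V \<inter> Z i)) = V \<inter> Z i"
    proof (intro equalityI subsetI)
      fix x assume x: "x \<in> V \<inter> Z i"
      then have "x \<in> \<beta> ` (B \<inter> \<beta> -` V)" using img by simp
      then obtain y where "y \<in> B" "x = \<beta> y" by auto
      then show "x \<in> \<beta> ` (B \<inter> \<beta> -` (V \<inter> Z i))" using x by simp
    qed auto
    ultimately have "(\<lambda>y. \<phi> (\<beta> y)) ` ((B \<inter> \<beta> -` V) \<inter> proper_transform C B \<beta> (Z i)) = \<phi> ` (V \<inter> Z i)"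
      by (metis image_image)
    also have "\<dots> = \<phi> ` V \<inter> S" by (rule chart_restrict[OF V0(4) VV0 S(4)])
    finally show "\<exists>S. subspace S \<and> S \<subseteq> T \<and> P i S \<and>
        (\<lambda>y. \<phi> (\<beta> y)) ` ((B \<inter> \<beta> -` V) \<inter> proper_transform C B \<beta> (Z i)) = \<phi> ` V \<inter> S"
      using S by blast
  qed
qed

text \<open>The affine chart around the line of y itself is used. A proper transform passing through
  y has this line in its linear model, so the chart flattens it, to the same subspace as before; the
  others impose no condition at y.\<close>

lemma flat_at_blowup_center:
  fixes Z :: "'i \<Rightarrow> (real^'m) set"
  assumes flat: "flat_at T P (insert a I) Z X (\<beta> y)" and bl: "is_blowup X (Z a) B \<beta>" and y: "y \<in> B" "\<beta> y \<in> Z a"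
    and T: "subspace T" and sub: "\<And>i. i \<in> I \<Longrightarrow> \<beta> y \<in> Z i \<Longrightarrow> Z a \<subseteq> Z i"
    and cl: "\<And>i. i \<in> I \<Longrightarrow> closedin (top_of_set X) (Z i)"
  shows "flat_at T P I (\<lambda>i. proper_transform (Z a) B \<beta> (Z i)) B y"
proof -
  note \<beta> = is_blowup_smooth_map[OF bl]
  obtain V S R \<psi> and \<phi> :: "real^'m \<Rightarrow> real^'m" where V:
    "openin (top_of_set X) V" "\<beta> y \<in> V" "openin (top_of_set T) (\<phi> ` V)" "diffeo V (\<phi> ` V) \<phi>"
    "subspace S" "S \<subseteq> T" "\<phi> ` (V \<inter> Z a) = \<phi> ` V \<inter> S"
    "diffeo (B \<inter> \<beta> -` V) (blowup_over T S (\<phi> ` V)) \<psi>"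
    "\<And>y. y \<in> B \<Longrightarrow> \<beta> y \<in> V \<Longrightarrow> fst (\<psi> y) = \<phi> (\<beta> y)"
    "\<And>i. i \<in> I \<Longrightarrow> \<beta> y \<in> Z i \<Longrightarrow> subspace (R i) \<and> R i \<subseteq> T \<and> P i (R i) \<and> \<phi> ` (V \<inter> Z i) = \<phi> ` V \<inter> R i \<and> S \<subseteq> R i"
    by (rule blowup_center_chart[OF flat bl y(2) T sub], assumption, assumption, rule that)
  note PT = proper_transform_chart[OF \<beta> V(1) diffeo_inj_on[OF V(4)] V(3) T V(5) _ _ _ V(7) _ V(8,9)]
  have \<psi>y: "\<psi> y \<in> blowup_over T S (\<phi> ` V)"
    by (rule smooth_map_image[OF diffeo_smooth_map[OF V(8)]]) (use y V(2) in auto)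
  then have "\<psi> y \<in> linear_blowup T S" by simp
  then obtain w u c where u: "\<psi> y = (w, proj_point u)" "w \<in> T" "u \<in> T" "u \<noteq> 0" "operp S u = u" "operp S w = c *\<^sub>R u"
    by (rule linear_blowup_cases[OF T V(5,6)])
  \<comment> \<open>The unit vector on the line over y becomes the distinguished direction, so that
    y lies in the domain of the affine chart.\<close>
  define e where "e = inverse (norm u) *\<^sub>R u"
  have e: "e \<bullet> e = 1" "operp S e = e" "e \<in> T"
    using u by (auto simp: e_def operp_scaleR[OF V(5)] subspace_scale[OF T] dot_square_norm power2_eq_square)
  let ?D = "{q. e \<bullet> (snd q *v e) \<noteq> 0} :: ((real^'m) \<times> (real^'m^'m)) set"
  have oD: "open ?D" using smooth_on_open[OF smooth_on_blowup_coords[OF V(5)]] .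
  define E where "E = blowup_over T S (\<phi> ` V) \<inter> ?D"
  define U where "U = (B \<inter> \<beta> -` V) \<inter> \<psi> -` ?D"
  define W where "W = T \<inter> (\<lambda>x. fst (blowup_chart S e x)) -` (\<phi> ` V)"
  note cm = blowup_chart_mem[OF V(5) e(1,2)] and km = blowup_coords_mem[OF V(5) e(1,2)]
    and kc = blowup_coords_chart[OF V(5) e(1,2)] and cd = blowup_chart_dom[OF V(5) e(1,2)]
  have ue: "\<psi> y \<in> ?D"
    using u(1,4) by (simp add: e_def proj_point_mult)
  have oU: "openin (top_of_set B) U"
  proof -
    have "openin (top_of_set (B \<inter> \<beta> -` V)) U"
      unfolding U_def by (rule continuous_openin_preimage_gen[OF smooth_map_continuous_on[OF diffeo_smooth_map[OF V(8)]] oD])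
    moreover have "openin (top_of_set B) (B \<inter> \<beta> -` V)"
      by (rule continuous_openin_preimage[OF smooth_map_continuous_on[OF \<beta>] _ V(1)])
        (use smooth_map_image[OF \<beta>] in auto)
    ultimately show ?thesis by (rule openin_trans)
  qed
  have oW: "openin (top_of_set T) W"
  proof -
    obtain Q where Q: "open Q" "\<phi> ` V = T \<inter> Q" using V(3) by (auto simp: openin_open)
    have "fst (blowup_chart S e x) \<in> T" if "x \<in> T" for x
      by (rule linear_blowup_cases[OF T V(5,6) cm[OF T V(6) e(3) that]]) simp
    then have "W = T \<inter> (\<lambda>x. fst (blowup_chart S e x)) -` Q" unfolding W_def Q(2) by auto
    moreover have "open ((\<lambda>x. fst (blowup_chart S e x)) -` Q)"
      by (rule open_vimage[OF Q(1)])
        (intro continuous_on_fst smooth_on_imp_continuous[OF smooth_on_blowup_chart[OF V(5) e(1,2)]])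
    ultimately show ?thesis by auto
  qed
  have dE: "diffeo E W (blowup_coords S e)"
  proof (rule diffeoI[where g = "blowup_chart S e"])
    show "smooth_map E W (blowup_coords S e)"
    proof (rule smooth_mapI_smooth_on[OF smooth_on_blowup_coords[OF V(5)]])
      show "blowup_coords S e ` E \<subseteq> W"
      proof
        fix x assume "x \<in> blowup_coords S e ` E"
        then obtain q where q: "x = blowup_coords S e q" "q \<in> linear_blowup T S" "fst q \<in> \<phi> ` V" "e \<bullet> (snd q *v e) \<noteq> 0"
          by (auto simp: E_def)
        then show "x \<in> W" using km[OF T V(6) e(3) q(2,4)] by (simp add: W_def)
      qed
    qed (auto simp: E_def)
    show "smooth_map W E (blowup_chart S e)"
      by (rule smooth_mapI_smooth_on[OF smooth_on_blowup_chart[OF V(5) e(1,2)]])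
        (use cm[OF T V(6) e(3)] cd in \<open>auto simp: E_def W_def\<close>)
    show "blowup_chart S e (blowup_coords S e q) = q" if "q \<in> E" for q
      using km[OF T V(6) e(3)] that by (auto simp: E_def)
    show "blowup_coords S e (blowup_chart S e x) = x" for x by (rule kc)
  qed
  have "\<psi> ` U = \<psi> ` (B \<inter> \<beta> -` V) \<inter> ?D" unfolding U_def by auto
  then have imgU: "\<psi> ` U = E" unfolding diffeo_image[OF V(8)] E_def .
  have "U \<subseteq> B \<inter> \<beta> -` V" unfolding U_def by blast
  from diffeo_restrict[OF V(8) this] have d1: "diffeo U E \<psi>" unfolding imgU .
  have dU: "diffeo U W (\<lambda>y. blowup_coords S e (\<psi> y))" by (rule diffeo_compose[OF d1 dE])
  show ?thesis
  proof (rule flat_atI[OF oU _ oW dU])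
    show "y \<in> U" using y V(2) ue by (auto simp: U_def)
    fix i assume i: "i \<in> I" "y \<in> proper_transform (Z a) B \<beta> (Z i)"
    have "\<beta> y \<in> Z i" using proper_transform_subset[OF \<beta> cl[OF i(1)]] i(2) by auto
    then have R: "subspace (R i)" "R i \<subseteq> T" "P i (R i)" "\<phi> ` (V \<inter> Z i) = \<phi> ` V \<inter> R i" "S \<subseteq> R i"
      using V(10) i(1) by auto
    have pt: "y' \<in> proper_transform (Z a) B \<beta> (Z i) \<longleftrightarrow> \<psi> y' \<in> linear_blowup (R i) S" if "y' \<in> U" for y'
      by (rule PT[OF R(5,1,2,4)]) (use that in \<open>auto simp: U_def\<close>)
    have "\<psi> y \<in> linear_blowup (R i) S" using pt[of y] i(2) y V(2) ue by (auto simp: U_def)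
    \<comment> \<open>The line over y is spanned by a vector of \<open>R i\<close> as well as by u,
      so the direction e lies in \<open>R i\<close>, as \<open>blowup_coords_mem\<close>
      requires.\<close>
    then obtain w' u' c' where u': "\<psi> y = (w', proj_point u')" "u' \<in> R i" "u' \<noteq> 0"
      by (rule linear_blowup_cases[OF R(1) V(5) R(5)])
    have "snd (\<psi> y) *v u = u" using u(1,4) by (simp add: proj_point_mult_self)
    then have "u = ((u' \<bullet> u) / (u' \<bullet> u')) *\<^sub>R u'" using u'(1) by (simp add: proj_point_mult)
    then have "u \<in> R i" using subspace_scale[OF R(1) u'(2)] by metis
    then have eR: "e \<in> R i" unfolding e_def by (rule subspace_scale[OF R(1)])
    have "(\<lambda>y. blowup_coords S e (\<psi> y)) ` (U \<inter> proper_transform (Z a) B \<beta> (Z i)) = W \<inter> R i"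
    proof (intro equalityI subsetI)
      fix x assume "x \<in> (\<lambda>y. blowup_coords S e (\<psi> y)) ` (U \<inter> proper_transform (Z a) B \<beta> (Z i))"
      then obtain y' where y': "x = blowup_coords S e (\<psi> y')" "y' \<in> U" "y' \<in> proper_transform (Z a) B \<beta> (Z i)" by auto
      have "x \<in> W" using y' smooth_map_image[OF diffeo_smooth_map[OF dU] y'(2)] by simp
      moreover have "x \<in> R i"
        using km[OF R(1,5) eR] pt[OF y'(2)] y' by (simp add: U_def)
      ultimately show "x \<in> W \<inter> R i" by simp
    next
      fix x assume x: "x \<in> W \<inter> R i"
      then have "x \<in> (\<lambda>y. blowup_coords S e (\<psi> y)) ` U" using diffeo_image[OF dU] by simp
      then obtain y' where y': "y' \<in> U" "x = blowup_coords S e (\<psi> y')" by auto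
      have "\<psi> y' \<in> E" using imgU y' by auto
      then have "blowup_chart S e x = \<psi> y'" using km[OF T V(6) e(3), of "\<psi> y'"] y'(2) by (simp add: E_def)
      then have "\<psi> y' \<in> linear_blowup (R i) S" using cm[OF R(1,5) eR, of x] x by simp
      then show "x \<in> (\<lambda>y. blowup_coords S e (\<psi> y)) ` (U \<inter> proper_transform (Z a) B \<beta> (Z i))"
        using pt[OF y'(1)] y' by auto
    qed
    then show "\<exists>S'. subspace S' \<and> S' \<subseteq> T \<and> P i S' \<and>
        (\<lambda>y. blowup_coords S e (\<psi> y)) ` (U \<inter> proper_transform (Z a) B \<beta> (Z i)) = W \<inter> S'"
      using R by blast
  qed
qed

text \<open>The assumption \<open>min\<close> makes the centre contained in every member it meets.
  Charts persist by the two preceding lemmas; what remains is that proper transforms meet in the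
  proper transform of the intersection, or not at all if that intersection was the centre.\<close>

lemma flat_arrangement_blowup:
  fixes Z :: "'e set \<Rightarrow> (real^'m) set"
  assumes arr: "flat_arrangement T P (insert a I) Z X" and a: "a \<notin> I" and bl: "is_blowup X (Z a) B \<beta>"
    and min: "\<And>i. i \<in> I \<Longrightarrow> a \<inter> i \<in> insert a I \<Longrightarrow> a \<subseteq> i"
  shows "flat_arrangement T P I (\<lambda>i. proper_transform (Z a) B \<beta> (Z i)) B"
proof -
  note \<beta> = is_blowup_smooth_map[OF bl]
  have T: "subspace T" and cl: "\<And>i. i \<in> insert a I \<Longrightarrow> closedin (top_of_set X) (Z i)"
    and meet: "\<And>i j. i \<in> insert a I \<Longrightarrow> j \<in> insert a I \<Longrightarrow> Z i \<inter> Z j = (if i \<inter> j \<in> insert a I then Z (i \<inter> j) else {})"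
    and flat: "\<And>x. x \<in> X \<Longrightarrow> flat_at T P (insert a I) Z X x"
  proof -
    note A = arr[unfolded flat_arrangement_def]
    show "subspace T" using A by (rule conjunct1)
    show "closedin (top_of_set X) (Z i)" if "i \<in> insert a I" for i
      by (rule bspec[OF A[THEN conjunct2, THEN conjunct1] that])
    show "Z i \<inter> Z j = (if i \<inter> j \<in> insert a I then Z (i \<inter> j) else {})" if "i \<in> insert a I" "j \<in> insert a I" for i j
      by (rule bspec[OF bspec[OF A[THEN conjunct2, THEN conjunct2, THEN conjunct1] that(1)] that(2)])
    show "flat_at T P (insert a I) Z X x" if "x \<in> X" for x
      by (rule bspec[OF A[THEN conjunct2, THEN conjunct2, THEN conjunct2] that])
  qed
  \<comment> \<open>A common point means that the index of the intersection is listed, and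
    minimality turns this into containment.\<close>
  have below: "a \<subseteq> i" "Z a \<subseteq> Z i" if i: "i \<in> I" and x: "x \<in> Z a" "x \<in> Z i" for i x
  proof -
    have "a \<inter> i \<in> insert a I" using meet[of a i] i x by (auto split: if_splits)
    then show ai: "a \<subseteq> i" by (rule min[OF i])
    then have "a \<inter> i = a" by auto
    then show "Z a \<subseteq> Z i" using meet[of a i] i by auto
  qed
  have flatB: "flat_at T P I (\<lambda>i. proper_transform (Z a) B \<beta> (Z i)) B y" if y: "y \<in> B" for y
  proof (cases "\<beta> y \<in> Z a")
    case True
    show ?thesis
      by (rule flat_at_blowup_center[OF flat[OF smooth_map_image[OF \<beta> y]] bl y True T below(2)[OF _ True] cl]) auto
  next
    case False
    have "flat_at T P I Z X (\<beta> y)"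
      using flat[OF smooth_map_image[OF \<beta> y]] by (rule flat_atE) (rule flat_atI, assumption+, simp)
    then show ?thesis
      by (rule flat_at_blowup_off[OF _ bl y False cl]) auto
  qed
  have meetB: "proper_transform (Z a) B \<beta> (Z i) \<inter> proper_transform (Z a) B \<beta> (Z j) =
      (if i \<inter> j \<in> I then proper_transform (Z a) B \<beta> (Z (i \<inter> j)) else {})" if ij: "i \<in> I" "j \<in> I" for i j
  proof -
    have "i \<inter> j \<in> I \<and> y \<in> proper_transform (Z a) B \<beta> (Z (i \<inter> j))"
      if y: "y \<in> proper_transform (Z a) B \<beta> (Z i)" "y \<in> proper_transform (Z a) B \<beta> (Z j)" for y
    proof -
      have yB: "y \<in> B" "\<beta> y \<in> Z i" "\<beta> y \<in> Z j"
        using y proper_transform_subset[OF \<beta> cl] ij by blast+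
      have d: "i \<inter> j \<in> insert a I" "\<beta> y \<in> Z (i \<inter> j)" "Z i \<inter> Z j = Z (i \<inter> j)"
        using meet[of i j] ij yB by (auto split: if_splits)
      show ?thesis
      proof (cases "\<beta> y \<in> Z a")
        case False
        then have "i \<inter> j \<in> I" using d by auto
        then show ?thesis using proper_transform_off[OF \<beta> cl yB(1) False, of "i \<inter> j"] d(2) by auto
      next
        case True
        obtain V S R \<psi> and \<phi> :: "real^'m \<Rightarrow> real^'m" where V:
          "openin (top_of_set X) V" "\<beta> y \<in> V" "openin (top_of_set T) (\<phi> ` V)" "diffeo V (\<phi> ` V) \<phi>"
          "subspace S" "S \<subseteq> T" "\<phi> ` (V \<inter> Z a) = \<phi> ` V \<inter> S"
          "diffeo (B \<inter> \<beta> -` V) (blowup_over T S (\<phi> ` V)) \<psi>"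
          "\<And>y. y \<in> B \<Longrightarrow> \<beta> y \<in> V \<Longrightarrow> fst (\<psi> y) = \<phi> (\<beta> y)"
          "\<And>i. i \<in> I \<Longrightarrow> \<beta> y \<in> Z i \<Longrightarrow> subspace (R i) \<and> R i \<subseteq> T \<and> P i (R i) \<and> \<phi> ` (V \<inter> Z i) = \<phi> ` V \<inter> R i \<and> S \<subseteq> R i"
          by (rule blowup_center_chart[OF flat[OF smooth_map_image[OF \<beta> yB(1)]] bl True T below(2)[OF _ True]], assumption, assumption, rule that)
        note PT = proper_transform_chart[OF \<beta> V(1) diffeo_inj_on[OF V(4)] V(3) T V(5) _ _ _ V(7) _ V(8,9) yB(1) V(2)]
        note Ri = V(10)[OF ij(1) yB(2)] and Rj = V(10)[OF ij(2) yB(3)]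
        have qi: "\<psi> y \<in> linear_blowup (R i) S" and qj: "\<psi> y \<in> linear_blowup (R j) S"
          using y PT[of "R i" "Z i"] PT[of "R j" "Z j"] Ri Rj by auto
        obtain w u c where u: "\<psi> y = (w, proj_point u)" "w \<in> R i" "u \<in> R i" "u \<noteq> 0" "operp S u = u" "operp S w = c *\<^sub>R u"
          using Ri qi by (auto elim: linear_blowup_cases[of "R i" S, rotated 3] simp: V(5))
        obtain w' u' c' where u': "\<psi> y = (w', proj_point u')" "w' \<in> R j" "u' \<in> R j" "u' \<noteq> 0" "operp S u' = u'" "operp S w' = c' *\<^sub>R u'"
          using Rj qj by (auto elim: linear_blowup_cases[of "R j" S, rotated 3] simp: V(5))
        have "proj_point u = proj_point u'" using u(1) u'(1) by simp
        then have "proj_point u' *v u = u" using proj_point_mult_self[OF u(4)] by simp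
        then have "u = ((u' \<bullet> u) / (u' \<bullet> u')) *\<^sub>R u'" by (simp add: proj_point_mult)
        then have uj: "u \<in> R j" using subspace_scale[of "R j" u'] u'(3) Rj by metis
        have wj: "w \<in> R j" using u(1) u'(1,2) by simp
        have w: "w = \<phi> (\<beta> y)" using V(9)[OF yB(1) V(2)] u(1) by simp
        have sRij: "subspace (R i \<inter> R j)" using Ri Rj by (simp add: subspace_inter)
        \<comment> \<open>Near w the subspace \<open>R i \<inter> R j\<close> is the chart image of
          the intersection of the two members, so it is contained in any linear model of that
          intersection.\<close>
        have loc: "R i \<inter> R j \<subseteq> Q" if "subspace Q" "\<phi> ` (V \<inter> Z (i \<inter> j)) = \<phi> ` V \<inter> Q" for Q
        proof (rule subspace_subset_local[OF T V(3) _ _ sRij _ that(1)])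
          show "w \<in> \<phi> ` V" "w \<in> R i \<inter> R j" "R i \<inter> R j \<subseteq> T" using w V(2) u(2) wj Ri by auto
          have "\<phi> ` V \<inter> (R i \<inter> R j) = \<phi> ` (V \<inter> Z i) \<inter> \<phi> ` (V \<inter> Z j)" using Ri Rj by auto
          also have "\<dots> = \<phi> ` (V \<inter> Z (i \<inter> j))"
            using inj_on_image_Int[OF diffeo_inj_on[OF V(4)], of "V \<inter> Z i" "V \<inter> Z j"] d(3) by (simp add: Int_ac)
          finally show "\<phi> ` V \<inter> (R i \<inter> R j) \<subseteq> Q" using that(2) by auto
        qed
        \<comment> \<open>If the two members met only in the centre, the common direction u would
          lie in S, although it is normal to S and non-zero: the blowup has separated them.\<close>
        have ne: "i \<inter> j \<noteq> a"
        proof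
          assume "i \<inter> j = a"
          then have "R i \<inter> R j \<subseteq> S" using loc[OF V(5)] V(7) by simp
          then have "u \<in> S" using u(3) uj by auto
          then show False using u(4,5) operp_eq_0_iff[OF V(5), of u] by simp
        qed
        then have dI: "i \<inter> j \<in> I" using d(1) by simp
        note Rd = V(10)[OF dI d(2)]
        have "R i \<inter> R j \<subseteq> R (i \<inter> j)" using loc[of "R (i \<inter> j)"] Rd by simp
        then have "\<psi> y \<in> linear_blowup (R (i \<inter> j)) S"
          unfolding u(1) using Rd u wj uj by (intro linear_blowupI[OF _ V(5)]) auto
        then show ?thesis using PT[of "R (i \<inter> j)" "Z (i \<inter> j)"] Rd dI by simp
      qed
    qed
    moreover have "proper_transform (Z a) B \<beta> (Z (i \<inter> j)) \<subseteq> proper_transform (Z a) B \<beta> (Z i) \<inter> proper_transform (Z a) B \<beta> (Z j)"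
      if "i \<inter> j \<in> I"
    proof -
      have "Z (i \<inter> j) \<subseteq> Z i" "Z (i \<inter> j) \<subseteq> Z j" using meet[of i j] ij that by auto
      then show ?thesis by (intro Int_greatest proper_transform_mono)
    qed
    ultimately show ?thesis by (cases "i \<inter> j \<in> I") auto
  qed
  have "closedin (top_of_set B) (proper_transform (Z a) B \<beta> S)" for S
    unfolding proper_transform_def by (rule closedin_closed_Int) simp
  then show ?thesis
    unfolding flat_arrangement_def using T flatB meetB by simp
qed

section \<open>Blowups along hypersurfaces\<close>

lemma diffeo_if_locally:
  assumes "smooth_map B X \<beta>"
    "\<And>x. x \<in> X \<Longrightarrow> \<exists>V. openin (top_of_set X) V \<and> x \<in> V \<and> diffeo (B \<inter> \<beta> -` V) V \<beta>"
  shows "diffeo B X \<beta>"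
proof (rule diffeo_local)
  show "bij_betw \<beta> B X"
    unfolding bij_betw_def
  proof
    show "inj_on \<beta> B"
    proof (rule inj_onI)
      fix y y' assume y: "y \<in> B" "y' \<in> B" "\<beta> y = \<beta> y'"
      then obtain V where "\<beta> y \<in> V" "diffeo (B \<inter> \<beta> -` V) V \<beta>"
        using assms(2) smooth_map_image[OF assms(1)] by blast
      then show "y = y'" using y by (auto dest!: diffeo_inj_on inj_onD)
    qed
    show "\<beta> ` B = X"
    proof
      show "X \<subseteq> \<beta> ` B"
      proof
        fix x assume "x \<in> X"
        then obtain V where "x \<in> V" "diffeo (B \<inter> \<beta> -` V) V \<beta>" using assms(2) by blast
        then show "x \<in> \<beta> ` B" using diffeo_image by blast
      qed
    qed (use smooth_map_image[OF assms(1)] in auto)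
  qed
qed (use assms in auto)

text \<open>The quotient T/S is one-dimensional, so there is only one line to choose and the line
  component is constant.\<close>

lemma linear_blowup_codim1:
  assumes "subspace T" "subspace S" "S \<subseteq> T" "dim S + 1 = dim T"
  obtains e where "linear_blowup T S = (\<lambda>w. (w, proj_point e)) ` T"
proof -
  have "S \<noteq> T" using assms(4) by auto
  then obtain v where v: "v \<in> T" "v \<notin> S" using assms(3) by auto
  define e where "e = operp S v"
  have e: "e \<in> T" "e \<noteq> 0" "operp S e = e"
    using v operp_mem[OF assms(2,1,3)] operp_eq_0_iff[OF assms(2)] operp_operp[OF assms(2)] by (auto simp: e_def)
  have "e \<notin> S" using operp_eq_0_iff[OF assms(2), of e] e by simp
  then have "e \<notin> span S" using assms(2) by (simp add: span_eq_iff[THEN iffD2])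
  then have "dim (span (insert e S)) = dim T" using assms(4) by (simp add: dim_insert)
  moreover have "span (insert e S) \<subseteq> T" using e(1) assms(1,3) by (intro span_minimal) auto
  ultimately have spT: "span (insert e S) = T"
    using subspace_dim_equal[OF subspace_span assms(1)] by simp
  have k: "\<exists>k. operp S w = k *\<^sub>R e" if "w \<in> T" for w
  proof -
    have "w \<in> span (insert e S)" using that spT by simp
    then obtain k where "w - k *\<^sub>R e \<in> span S" unfolding span_breakdown_eq by auto
    then have "w - k *\<^sub>R e \<in> S" using assms(2) by (simp add: span_eq_iff[THEN iffD2])
    then have "operp S (w - k *\<^sub>R e) = 0" by (simp add: operp_eq_0_iff[OF assms(2)])
    then show ?thesis by (auto simp: operp_sub[OF assms(2)] operp_scaleR[OF assms(2)] e(3))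
  qed
  have "linear_blowup T S = (\<lambda>w. (w, proj_point e)) ` T"
  proof (intro equalityI subsetI)
    fix q assume "q \<in> linear_blowup T S"
    then obtain w u c where u: "q = (w, proj_point u)" "w \<in> T" "u \<in> T" "u \<noteq> 0" "operp S u = u"
      by (rule linear_blowup_cases[OF assms(1-3)])
    obtain k where "u = k *\<^sub>R e" using k[OF u(3)] u(5) by auto
    then show "q \<in> (\<lambda>w. (w, proj_point e)) ` T" using u(1,2,4) by (auto simp: proj_point_scaleR)
  next
    fix q assume "q \<in> (\<lambda>w. (w, proj_point e)) ` T"
    then obtain w where w: "w \<in> T" "q = (w, proj_point e)" by auto
    obtain c where "operp S w = c *\<^sub>R e" using k[OF w(1)] by auto
    then show "q \<in> linear_blowup T S" unfolding w(2) using w(1) e by (intro linear_blowupI[OF assms(1-3)])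
  qed
  then show ?thesis by (rule that)
qed

lemma diffeo_fst_blowup_over_codim1:
  assumes T: "subspace T" "subspace S" "S \<subseteq> T" "dim S + 1 = dim T" and W: "W \<subseteq> T"
  obtains e where "diffeo (blowup_over T S W) W fst" "diffeo W (blowup_over T S W) (\<lambda>w. (w, proj_point e))"
proof -
  obtain e where e: "linear_blowup T S = (\<lambda>w. (w, proj_point e)) ` T"
    by (rule linear_blowup_codim1[OF T])
  have 1: "smooth_map (blowup_over T S W) W fst"
    by (rule smooth_mapI_smooth_on[OF smooth_on_fst[OF smooth_on_ident[OF open_UNIV]]]) auto
  have 2: "smooth_map W (blowup_over T S W) (\<lambda>w. (w, proj_point e))"
    by (rule smooth_mapI_smooth_on[OF smooth_on_Pair[OF smooth_on_ident[OF open_UNIV] smooth_on_const[OF open_UNIV]]])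
      (use W e in auto)
  show ?thesis
    by (rule that[of e]; rule diffeoI[OF 1 2] diffeoI[OF 2 1]) (use e in auto)
qed

text \<open>With the constant normal line attached, a chart of X is already a chart of its blowup.
  Thus hypersurfaces can be added to a list of centres without changing the space.\<close>

lemma is_blowup_hypersurface_id:
  fixes Z :: "'i \<Rightarrow> (real^'m) set"
  assumes "subspace T" "closedin (top_of_set X) (Z i)" "i \<in> I" "\<And>S. P i S \<Longrightarrow> dim S + 1 = dim T"
    "\<And>x. x \<in> X \<Longrightarrow> flat_at T P I Z X x"
  shows "is_blowup X (Z i) X id"
  unfolding is_blowup_def
proof (intro conjI ballI)
  show "smooth_map X X id" using smooth_map_ident[of X] by (simp add: id_def)
  show "diffeo (X - id -` Z i) (X - Z i) id" using diffeo_ident[of "X - Z i"] by (simp add: id_def)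
  fix z assume z: "z \<in> Z i"
  then have zX: "z \<in> X" using closedin_imp_subset[OF assms(2)] by auto
  obtain V W and \<phi> :: "real^'m \<Rightarrow> real^'m" where V: "openin (top_of_set X) V" "z \<in> V" "openin (top_of_set T) W" "diffeo V W \<phi>"
    "\<forall>i\<in>I. z \<in> Z i \<longrightarrow> (\<exists>S. subspace S \<and> S \<subseteq> T \<and> P i S \<and> \<phi> ` (V \<inter> Z i) = W \<inter> S)"
    by (rule flat_atE[OF assms(5)[OF zX]], rule that)
  then obtain S where S: "subspace S" "S \<subseteq> T" "P i S" "\<phi> ` (V \<inter> Z i) = W \<inter> S" using z assms(3) by auto
  obtain e where e: "diffeo W (blowup_over T S W) (\<lambda>w. (w, proj_point e))"
    by (rule diffeo_fst_blowup_over_codim1[OF assms(1) S(1,2) assms(4)[OF S(3)] openin_imp_subset[OF V(3)]])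
  have "X \<inter> id -` V = V" using openin_imp_subset[OF V(1)] by auto
  then have "diffeo (X \<inter> id -` V) (blowup_over T S W) (\<lambda>v. (\<phi> v, proj_point e))"
    using diffeo_compose[OF V(4) e] by simp
  then show "\<exists>V W T S (\<phi> :: real^'m \<Rightarrow> real^'m) \<psi>.
            openin (top_of_set X) V \<and> z \<in> V \<and> subspace T \<and> subspace S \<and> S \<subseteq> T \<and>
            openin (top_of_set T) W \<and> diffeo V W \<phi> \<and> \<phi> ` (V \<inter> Z i) = W \<inter> S \<and>
            diffeo (X \<inter> id -` V) {q \<in> linear_blowup T S. fst q \<in> W} \<psi> \<and>
            (\<forall>y\<in>X \<inter> id -` V. fst (\<psi> y) = \<phi> (id y))"
    by (intro exI[of _ V] exI[of _ W] exI[of _ T] exI[of _ S] exI[of _ \<phi>] exI[of _ "\<lambda>v. (\<phi> v, proj_point e)"])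
      (use V S assms(1) in simp)
qed (rule assms(2))

text \<open>Any other blowup of a hypersurface is a diffeomorphism: near the centre
  \<open>\<beta>\<close> is the blowup chart, followed by the projection \<open>fst\<close>, which
  is a diffeomorphism in codimension one, and the inverse of the chart of X.\<close>

lemma is_blowup_hypersurface_diffeo:
  fixes Z :: "'i \<Rightarrow> (real^'m) set"
  assumes T: "subspace T" and i: "i \<in> I" and P: "\<And>S. P i S \<Longrightarrow> dim S + 1 = dim T"
    and flat: "\<And>x. x \<in> X \<Longrightarrow> flat_at T P I Z X x" and bl: "is_blowup X (Z i) B \<beta>"
  shows "diffeo B X \<beta>"
proof (rule diffeo_if_locally[OF is_blowup_smooth_map[OF bl]])
  fix x assume x: "x \<in> X"
  have cl: "closedin (top_of_set X) (Z i)" and d\<beta>: "diffeo (B - \<beta> -` Z i) (X - Z i) \<beta>" using bl by (auto simp: is_blowup_def)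
  show "\<exists>V. openin (top_of_set X) V \<and> x \<in> V \<and> diffeo (B \<inter> \<beta> -` V) V \<beta>"
  proof (cases "x \<in> Z i")
    case False
    have "openin (top_of_set X) (X - Z i)" by (rule openin_diff[OF _ cl]) simp
    moreover have "B \<inter> \<beta> -` (X - Z i) = B - \<beta> -` Z i"
      using smooth_map_image[OF is_blowup_smooth_map[OF bl]] by auto
    ultimately show ?thesis using False x d\<beta> by (intro exI[of _ "X - Z i"]) simp
  next
    case True
    obtain V W and \<phi> :: "real^'m \<Rightarrow> real^'m" where V: "openin (top_of_set X) V" "x \<in> V" "openin (top_of_set T) W" "diffeo V W \<phi>"
      "\<forall>i\<in>I. x \<in> Z i \<longrightarrow> (\<exists>S. subspace S \<and> S \<subseteq> T \<and> P i S \<and> \<phi> ` (V \<inter> Z i) = W \<inter> S)"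
      by (rule flat_atE[OF flat[OF x]], rule that)
    then obtain S where S: "subspace S" "S \<subseteq> T" "P i S" "\<phi> ` (V \<inter> Z i) = W \<inter> S" using True i by auto
    obtain V' \<psi> where V': "openin (top_of_set X) V'" "x \<in> V'" "V' \<subseteq> V"
      "diffeo (B \<inter> \<beta> -` V') (blowup_over T S (\<phi> ` V')) \<psi>"
      "\<And>y. y \<in> B \<Longrightarrow> \<beta> y \<in> V' \<Longrightarrow> fst (\<psi> y) = \<phi> (\<beta> y)"
      by (rule blowup_over_chart[OF bl V(2) True V(1,3,4) T S(1,2,4)], rule that)
    have "\<phi> ` V' \<subseteq> T" using V'(3) diffeo_image[OF V(4)] openin_imp_subset[OF V(3)] by auto
    then have f: "diffeo (blowup_over T S (\<phi> ` V')) (\<phi> ` V') fst"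
      by (rule diffeo_fst_blowup_over_codim1[OF T S(1,2) P[OF S(3)]])
    obtain g where g: "\<And>a. a \<in> V' \<Longrightarrow> g (\<phi> a) = a" "diffeo (\<phi> ` V') V' g"
      by (rule diffeo_inverse[OF diffeo_restrict[OF V(4) V'(3)]], rule that)
    have "diffeo (B \<inter> \<beta> -` V') V' (\<lambda>y. g (fst (\<psi> y)))"
      by (rule diffeo_compose[OF diffeo_compose[OF V'(4) f] g(2)])
    then have "diffeo (B \<inter> \<beta> -` V') V' \<beta>"
      by (rule diffeo_cong) (use V'(5) g(1) in simp)
    then show ?thesis using V' by blast
  qed
qed

text \<open>Only the charts of B change, by composition with \<open>\<gamma>\<close>. This lets a
  blowup absorb a diffeomorphism that is left over at the end of a sequence.\<close>

lemma is_blowup_precompose: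
  fixes \<gamma> :: "real^'m \<Rightarrow> real^'m"
  assumes bl: "is_blowup X Z B \<beta>" and \<gamma>: "diffeo B' B \<gamma>"
  shows "is_blowup X Z B' (\<beta> \<circ> \<gamma>)"
  unfolding is_blowup_def
proof (intro conjI ballI)
  have pre: "diffeo (B' \<inter> \<gamma> -` A) A \<gamma>" if "A \<subseteq> B" for A
  proof -
    have "\<gamma> ` (B' \<inter> \<gamma> -` A) = A" using diffeo_image[OF \<gamma>] that by auto
    then show ?thesis using diffeo_restrict[OF \<gamma>, of "B' \<inter> \<gamma> -` A"] by simp
  qed
  have \<gamma>B: "\<gamma> y \<in> B" if "y \<in> B'" for y using smooth_map_image[OF diffeo_smooth_map[OF \<gamma>] that] .
  show "closedin (top_of_set X) Z" using bl by (simp add: is_blowup_def)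
  show "smooth_map B' X (\<beta> \<circ> \<gamma>)"
    using smooth_map_compose[OF diffeo_smooth_map[OF \<gamma>] is_blowup_smooth_map[OF bl]] by (simp add: comp_def)
  have "diffeo (B - \<beta> -` Z) (X - Z) \<beta>" using bl by (simp add: is_blowup_def)
  from diffeo_compose[OF pre this] have "diffeo (B' \<inter> \<gamma> -` (B - \<beta> -` Z)) (X - Z) (\<lambda>x. \<beta> (\<gamma> x))" by auto
  moreover have "B' \<inter> \<gamma> -` (B - \<beta> -` Z) = B' - (\<beta> \<circ> \<gamma>) -` Z" using \<gamma>B by auto
  ultimately show "diffeo (B' - (\<beta> \<circ> \<gamma>) -` Z) (X - Z) (\<beta> \<circ> \<gamma>)" by (simp add: comp_def)
  fix z assume "z \<in> Z"
  then have "\<exists>V W T S (\<phi> :: real^'m \<Rightarrow> real^'m) \<psi>.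
        openin (top_of_set X) V \<and> z \<in> V \<and>
        subspace T \<and> subspace S \<and> S \<subseteq> T \<and> openin (top_of_set T) W \<and>
        diffeo V W \<phi> \<and> \<phi> ` (V \<inter> Z) = W \<inter> S \<and>
        diffeo (B \<inter> \<beta> -` V) {q \<in> linear_blowup T S. fst q \<in> W} \<psi> \<and>
        (\<forall>y\<in>B \<inter> \<beta> -` V. fst (\<psi> y) = \<phi> (\<beta> y))"
    using bl unfolding is_blowup_def by simp
  then obtain V W T S and \<phi> :: "real^'m \<Rightarrow> real^'m" and \<psi> where V:
    "openin (top_of_set X) V" "z \<in> V" "subspace T" "subspace S" "S \<subseteq> T" "openin (top_of_set T) W"
    "diffeo V W \<phi>" "\<phi> ` (V \<inter> Z) = W \<inter> S" "diffeo (B \<inter> \<beta> -` V) (blowup_over T S W) \<psi>"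
    "\<forall>y\<in>B \<inter> \<beta> -` V. fst (\<psi> y) = \<phi> (\<beta> y)"
    by (elim exE conjE) (rule that)
  have "diffeo (B' \<inter> \<gamma> -` (B \<inter> \<beta> -` V)) (blowup_over T S W) (\<lambda>y. \<psi> (\<gamma> y))"
    by (rule diffeo_compose[OF pre V(9)]) auto
  moreover have "B' \<inter> \<gamma> -` (B \<inter> \<beta> -` V) = B' \<inter> (\<beta> \<circ> \<gamma>) -` V" using \<gamma>B by auto
  ultimately have "diffeo (B' \<inter> (\<beta> \<circ> \<gamma>) -` V) (blowup_over T S W) (\<lambda>y. \<psi> (\<gamma> y))" by simp
  moreover have "\<forall>y\<in>B' \<inter> (\<beta> \<circ> \<gamma>) -` V. fst (\<psi> (\<gamma> y)) = \<phi> ((\<beta> \<circ> \<gamma>) y)" using V(10) \<gamma>B by simp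
  ultimately show "\<exists>V W T S (\<phi> :: real^'m \<Rightarrow> real^'m) \<psi>.
            openin (top_of_set X) V \<and> z \<in> V \<and> subspace T \<and> subspace S \<and> S \<subseteq> T \<and>
            openin (top_of_set T) W \<and> diffeo V W \<phi> \<and> \<phi> ` (V \<inter> Z) = W \<inter> S \<and>
            diffeo (B' \<inter> (\<beta> \<circ> \<gamma>) -` V) {q \<in> linear_blowup T S. fst q \<in> W} \<psi> \<and>
            (\<forall>y\<in>B' \<inter> (\<beta> \<circ> \<gamma>) -` V. fst (\<psi> y) = \<phi> ((\<beta> \<circ> \<gamma>) y))"
    by (intro exI[of _ V] exI[of _ W] exI[of _ T] exI[of _ S] exI[of _ \<phi>] exI[of _ "\<lambda>y. \<psi> (\<gamma> y)"])
      (use V in simp)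
qed

section \<open>Iterated blowups along an ordered list of centres\<close>

primrec center_order :: "'e set list \<Rightarrow> bool" where
  "center_order [] \<longleftrightarrow> True"
| "center_order (a # is) \<longleftrightarrow>
     a \<notin> set is \<and> (\<forall>i\<in>set is. a \<inter> i \<in> insert a (set is) \<longrightarrow> a \<subseteq> i) \<and> center_order is"

text \<open>\<open>center_order\<close> states for every position of the list what one blowup needs:
  the centre is new, and it is contained in each later member whose intersection with it is still
  listed.\<close>

lemma flat_arrangement_step:
  assumes "flat_arrangement T P (set (a # is)) Z X" "center_order (a # is)" "is_blowup X (Z a) B \<beta>"
  shows "flat_arrangement T P (set is) (\<lambda>i. proper_transform (Z a) B \<beta> (Z i)) B"
  by (rule flat_arrangement_blowup) (use assms in auto)

lemma iterated_blowup_Nil_cases: "iterated_blowup X [] Y b \<Longrightarrow> Y = X \<and> b = id"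
  by (erule iterated_blowup.cases) auto

lemma iterated_blowup_Cons_cases:
  assumes "iterated_blowup X (C # Zs) Y b"
  obtains B \<beta> b' where "is_blowup X C B \<beta>" "iterated_blowup B (map (proper_transform C B \<beta>) Zs) Y b'" "b = \<beta> \<circ> b'"
  using assms by (cases rule: iterated_blowup.cases) auto

lemma flat_arrangementD:
  assumes "flat_arrangement T P I Z X"
  shows "subspace T" "i \<in> I \<Longrightarrow> closedin (top_of_set X) (Z i)" "x \<in> X \<Longrightarrow> flat_at T P I Z X x"
  using assms unfolding flat_arrangement_def by simp_all

text \<open>Even after a blowup by the identity the later centres are replaced by proper transforms.
  They remain hypersurfaces because flatness carries the codimension along.\<close>

lemma iterated_blowup_hypersurfaces_id:
  assumes "flat_arrangement T P (set hs) Z X" "center_order hs" "\<And>i S. i \<in> set hs \<Longrightarrow> P i S \<Longrightarrow> dim S + 1 = dim T"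
  shows "iterated_blowup X (map Z hs) X id"
  using assms
proof (induction hs arbitrary: Z)
  case Nil
  show ?case unfolding list.map by (rule iterated_blowup.Nil)
next
  case (Cons a hs)
  note A = flat_arrangementD[OF Cons.prems(1)]
  have bl: "is_blowup X (Z a) X id"
    by (rule is_blowup_hypersurface_id[OF A(1,2) _ Cons.prems(3) A(3)]) auto
  have "iterated_blowup X (map (\<lambda>i. proper_transform (Z a) X id (Z i)) hs) X id"
    by (rule Cons.IH[OF flat_arrangement_step[OF Cons.prems(1,2) bl]]) (use Cons.prems in auto)
  then have "iterated_blowup X (map (proper_transform (Z a) X id) (map Z hs)) X id" by (simp add: comp_def)
  from iterated_blowup.Cons[OF bl this] show ?case unfolding list.map comp_id .
qed

text \<open>Flatness is carried through the blowups along \<open>as\<close>; at their end the proper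
  transforms of \<open>hs\<close> are hypersurfaces and are blown up by the identity. The induction
  needs arbitrary \<open>Z\<close>, since each step replaces it by proper transforms.\<close>

lemma iterated_blowup_append_hypersurfaces:
  assumes "flat_arrangement T P (set (as @ hs)) Z X" "center_order (as @ hs)"
    "\<And>i S. i \<in> set hs \<Longrightarrow> P i S \<Longrightarrow> dim S + 1 = dim T" "iterated_blowup X (map Z as) Y b"
  shows "iterated_blowup X (map Z (as @ hs)) Y b"
  using assms
proof (induction as arbitrary: X Z b)
  case Nil
  have e: "Y = X" "b = id"
    using iterated_blowup_Nil_cases[OF Nil.prems(4)[unfolded list.map]] by (rule conjunct1, rule conjunct2)
  have "iterated_blowup X (map Z hs) X id"
    by (rule iterated_blowup_hypersurfaces_id[where T = T and P = P]) (use Nil.prems(1-3) in simp_all)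
  then show ?case unfolding e append_Nil .
next
  case (Cons a as)
  have "iterated_blowup X (Z a # map Z as) Y b" using Cons.prems(4) by simp
  then obtain B \<beta> b' where b: "is_blowup X (Z a) B \<beta>" "iterated_blowup B (map (proper_transform (Z a) B \<beta>) (map Z as)) Y b'" "b = \<beta> \<circ> b'"
    by (rule iterated_blowup_Cons_cases)
  have step: "flat_arrangement T P (set (as @ hs)) (\<lambda>i. proper_transform (Z a) B \<beta> (Z i)) B"
    by (rule flat_arrangement_step[of T P a "as @ hs" Z X B \<beta>, OF _ _ b(1)]) (use Cons.prems(1,2) in auto)
  have "iterated_blowup B (map (\<lambda>i. proper_transform (Z a) B \<beta> (Z i)) (as @ hs)) Y b'"
    by (rule Cons.IH[OF step]) (use Cons.prems b(2) in \<open>auto simp: comp_def\<close>)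
  then have "iterated_blowup B (map (proper_transform (Z a) B \<beta>) (map Z (as @ hs))) Y b'" by (simp add: comp_def)
  from iterated_blowup.Cons[OF b(1) this] show ?case unfolding b(3) append_Cons list.map .
qed

lemma iterated_blowup_hypersurfaces_diffeo:
  assumes "flat_arrangement T P (set hs) Z X" "center_order hs"
    "\<And>i S. i \<in> set hs \<Longrightarrow> P i S \<Longrightarrow> dim S + 1 = dim T" "iterated_blowup X (map Z hs) Y b"
  shows "diffeo Y X b"
  using assms
proof (induction hs arbitrary: X Z b)
  case Nil
  have e: "Y = X" "b = id"
    using iterated_blowup_Nil_cases[OF Nil.prems(4)[unfolded list.map]] by (rule conjunct1, rule conjunct2)
  show ?case unfolding e id_def by (rule diffeo_ident)
next
  case (Cons a hs)
  note A = flat_arrangementD[OF Cons.prems(1)]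
  have "iterated_blowup X (Z a # map Z hs) Y b" using Cons.prems(4) by simp
  then obtain B \<beta> b' where b: "is_blowup X (Z a) B \<beta>" "iterated_blowup B (map (proper_transform (Z a) B \<beta>) (map Z hs)) Y b'" "b = \<beta> \<circ> b'"
    by (rule iterated_blowup_Cons_cases)
  have "diffeo B X \<beta>"
    by (rule is_blowup_hypersurface_diffeo[OF A(1) _ Cons.prems(3) A(3) b(1)]) auto
  moreover have "diffeo Y B b'"
    by (rule Cons.IH[OF flat_arrangement_step[OF Cons.prems(1,2) b(1)]]) (use Cons.prems b(2) in \<open>auto simp: comp_def\<close>)
  ultimately show ?case unfolding b(3) comp_def by (rule diffeo_compose[rotated])
qed

text \<open>The converse cannot remove the hypersurface blowups literally: they compose to some
  diffeomorphism \<open>\<gamma>\<close>, which remains as a factor of the blowdown map.\<close>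

lemma iterated_blowup_split_hypersurfaces:
  assumes "flat_arrangement T P (set (as @ hs)) Z X" "center_order (as @ hs)"
    "\<And>i S. i \<in> set hs \<Longrightarrow> P i S \<Longrightarrow> dim S + 1 = dim T" "iterated_blowup X (map Z (as @ hs)) Y b"
  shows "\<exists>Y1 \<gamma> b1. iterated_blowup X (map Z as) Y1 b1 \<and> diffeo Y Y1 \<gamma> \<and> b = b1 \<circ> \<gamma>"
  using assms
proof (induction as arbitrary: X Z b)
  case Nil
  have "diffeo Y X b"
    by (rule iterated_blowup_hypersurfaces_diffeo[where T = T and P = P]) (use Nil.prems in simp_all)
  moreover have "iterated_blowup X (map Z []) X id" unfolding list.map by (rule iterated_blowup.Nil)
  moreover have "b = id \<circ> b" by (simp only: id_comp)
  ultimately have "iterated_blowup X (map Z []) X id \<and> diffeo Y X b \<and> b = id \<circ> b" by (intro conjI)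
  then show ?case by (rule_tac exI, rule_tac exI, rule_tac exI)
next
  case (Cons a as)
  have "iterated_blowup X (Z a # map Z (as @ hs)) Y b" using Cons.prems(4) by simp
  then obtain B \<beta> b' where b: "is_blowup X (Z a) B \<beta>" "iterated_blowup B (map (proper_transform (Z a) B \<beta>) (map Z (as @ hs))) Y b'" "b = \<beta> \<circ> b'"
    by (rule iterated_blowup_Cons_cases)
  have step: "flat_arrangement T P (set (as @ hs)) (\<lambda>i. proper_transform (Z a) B \<beta> (Z i)) B"
    by (rule flat_arrangement_step[of T P a "as @ hs" Z X B \<beta>, OF _ _ b(1)]) (use Cons.prems(1,2) in auto)
  have "\<exists>Y1 \<gamma> b1. iterated_blowup B (map (\<lambda>i. proper_transform (Z a) B \<beta> (Z i)) as) Y1 b1 \<and> diffeo Y Y1 \<gamma> \<and> b' = b1 \<circ> \<gamma>"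
    by (rule Cons.IH[OF step]) (use Cons.prems b(2) in \<open>auto simp: comp_def\<close>)
  then obtain Y1 \<gamma> b1 where 1: "iterated_blowup B (map (\<lambda>i. proper_transform (Z a) B \<beta> (Z i)) as) Y1 b1" "diffeo Y Y1 \<gamma>" "b' = b1 \<circ> \<gamma>"
    by (elim exE conjE) (rule that)
  have "iterated_blowup B (map (proper_transform (Z a) B \<beta>) (map Z as)) Y1 b1" using 1(1) by (simp add: comp_def)
  from iterated_blowup.Cons[OF b(1) this] have "iterated_blowup X (map Z (a # as)) Y1 (\<beta> \<circ> b1)" by simp
  moreover have "b = (\<beta> \<circ> b1) \<circ> \<gamma>" unfolding b(3) 1(3) by (simp only: comp_assoc)
  ultimately have "iterated_blowup X (map Z (a # as)) Y1 (\<beta> \<circ> b1) \<and> diffeo Y Y1 \<gamma> \<and> b = (\<beta> \<circ> b1) \<circ> \<gamma>"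
    using 1(2) by (intro conjI)
  then show ?case by (rule_tac exI, rule_tac exI, rule_tac exI)
qed

text \<open>The last blowup of the list takes up \<open>\<gamma>\<close>. For an empty list there is
  nothing to take it up, because the space and the map are then fixed to be X and
  \<open>id\<close>.\<close>

lemma iterated_blowup_precompose:
  fixes \<gamma> :: "real^'m \<Rightarrow> real^'m"
  assumes "iterated_blowup X Zs Y1 b1" "diffeo Y Y1 \<gamma>" "Zs \<noteq> []"
  shows "iterated_blowup X Zs Y (b1 \<circ> \<gamma>)"
  using assms
proof (induction rule: iterated_blowup.induct)
  case (Nil X)
  then show ?case by simp
next
  case (Cons X Z B \<beta> Zs Y1 b)
  show ?case
  proof (cases "Zs = []")
    case True
    have e: "Y1 = B" "b = id"
      using iterated_blowup_Nil_cases[OF Cons.hyps(2)[unfolded True list.map]] by (rule conjunct1, rule conjunct2)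
    have "is_blowup X Z Y (\<beta> \<circ> \<gamma>)"
      using is_blowup_precompose[OF Cons.hyps(1)] Cons.prems(1) unfolding e .
    moreover have "iterated_blowup Y (map (proper_transform Z Y (\<beta> \<circ> \<gamma>)) []) Y id"
      unfolding list.map by (rule iterated_blowup.Nil)
    ultimately have "iterated_blowup X [Z] Y (\<beta> \<circ> \<gamma> \<circ> id)" by (rule iterated_blowup.Cons)
    then show ?thesis unfolding True e comp_id .
  next
    case False
    then have "iterated_blowup B (map (proper_transform Z B \<beta>) Zs) Y (b \<circ> \<gamma>)"
      by (intro Cons.IH Cons.prems(1)) simp
    from iterated_blowup.Cons[OF Cons.hyps(1) this] show ?thesis unfolding comp_assoc .
  qed
qed

section \<open>Tangent spaces and invariant lines of projective space\<close>

definition perm_vec :: "('n \<Rightarrow> 'n) \<Rightarrow> real^'n \<Rightarrow> real^'n" where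
  "perm_vec \<sigma> v = (\<chi> i. v $ inv_into UNIV \<sigma> i)"

text \<open>Conjugation by the permutation matrix. In contrast to the restricted map
  \<open>RP_action \<sigma>\<close>, it is linear on all matrices and hence its own
  derivative.\<close>

definition perm_mat :: "('n \<Rightarrow> 'n) \<Rightarrow> real^'n^'n \<Rightarrow> real^'n^'n" where
  "perm_mat \<sigma> A = (\<chi> i j. A $ inv_into UNIV \<sigma> i $ inv_into UNIV \<sigma> j)"

text \<open>For a unit vector \<open>v\<close>, the map \<open>sym_prod v\<close> identifies the orthogonal complement of \<open>v\<close> with the tangent
  space of projective space at \<open>[v]\<close>.\<close>

definition sym_prod :: "real^'n \<Rightarrow> real^'n \<Rightarrow> real^'n^'n" where
  "sym_prod v w = (\<chi> i j. v $ i * w $ j + w $ i * v $ j)"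

lemma perm_vec_add: "perm_vec \<sigma> (v + w) = perm_vec \<sigma> v + perm_vec \<sigma> w"
  and perm_vec_diff: "perm_vec \<sigma> (v - w) = perm_vec \<sigma> v - perm_vec \<sigma> w"
  and perm_vec_scaleR: "perm_vec \<sigma> (c *\<^sub>R v) = c *\<^sub>R perm_vec \<sigma> v"
  and perm_vec_0: "perm_vec \<sigma> 0 = 0"
  and perm_vec_1: "perm_vec \<sigma> 1 = 1"
  by (simp_all add: perm_vec_def vec_eq_iff)

lemma perm_vec_inner:
  assumes "bij \<sigma>"
  shows "perm_vec \<sigma> v \<bullet> perm_vec \<sigma> w = v \<bullet> w"
  using sum.reindex_bij_betw[OF bij_imp_bij_inv[OF assms], of "\<lambda>i. v $ i * w $ i"]
  by (simp add: perm_vec_def inner_vec_def)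

lemma perm_vec_comp: "bij \<sigma> \<Longrightarrow> bij \<tau> \<Longrightarrow> perm_vec (\<sigma> \<circ> \<tau>) v = perm_vec \<sigma> (perm_vec \<tau> v)"
  by (simp add: perm_vec_def o_inv_distrib)

lemma perm_vec_id: "perm_vec id v = v"
  by (simp add: perm_vec_def inv_id vec_eq_iff)

lemma perm_vec_inv_left:
  assumes "bij \<sigma>"
  shows "perm_vec (inv_into UNIV \<sigma>) (perm_vec \<sigma> v) = v"
proof -
  have "inv_into UNIV \<sigma> \<circ> \<sigma> = id" using assms by (simp add: bij_is_inj)
  then show ?thesis
    using perm_vec_comp[OF bij_imp_bij_inv[OF assms] assms, of v] by (simp add: perm_vec_id)
qed

lemma perm_vec_inv_right:
  assumes "bij \<sigma>"
  shows "perm_vec \<sigma> (perm_vec (inv_into UNIV \<sigma>) v) = v"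
proof -
  have "\<sigma> \<circ> inv_into UNIV \<sigma> = id" using assms by (metis bij_is_surj surj_iff)
  then show ?thesis
    using perm_vec_comp[OF assms bij_imp_bij_inv[OF assms], of v] by (simp add: perm_vec_id)
qed

lemma perm_vec_inner_left:
  assumes "bij \<sigma>"
  shows "perm_vec \<sigma> v \<bullet> w = v \<bullet> perm_vec (inv_into UNIV \<sigma>) w"
  using perm_vec_inner[OF assms, of v "perm_vec (inv_into UNIV \<sigma>) w"] by (simp add: perm_vec_inv_right[OF assms])

lemma perm_vec_eigenvalue:
  assumes "bij \<sigma>" "perm_vec \<sigma> w = c *\<^sub>R w" "w \<noteq> 0"
  shows "c * c = 1" "c = 1 \<or> c = - 1"
proof -
  have "(c *\<^sub>R w) \<bullet> (c *\<^sub>R w) = w \<bullet> w" using perm_vec_inner[OF assms(1), of w w] assms(2) by simp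
  then show "c * c = 1" using assms(3) by simp
  then show "c = 1 \<or> c = - 1" by (simp add: square_eq_1_iff)
qed

lemma perm_mat_sym_prod: "perm_mat \<sigma> (sym_prod v w) = sym_prod (perm_vec \<sigma> v) (perm_vec \<sigma> w)"
  by (simp add: perm_mat_def sym_prod_def perm_vec_def)

lemma linear_perm_mat: "linear (perm_mat \<sigma>)"
  by (rule linearI) (simp_all add: perm_mat_def vec_eq_iff)

lemma linear_sym_prod: "linear (sym_prod v)"
  by (rule linearI) (simp_all add: sym_prod_def vec_eq_iff algebra_simps)

lemma sym_prod_scaleR_left: "sym_prod (c *\<^sub>R v) w = c *\<^sub>R sym_prod v w"
  by (simp add: sym_prod_def vec_eq_iff algebra_simps)

lemma sym_prod_scaleR_right: "sym_prod v (c *\<^sub>R w) = c *\<^sub>R sym_prod v w"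
  by (rule linear_scale[OF linear_sym_prod])

lemma sym_prod_mult: "sym_prod v w *v z = (w \<bullet> z) *\<^sub>R v + (v \<bullet> z) *\<^sub>R w"
  by (simp add: vec_eq_iff matrix_vector_mult_def sym_prod_def inner_vec_def sum_distrib_left sum_distrib_right
      sum.distrib algebra_simps)

lemma sym_prod_inj:
  assumes "v \<bullet> v = 1" "w \<bullet> v = 0" "w' \<bullet> v = 0" "sym_prod v w = sym_prod v w'"
  shows "w = w'"
proof -
  have "sym_prod v w *v v = sym_prod v w' *v v" using assms(4) by simp
  then show ?thesis using assms(1-3) by (simp add: sym_prod_mult)
qed

lemma RP_action_perm_mat: "A \<in> RP \<Longrightarrow> RP_action \<sigma> A = perm_mat \<sigma> A"
  by (simp add: RP_action_def perm_mat_def)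

lemma RP_action_proj: "bij \<sigma> \<Longrightarrow> v \<noteq> 0 \<Longrightarrow> RP_action \<sigma> (proj_point v) = proj_point (perm_vec \<sigma> v)"
  by (simp add: RP_action_proj_point perm_vec_def)

lemma proj_point_in_projectivization:
  assumes "subspace V" "v \<noteq> 0"
  shows "proj_point v \<in> projectivization V \<longleftrightarrow> v \<in> V"
proof
  assume "proj_point v \<in> projectivization V"
  then obtain u where u: "u \<in> V" "u \<noteq> 0" "proj_point v = proj_point u" by (auto simp: projectivization_def)
  then obtain c where "v = c *\<^sub>R u" using proj_point_eq_iff[of u v] assms(2) by metis
  then show "v \<in> V" using u(1) assms(1) by (simp add: subspace_scale)
qed (use assms(2) in \<open>auto simp: projectivization_def\<close>)

lemma projectivization_unit:
  assumes "subspace V" "A \<in> projectivization V"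
  obtains v where "v \<in> V" "v \<bullet> v = 1" "A = proj_point v"
proof -
  obtain u where u: "u \<in> V" "u \<noteq> 0" "A = proj_point u" using assms(2) by (auto simp: projectivization_def)
  show ?thesis
  proof (rule that[of "inverse (norm u) *\<^sub>R u"])
    show "inverse (norm u) *\<^sub>R u \<in> V" by (rule subspace_scale[OF assms(1) u(1)])
    show "(inverse (norm u) *\<^sub>R u) \<bullet> (inverse (norm u) *\<^sub>R u) = 1"
      using u(2) by (simp add: dot_square_norm power2_eq_square)
    show "A = proj_point (inverse (norm u) *\<^sub>R u)" using u(2,3) by (simp add: proj_point_scaleR)
  qed
qed

lemma bounded_linear_matrix_apply: "bounded_linear (\<lambda>A::real^'n^'k. A *v z)"
  unfolding linear_conv_bounded_linear[symmetric]
  by (rule linearI) (simp_all add: matrix_vector_mult_add_rdistrib scaleR_matrix_vector_assoc)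

text \<open>Points of projective space are symmetric idempotent matrices. Differentiating both
  identities at P = v v^T shows that M is symmetric with M = P M + M P, which forces M = v w^T + w
  v^T with w = M v orthogonal to v.\<close>

lemma velocity_projectivization:
  fixes V :: "(real^'n) set"
  assumes V: "subspace V" and v: "v \<bullet> v = 1"
    and \<gamma>: "range \<gamma> \<subseteq> projectivization V" "\<gamma> 0 = proj_point v" "(\<gamma> has_vector_derivative M) (at (0::real))"
  shows "M *v v \<in> V" "(M *v v) \<bullet> v = 0" "M = sym_prod v (M *v v)"
proof -
  have v0: "v \<noteq> 0" using v by auto
  have d: "((\<lambda>t. \<gamma> t *v z) has_vector_derivative M *v z) (at 0)" for z
    by (rule bounded_linear.has_vector_derivative[OF bounded_linear_matrix_apply \<gamma>(3)])
  have g0: "\<gamma> 0 *v z = (v \<bullet> z) *\<^sub>R v" for z using \<gamma>(2) v by (simp add: proj_point_mult)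
  have \<gamma>u: "\<exists>u. u \<in> V \<and> u \<noteq> 0 \<and> \<gamma> t = proj_point u" for t
  proof -
    have "\<gamma> t \<in> projectivization V" using \<gamma>(1) by auto
    then show ?thesis by (auto simp: projectivization_def)
  qed
  have inV: "\<gamma> t *v z \<in> V" for t z
    using \<gamma>u[of t] by (auto simp: proj_point_mult intro: subspace_scale[OF V])
  have idem: "(\<gamma> t *v z) \<bullet> (\<gamma> t *v z') = (\<gamma> t *v z) \<bullet> z'" and sym: "(\<gamma> t *v z) \<bullet> z' = (\<gamma> t *v z') \<bullet> z" for t z z'
    using \<gamma>u[of t] by (auto simp: proj_point_mult)
  show wV: "M *v v \<in> V"
    by (rule derivative_in_subspace[OF d V]) (simp add: inV)
  have D1: "((\<lambda>t. (\<gamma> t *v z) \<bullet> z') has_vector_derivative (M *v z) \<bullet> z') (at 0)" for z z'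
    by (rule bounded_linear.has_vector_derivative[OF bounded_linear_inner_left d])
  have D2: "((\<lambda>t. (\<gamma> t *v z) \<bullet> (\<gamma> t *v z')) has_vector_derivative
      ((\<gamma> 0 *v z) \<bullet> (M *v z') + (M *v z) \<bullet> (\<gamma> 0 *v z'))) (at 0)" for z z'
    by (rule bounded_bilinear.has_vector_derivative[OF bounded_bilinear_inner d d])
  have e1: "(M *v z) \<bullet> z' = (M *v z') \<bullet> z" for z z'
    using vector_derivative_unique_at[OF D1[of z z', unfolded sym[of _ z z']] D1[of z' z]] .
  have e2: "(M *v z) \<bullet> z' = (\<gamma> 0 *v z) \<bullet> (M *v z') + (M *v z) \<bullet> (\<gamma> 0 *v z')" for z z'
    using vector_derivative_unique_at[OF D1[of z z'] D2[of z z', unfolded idem]] .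
  define w where "w = M *v v"
  have e3: "(M *v z) \<bullet> z' = ((w \<bullet> z) *\<^sub>R v + (v \<bullet> z) *\<^sub>R w) \<bullet> z'" for z z'
  proof -
    have a: "v \<bullet> (M *v z') = w \<bullet> z'" "(M *v z) \<bullet> v = w \<bullet> z"
      using e1[of z' v] e1[of z v] by (simp_all add: w_def inner_commute[of v "M *v z'"])
    have "(M *v z) \<bullet> z' = (v \<bullet> z) * (w \<bullet> z') + (v \<bullet> z') * (w \<bullet> z)"
      using e2[of z z'] unfolding g0 by (simp add: a)
    then show ?thesis by (simp add: inner_add_left)
  qed
  have e4: "M *v z = (w \<bullet> z) *\<^sub>R v + (v \<bullet> z) *\<^sub>R w" for z
    by (rule vector_eq_rdot[THEN iffD1], rule allI, rule e3)
  have "w = (w \<bullet> v) *\<^sub>R v + w" using e4[of v] v unfolding w_def[symmetric] by simp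
  then show "(M *v v) \<bullet> v = 0" using v0 by (simp add: w_def)
  show "M = sym_prod v (M *v v)"
    unfolding w_def[symmetric] by (rule matrix_eq[THEN iffD2], rule allI, unfold sym_prod_mult, rule e4)
qed

lemma curve_projectivization:
  fixes V :: "(real^'n) set"
  assumes V: "subspace V" and v: "v \<in> V" "v \<bullet> v = 1" and w: "w \<in> V" "w \<bullet> v = 0"
  obtains \<gamma> where "range \<gamma> \<subseteq> projectivization V" "\<gamma> 0 = proj_point v"
    "(\<gamma> has_vector_derivative sym_prod v w) (at (0::real))"
proof -
  define \<gamma> where "\<gamma> t = proj_point (v + t *\<^sub>R w)" for t
  have nz: "v + t *\<^sub>R w \<noteq> 0" for t
  proof
    assume "v + t *\<^sub>R w = 0"
    then have "(v + t *\<^sub>R w) \<bullet> v = 0" by simp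
    then show False using v w by (simp add: inner_add_left)
  qed
  have 1: "range \<gamma> \<subseteq> projectivization V"
    using V v w nz by (auto simp: \<gamma>_def projectivization_def intro!: exI[of _ "v + _ *\<^sub>R w"] subspace_add subspace_scale)
  have 2: "\<gamma> 0 = proj_point v" by (simp add: \<gamma>_def)
  have "smooth_on UNIV \<gamma>" unfolding \<gamma>_def
    by (intro smooth_on_proj_point smooth_on_add smooth_on_scaleR smooth_on_const smooth_on_ident open_UNIV nz)
  from smooth_on_has_derivative[OF this, of 0]
  have D: "(\<gamma> has_derivative frechet_derivative \<gamma> (at 0)) (at 0)" by simp
  define M where "M = frechet_derivative \<gamma> (at 0) 1"
  have lin: "linear (frechet_derivative \<gamma> (at 0))" using D by (rule has_derivative_linear)
  have "frechet_derivative \<gamma> (at 0) = (\<lambda>t. t *\<^sub>R M)"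
  proof
    fix t show "frechet_derivative \<gamma> (at 0) t = t *\<^sub>R M"
      using linear_scale[OF lin, of t 1] by (simp add: M_def)
  qed
  then have M: "(\<gamma> has_vector_derivative M) (at 0)"
    using D unfolding has_vector_derivative_def by simp
  \<comment> \<open>The velocity M need not be computed entrywise: by
    \<open>velocity_projectivization\<close> it is determined by M v, and \<gamma>(t) v has a simple
    closed form with derivative w at 0.\<close>
  have "((\<lambda>t. \<gamma> t *v v) has_vector_derivative M *v v) (at 0)"
    by (rule bounded_linear.has_vector_derivative[OF bounded_linear_matrix_apply M])
  moreover have "\<gamma> t *v v = inverse (1 + t * t * (w \<bullet> w)) *\<^sub>R (v + t *\<^sub>R w)" for t
    using v w by (simp add: \<gamma>_def proj_point_mult inner_add_left inner_add_right inner_commute[of v w] divide_inverse algebra_simps)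
  moreover have "((\<lambda>t. inverse (1 + t * t * (w \<bullet> w)) *\<^sub>R (v + t *\<^sub>R w)) has_vector_derivative w) (at 0)"
    unfolding has_vector_derivative_def
    by (auto intro!: derivative_eq_intros)
  ultimately have "M *v v = w" using vector_derivative_unique_at by fastforce
  then have "M = sym_prod v w" using velocity_projectivization(3)[OF V v(2) 1 2 M] by simp
  then show ?thesis using that[OF 1 2] M by simp
qed

lemma tangent_space_projectivization:
  fixes V :: "(real^'n) set"
  assumes V: "subspace V" and v: "v \<in> V" "v \<bullet> v = 1"
  shows "tangent_space (projectivization V) (proj_point v) = sym_prod v ` {w \<in> V. w \<bullet> v = 0}"
proof (intro equalityI subsetI)
  fix M assume "M \<in> tangent_space (projectivization V) (proj_point v)"
  then obtain \<gamma> where \<gamma>: "range \<gamma> \<subseteq> projectivization V" "\<gamma> 0 = proj_point v" "(\<gamma> has_vector_derivative M) (at (0::real))"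
    unfolding tangent_space_def by (elim CollectE exE conjE) (rule that)
  show "M \<in> sym_prod v ` {w \<in> V. w \<bullet> v = 0}"
    using velocity_projectivization[OF V v(2) \<gamma>] by (intro image_eqI[of _ _ "M *v v"]) auto
next
  fix M assume "M \<in> sym_prod v ` {w \<in> V. w \<bullet> v = 0}"
  then obtain w where w: "w \<in> V" "w \<bullet> v = 0" "M = sym_prod v w" by auto
  obtain \<gamma> where "range \<gamma> \<subseteq> projectivization V" "\<gamma> 0 = proj_point v" "(\<gamma> has_vector_derivative sym_prod v w) (at (0::real))"
    by (rule curve_projectivization[OF V v w(1,2)], rule that)
  then show "M \<in> tangent_space (projectivization V) (proj_point v)"
    unfolding tangent_space_def w(3) by (intro CollectI exI[of _ \<gamma>] conjI)
qed

lemma subspace_orth: "subspace V \<Longrightarrow> subspace {w \<in> V. w \<bullet> v = 0}"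
  unfolding subspace_def by (simp add: inner_add_left)

lemma dim_orthogonal_to_vector:
  fixes V :: "(real^'n) set"
  assumes V: "subspace V" and v: "v \<in> V" "v \<bullet> v = 1"
  shows "dim {w \<in> V. w \<bullet> v = 0} + 1 = dim V"
proof -
  have v0: "v \<noteq> 0" using v by auto
  have s: "span {v} \<subseteq> V" using v(1) V by (intro span_minimal) auto
  have "dim {y \<in> V. \<forall>x\<in>span {v}. orthogonal x y} + dim (span {v}) = dim V"
    by (rule dim_subspace_orthogonal_to_vectors[OF subspace_span V s])
  moreover have "{y \<in> V. \<forall>x\<in>span {v}. orthogonal x y} = {w \<in> V. w \<bullet> v = 0}"
    by (auto simp: span_singleton orthogonal_def inner_commute)
  ultimately show ?thesis using v0 by simp
qed

lemma dim_tangent_space_projectivization: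
  fixes V :: "(real^'n) set"
  assumes V: "subspace V" and v: "v \<in> V" "v \<bullet> v = 1"
  shows "dim (tangent_space (projectivization V) (proj_point v)) = dim V - 1"
proof -
  let ?W = "{w \<in> V. w \<bullet> v = 0}"
  have "dim (sym_prod v ` ?W) = dim ?W"
  proof (rule dim_image_eq[OF linear_sym_prod])
    have sp: "span ?W = ?W" using subspace_orth[OF V] by (simp add: span_eq_iff)
    show "inj_on (sym_prod v) (span ?W)"
      unfolding sp by (rule inj_onI) (use sym_prod_inj[OF v(2)] in simp)
  qed
  moreover have "dim ?W = dim V - 1" using dim_orthogonal_to_vector[OF V v] by simp
  ultimately show ?thesis using tangent_space_projectivization[OF V v] by simp
qed

lemma mdim_projectivization:
  fixes V :: "(real^'n) set"
  assumes V: "subspace V" "V \<noteq> {0}"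
  shows "mdim (projectivization V) = dim V - 1"
proof -
  obtain v where "v \<in> V" "v \<noteq> 0" using V subspace_0 by blast
  then have "projectivization V \<noteq> {}" by (auto simp: projectivization_def)
  moreover have "dim (tangent_space (projectivization V) x) = dim V - 1" if "x \<in> projectivization V" for x
    using projectivization_unit[OF V(1) that] dim_tangent_space_projectivization[OF V(1)] by metis
  ultimately show ?thesis unfolding mdim_def by simp
qed

text \<open>On projective space the action agrees with a linear map, so velocities of all curves are
  transported by it. One curve with the given velocity must be exhibited for the uniqueness in the
  definite description.\<close>

lemma tangent_map_RP_action:
  fixes v :: "real^'n"
  assumes v: "v \<bullet> v = 1" and w: "w \<bullet> v = 0"
  shows "tangent_map RP (RP_action \<sigma>) (proj_point v) (sym_prod v w) = perm_mat \<sigma> (sym_prod v w)"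
proof -
  have P: "((RP_action \<sigma> \<circ> \<gamma>) has_vector_derivative perm_mat \<sigma> M) (at 0)"
    if "range \<gamma> \<subseteq> RP" "(\<gamma> has_vector_derivative M) (at 0)" for \<gamma> :: "real \<Rightarrow> real^'n^'n" and M
  proof -
    have "bounded_linear (perm_mat \<sigma> :: real^'n^'n \<Rightarrow> _)" using linear_perm_mat by (simp add: linear_conv_bounded_linear)
    from bounded_linear.has_vector_derivative[OF this that(2)]
    have "((\<lambda>t. perm_mat \<sigma> (\<gamma> t)) has_vector_derivative perm_mat \<sigma> M) (at 0)" .
    moreover have "RP_action \<sigma> \<circ> \<gamma> = (\<lambda>t. perm_mat \<sigma> (\<gamma> t))"
    proof
      fix t have "\<gamma> t \<in> RP" using that(1) by auto
      then show "(RP_action \<sigma> \<circ> \<gamma>) t = perm_mat \<sigma> (\<gamma> t)" unfolding comp_apply by (rule RP_action_perm_mat)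
    qed
    ultimately show ?thesis by metis
  qed
  obtain \<gamma> where \<gamma>: "range \<gamma> \<subseteq> RP" "\<gamma> 0 = proj_point v" "(\<gamma> has_vector_derivative sym_prod v w) (at (0::real))"
    by (rule curve_projectivization[OF subspace_UNIV UNIV_I v UNIV_I w], rule that)
  show ?thesis unfolding tangent_map_def
  proof (rule the_equality)
    show "\<forall>\<gamma>. range \<gamma> \<subseteq> RP \<and> \<gamma> 0 = proj_point v \<and> (\<gamma> has_vector_derivative sym_prod v w) (at (0::real)) \<longrightarrow>
         ((RP_action \<sigma> \<circ> \<gamma>) has_vector_derivative perm_mat \<sigma> (sym_prod v w)) (at 0)"
      using P by blast
    fix M assume "\<forall>\<gamma>. range \<gamma> \<subseteq> RP \<and> \<gamma> 0 = proj_point v \<and> (\<gamma> has_vector_derivative sym_prod v w) (at (0::real)) \<longrightarrow>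
         ((RP_action \<sigma> \<circ> \<gamma>) has_vector_derivative M) (at 0)"
    then have "((RP_action \<sigma> \<circ> \<gamma>) has_vector_derivative M) (at 0)" using \<gamma> by blast
    then show "M = perm_mat \<sigma> (sym_prod v w)"
      using P[OF \<gamma>(1,3)] by (rule vector_derivative_unique_at)
  qed
qed

section \<open>Joint eigenvectors, the space L and the subgroup F\<close>

definition joint_eigenvectors :: "('n \<Rightarrow> 'n) set \<Rightarrow> (real^'n) set" where
  "joint_eigenvectors H = {w. \<forall>h\<in>H. \<exists>c. perm_vec h w = c *\<^sub>R w}"

definition fixed_space :: "('n \<Rightarrow> 'n) set \<Rightarrow> (real^'n) set" where
  "fixed_space F = {w. \<forall>g\<in>F. perm_vec g w = w}"

lemma subspace_fixed_space: "subspace (fixed_space F)"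
  unfolding subspace_def fixed_space_def by (simp add: perm_vec_0 perm_vec_add perm_vec_scaleR)

lemma carrier_Sym: "carrier Sym = {\<sigma> :: 'n \<Rightarrow> 'n. bij \<sigma>}"
  by (auto simp: BijGroup_def Bij_def)

lemma stabilizer_Sym:
  fixes v :: "real^'n"
  assumes "v \<bullet> v = 1" "h \<in> stabilizer Sym RP_action (proj_point v)"
  obtains \<epsilon> where "bij h" "perm_vec h v = \<epsilon> *\<^sub>R v" "\<epsilon> * \<epsilon> = 1"
proof -
  have h: "bij h" "RP_action h (proj_point v) = proj_point v"
    using assms(2) by (auto simp: stabilizer_def carrier_Sym)
  have v0: "v \<noteq> 0" using assms(1) by auto
  then have p0: "perm_vec h v \<noteq> 0" using perm_vec_inner[OF h(1), of v v] by auto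
  have "proj_point v = proj_point (perm_vec h v)" using h RP_action_proj[OF h(1) v0] by simp
  then obtain c where "perm_vec h v = c *\<^sub>R v" using proj_point_eq_iff[OF v0 p0] by auto
  then show ?thesis using that[OF h(1)] perm_vec_eigenvalue(1)[OF h(1) _ v0] by metis
qed

text \<open>If h v = \<epsilon> v, the differential of h at [v] is w \<mapsto> \<epsilon> h w under
  the identification \<open>sym_prod v\<close>. The twist by the sign \<epsilon> does not affect
  which lines are invariant, so they come from the joint eigenvectors orthogonal to v.\<close>

lemma L_space_RP:
  fixes v :: "real^'n"
  assumes v: "v \<bullet> v = 1" and H: "H \<subseteq> stabilizer Sym RP_action (proj_point v)"
  shows "L_space RP_action RP (proj_point v) H = span (sym_prod v ` {w \<in> joint_eigenvectors H. w \<bullet> v = 0})"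
  unfolding L_space_def
proof (rule subset_antisym)
  let ?x = "proj_point v" and ?E = "{w \<in> joint_eigenvectors H. w \<bullet> v = 0}"
  have T: "tangent_space RP ?x = sym_prod v ` {w. w \<bullet> v = 0}"
    using tangent_space_projectivization[OF subspace_UNIV UNIV_I v] by simp
  have tm: "tangent_map RP (RP_action h) ?x (sym_prod v w) = sym_prod v (\<epsilon> *\<^sub>R perm_vec h w)"
    if "perm_vec h v = \<epsilon> *\<^sub>R v" "w \<bullet> v = 0" for h w \<epsilon>
    using tangent_map_RP_action[OF v that(2), of h] that(1)
    by (simp add: perm_mat_sym_prod sym_prod_scaleR_left sym_prod_scaleR_right)
  have po: "perm_vec h w \<bullet> v = 0" if "bij h" "perm_vec h v = \<epsilon> *\<^sub>R v" "\<epsilon> * \<epsilon> = 1" "w \<bullet> v = 0" for h w \<epsilon>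
  proof -
    have "perm_vec h w \<bullet> (\<epsilon> *\<^sub>R v) = 0" using perm_vec_inner[OF that(1), of w v] that by simp
    then show ?thesis using that(3) by auto
  qed
  show "span (\<Union>(invariant_lines RP_action RP ?x H)) \<subseteq> span (sym_prod v ` ?E)"
  proof (rule span_mono, rule subsetI)
    fix M assume "M \<in> \<Union>(invariant_lines RP_action RP ?x H)"
    then obtain l where l: "M \<in> l" "subspace l" "dim l = 1" "l \<subseteq> tangent_space RP ?x"
      "\<And>h. h \<in> H \<Longrightarrow> tangent_map RP (RP_action h) ?x ` l = l"
      unfolding invariant_lines_def by auto
    obtain w where w: "M = sym_prod v w" "w \<bullet> v = 0" using l(1,4) T by auto
    have "\<exists>c. perm_vec h w = c *\<^sub>R w" if h: "h \<in> H" for h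
    proof (cases "w = 0")
      case True then show ?thesis by (simp add: perm_vec_0)
    next
      case False
      have "h \<in> stabilizer Sym RP_action ?x" using h H by auto
      then obtain \<epsilon> where \<epsilon>: "bij h" "perm_vec h v = \<epsilon> *\<^sub>R v" "\<epsilon> * \<epsilon> = 1"
        by (rule stabilizer_Sym[OF v])
      have "M \<noteq> 0"
      proof
        assume "M = 0"
        then have "sym_prod v w = sym_prod v 0" using w(1) linear_0[OF linear_sym_prod] by metis
        then show False using sym_prod_inj[OF v w(2)] False by simp
      qed
      \<comment> \<open>The line is one-dimensional and M is a non-zero element, so M spans it and
        invariance becomes an eigenvector equation.\<close>
      then have "{M} \<subseteq> l \<and> independent {M} \<and> card {M} = dim l" using l(1,3) by simp
      then have "l \<subseteq> span {M}" using card_ge_dim_independent[of "{M}" l] by simp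
      moreover have "sym_prod v (\<epsilon> *\<^sub>R perm_vec h w) \<in> l"
        using imageI[OF l(1), of "tangent_map RP (RP_action h) ?x"] unfolding l(5)[OF h] w(1) tm[OF \<epsilon>(2) w(2)] .
      ultimately obtain c where "sym_prod v (\<epsilon> *\<^sub>R perm_vec h w) = c *\<^sub>R M" by (auto simp: span_singleton)
      then have "sym_prod v (\<epsilon> *\<^sub>R perm_vec h w) = sym_prod v (c *\<^sub>R w)" by (simp add: w(1) sym_prod_scaleR_right)
      then have "\<epsilon> *\<^sub>R perm_vec h w = c *\<^sub>R w"
        by (rule sym_prod_inj[OF v, rotated 2]) (use po[OF \<epsilon> w(2)] w(2) in simp_all)
      then have "\<epsilon> *\<^sub>R \<epsilon> *\<^sub>R perm_vec h w = (\<epsilon> * c) *\<^sub>R w" by simp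
      then show ?thesis using \<epsilon>(3) by auto
    qed
    then show "M \<in> sym_prod v ` ?E" using w by (auto simp: joint_eigenvectors_def)
  qed
  show "span (sym_prod v ` ?E) \<subseteq> span (\<Union>(invariant_lines RP_action RP ?x H))"
  proof (rule span_minimal[OF _ subspace_span], rule subsetI)
    fix M assume "M \<in> sym_prod v ` ?E"
    then obtain w where w: "M = sym_prod v w" "w \<in> joint_eigenvectors H" "w \<bullet> v = 0" by auto
    show "M \<in> span (\<Union>(invariant_lines RP_action RP ?x H))"
    proof (cases "M = 0")
      case True then show ?thesis by (simp add: span_zero)
    next
      case False
      have w0: "w \<noteq> 0" using False w(1) linear_0[OF linear_sym_prod] by auto
      have lM: "x \<in> span {M} \<longleftrightarrow> (\<exists>c. x = sym_prod v (c *\<^sub>R w))" for x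
        by (auto simp: span_singleton w(1) sym_prod_scaleR_right)
      have "tangent_map RP (RP_action h) ?x ` span {M} = span {M}" if h: "h \<in> H" for h
      proof -
        have "h \<in> stabilizer Sym RP_action ?x" using h H by auto
        then obtain \<epsilon> where \<epsilon>: "bij h" "perm_vec h v = \<epsilon> *\<^sub>R v" "\<epsilon> * \<epsilon> = 1"
          by (rule stabilizer_Sym[OF v])
        obtain k where k: "perm_vec h w = k *\<^sub>R w" using w(2) h by (auto simp: joint_eigenvectors_def)
        have kk: "k * k = 1" by (rule perm_vec_eigenvalue(1)[OF \<epsilon>(1) k w0])
        have t: "tangent_map RP (RP_action h) ?x (sym_prod v (c *\<^sub>R w)) = sym_prod v ((\<epsilon> * k * c) *\<^sub>R w)" for c
          using tm[OF \<epsilon>(2), of "c *\<^sub>R w"] w(3) k by (simp add: perm_vec_scaleR mult_ac)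
        have "x \<in> tangent_map RP (RP_action h) ?x ` span {M}" if xM: "x \<in> span {M}" for x
        proof -
          obtain c where c: "x = sym_prod v (c *\<^sub>R w)" using iffD1[OF lM xM] by auto
          have "\<epsilon> * k * (\<epsilon> * k * c) = (\<epsilon> * \<epsilon>) * (k * k) * c" by (simp only: mult_ac)
          then have e: "\<epsilon> * k * (\<epsilon> * k * c) = c" using \<epsilon>(3) kk by simp
          have "x = tangent_map RP (RP_action h) ?x (sym_prod v ((\<epsilon> * k * c) *\<^sub>R w))"
            unfolding t e by (rule c)
          moreover have "sym_prod v ((\<epsilon> * k * c) *\<^sub>R w) \<in> span {M}" using lM by blast
          ultimately show ?thesis by blast
        qed
        moreover have "tangent_map RP (RP_action h) ?x x \<in> span {M}" if "x \<in> span {M}" for x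
          using that t lM by metis
        ultimately show ?thesis by auto
      qed
      moreover have "span {M} \<subseteq> tangent_space RP ?x" using lM T w(3) by auto
      moreover have "dim (span {M}) = 1" using False by simp
      ultimately have "span {M} \<in> invariant_lines RP_action RP ?x H"
        unfolding invariant_lines_def using subspace_span by blast
      then show ?thesis using span_base[of M "{M}"] by (intro span_base) auto
    qed
  qed
qed

text \<open>The all-ones vector is fixed by every permutation; comparing it with \<open>v\<close> rules out that an
  element of \<open>F\<close> acts by \<open>-1\<close> on \<open>v\<close>.\<close>

lemma F_subgroup_RP:
  fixes v :: "real^'n"
  assumes v: "v \<bullet> v = 1" and H: "H \<subseteq> stabilizer Sym RP_action (proj_point v)"
  shows "F_subgroup RP_action RP (proj_point v) H = {h \<in> H. \<forall>w\<in>joint_eigenvectors H. perm_vec h w = w}"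
proof -
  let ?x = "proj_point v" and ?E = "{w \<in> joint_eigenvectors H. w \<bullet> v = 0}"
  have v0: "v \<noteq> 0" using v by auto
  have st: "\<exists>\<epsilon>. perm_vec h v = \<epsilon> *\<^sub>R v \<and> \<epsilon> * \<epsilon> = 1" "bij h" if h: "h \<in> H" for h
    using stabilizer_Sym[OF v, of h] h H by blast+
  have vE: "v \<in> joint_eigenvectors H" using st by (auto simp: joint_eigenvectors_def)
  have oE: "1 \<in> joint_eigenvectors H" by (auto simp: joint_eigenvectors_def perm_vec_1 intro: exI[of _ 1])
  have Fiff: "(\<forall>M\<in>L_space RP_action RP ?x H. tangent_map RP (RP_action h) ?x M = M) \<longleftrightarrow>
      (\<forall>w\<in>joint_eigenvectors H. perm_vec h w = w)" if h: "h \<in> H" for h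
  proof -
    obtain \<epsilon> where \<epsilon>: "perm_vec h v = \<epsilon> *\<^sub>R v" "\<epsilon> * \<epsilon> = 1" using st(1)[OF h] by auto
    note bh = st(2)[OF h]
    have tm: "tangent_map RP (RP_action h) ?x (sym_prod v w) = sym_prod v (\<epsilon> *\<^sub>R perm_vec h w)"
      if "w \<bullet> v = 0" for w
      using tangent_map_RP_action[OF v that, of h] \<epsilon>(1)
      by (simp add: perm_mat_sym_prod sym_prod_scaleR_left sym_prod_scaleR_right)
    have po: "perm_vec h w \<bullet> v = 0" if "w \<bullet> v = 0" for w
    proof -
      have "perm_vec h w \<bullet> (\<epsilon> *\<^sub>R v) = 0" using perm_vec_inner[OF bh, of w v] that \<epsilon> by simp
      then show ?thesis using \<epsilon>(2) by auto
    qed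
    have 1: "(\<forall>M\<in>L_space RP_action RP ?x H. tangent_map RP (RP_action h) ?x M = M) \<longleftrightarrow>
      (\<forall>w\<in>?E. \<epsilon> *\<^sub>R perm_vec h w = w)" (is "?l \<longleftrightarrow> ?r")
    proof
      assume l: ?l
      show ?r
      proof
        fix w assume w: "w \<in> ?E"
        then have "sym_prod v w \<in> L_space RP_action RP ?x H"
          unfolding L_space_RP[OF v H] by (intro span_base imageI)
        then have "sym_prod v (\<epsilon> *\<^sub>R perm_vec h w) = sym_prod v w" using l tm[of w] w by simp
        then show "\<epsilon> *\<^sub>R perm_vec h w = w"
          by (rule sym_prod_inj[OF v, rotated 2]) (use po[of w] w in simp_all)
      qed
    next
      assume r: ?r
      \<comment> \<open>The fixed vectors are taken inside the tangent space, because
        \<open>tangent_map\<close> is only known to agree with \<open>perm_mat\<close>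
        there.\<close>
      have sub: "L_space RP_action RP ?x H \<subseteq> {M \<in> sym_prod v ` {w. w \<bullet> v = 0}. perm_mat h M = M}"
        unfolding L_space_RP[OF v H]
      proof (rule span_minimal)
        show "sym_prod v ` ?E \<subseteq> {M \<in> sym_prod v ` {w. w \<bullet> v = 0}. perm_mat h M = M}"
          using r \<epsilon>(1) by (auto simp: perm_mat_sym_prod sym_prod_scaleR_left sym_prod_scaleR_right[symmetric])
        have s1: "subspace (sym_prod v ` {w. w \<bullet> v = 0})"
          using linear_subspace_image[OF linear_sym_prod subspace_orth[OF subspace_UNIV, of v]] by simp
        have "subspace {M :: real^'n^'n. perm_mat h M = M}"
          unfolding subspace_def
          by (simp add: linear_0[OF linear_perm_mat] linear_add[OF linear_perm_mat] linear_scale[OF linear_perm_mat])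
        from subspace_inter[OF s1 this]
        show "subspace {M \<in> sym_prod v ` {w. w \<bullet> v = 0}. perm_mat h M = M}" by (simp add: Int_def)
      qed
      show ?l
      proof
        fix M assume "M \<in> L_space RP_action RP ?x H"
        then obtain w where "M = sym_prod v w" "w \<bullet> v = 0" "perm_mat h M = M" using sub by auto
        then show "tangent_map RP (RP_action h) ?x M = M" using tangent_map_RP_action[OF v, of w h] by simp
      qed
    qed
    have 2: "(\<forall>w\<in>?E. \<epsilon> *\<^sub>R perm_vec h w = w) \<longleftrightarrow> (\<forall>w\<in>joint_eigenvectors H. perm_vec h w = w)" (is "?l \<longleftrightarrow> ?r")
    proof
      assume r: ?r
      then have "\<epsilon> *\<^sub>R v = v" using vE \<epsilon>(1) by metis
      then have "\<epsilon> = 1" using v0 by (metis scaleR_one scaleR_right_imp_eq)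
      then show ?l using r by simp
    next
      assume l: ?l
      have \<epsilon>1: "\<epsilon> = 1"
      proof (cases "1 \<bullet> v = 0")
        case True
        then have "\<epsilon> *\<^sub>R perm_vec h 1 = 1" using l oE by simp
        then have "\<epsilon> *\<^sub>R (1 :: real^'n) = 1" by (simp add: perm_vec_1)
        then show ?thesis by (simp add: vec_eq_iff)
      next
        case False
        have "1 \<bullet> v = \<epsilon> * (1 \<bullet> v)" using perm_vec_inner[OF bh, of 1 v] \<epsilon>(1) by (simp add: perm_vec_1)
        then show ?thesis using False by simp
      qed
      show ?r
      proof
        fix w assume w: "w \<in> joint_eigenvectors H"
        \<comment> \<open>Removing the v-component keeps w a joint eigenvector: if w . v is
          non-zero, orthogonality of g forces its eigenvalues on w and v to agree, and otherwise
          nothing is removed.\<close>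
        define w' where "w' = w - (w \<bullet> v) *\<^sub>R v"
        have w'v: "w' \<bullet> v = 0" using v by (simp add: w'_def inner_diff_left)
        have "\<exists>c. perm_vec g w' = c *\<^sub>R w'" if g: "g \<in> H" for g
        proof -
          obtain c where c: "perm_vec g w = c *\<^sub>R w" using w g by (auto simp: joint_eigenvectors_def)
          obtain \<delta> where \<delta>: "perm_vec g v = \<delta> *\<^sub>R v" "\<delta> * \<delta> = 1" using st(1)[OF g] by auto
          have "w \<bullet> v = perm_vec g w \<bullet> perm_vec g v" by (rule perm_vec_inner[OF st(2)[OF g], symmetric])
          also have "\<dots> = c * \<delta> * (w \<bullet> v)" by (simp add: c \<delta>(1))
          finally have "\<delta> * (w \<bullet> v) = c * (\<delta> * \<delta>) * (w \<bullet> v)" by (simp add: mult_ac)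
          then have "\<delta> * (w \<bullet> v) = c * (w \<bullet> v)" using \<delta>(2) by simp
          then have "perm_vec g w' = c *\<^sub>R w'"
            by (simp add: w'_def perm_vec_diff perm_vec_scaleR c \<delta>(1) scaleR_diff_right mult.commute)
          then show ?thesis by blast
        qed
        then have "w' \<in> ?E" using w'v by (auto simp: joint_eigenvectors_def)
        then have "perm_vec h w' = w'" using l \<epsilon>1 by simp
        then show "perm_vec h w = w" using \<epsilon>(1) \<epsilon>1 by (simp add: w'_def perm_vec_diff perm_vec_scaleR)
      qed
    qed
    show ?thesis using 1 2 by (rule trans)
  qed
  show ?thesis unfolding F_subgroup_def using Fiff by auto
qed

section \<open>The strata are braid spaces\<close>

lemma perm_vec_eq_iff:
  assumes "bij g"
  shows "perm_vec g w = w \<longleftrightarrow> (\<forall>m. w $ g m = w $ m)"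
proof
  assume f: "perm_vec g w = w"
  show "\<forall>m. w $ g m = w $ m"
  proof
    fix m
    have "w $ g m = perm_vec g w $ g m" using f by simp
    also have "\<dots> = w $ m" using assms by (simp add: perm_vec_def bij_is_inj)
    finally show "w $ g m = w $ m" .
  qed
next
  assume m: "\<forall>m. w $ g m = w $ m"
  have "w $ inv_into UNIV g i = w $ i" for i
    using m[rule_format, of "inv_into UNIV g i"] assms by (simp add: bij_is_surj surj_f_inv_f)
  then show "perm_vec g w = w" by (simp add: perm_vec_def vec_eq_iff)
qed

text \<open>A line fixed by F may consist of vectors that some g negates. The eigenvalue of g
  depends continuously on the line and takes only the values 1 and -1, so it stays 1 on the
  component of [v]. Conversely, lines of fixed vectors are joined to [v] by segments.\<close>

lemma connected_component_fixed_points: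
  fixes v :: "real^'n"
  assumes F: "\<And>g. g \<in> F \<Longrightarrow> bij g" and v: "v \<noteq> 0" "v \<in> fixed_space F"
  shows "connected_component_set {y \<in> RP. \<forall>g\<in>F. RP_action g y = y} (proj_point v) = projectivization (fixed_space F)"
    (is "connected_component_set ?Y _ = ?P")
proof (intro equalityI subsetI)
  have fixY: "\<exists>c. perm_vec g u = c *\<^sub>R u \<and> c * c = 1" if u: "u \<noteq> 0" "proj_point u \<in> ?Y" "g \<in> F" for u g
  proof -
    have g: "bij g" using F u(3) .
    have p0: "perm_vec g u \<noteq> 0" using perm_vec_inner[OF g, of u u] u(1) by auto
    have "proj_point u = proj_point (perm_vec g u)" using u RP_action_proj[OF g u(1)] by auto
    then obtain c where "perm_vec g u = c *\<^sub>R u" using proj_point_eq_iff[OF u(1) p0] by auto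
    then show ?thesis using perm_vec_eigenvalue(1)[OF g _ u(1)] by blast
  qed
  fix y assume "y \<in> connected_component_set ?Y (proj_point v)"
  then obtain C where C: "connected C" "C \<subseteq> ?Y" "proj_point v \<in> C" "y \<in> C"
    unfolding connected_component_def mem_Collect_eq by (elim exE conjE) (rule that)
  have "y \<in> RP" using C(2,4) by auto
  then obtain u where u: "u \<bullet> u = 1" "y = proj_point u" by (rule projectivization_unit[OF subspace_UNIV])
  have u0: "u \<noteq> 0" using u by auto
  have "perm_vec g u = u" if g: "g \<in> F" for g
  proof -
    \<comment> \<open>The trace of A times the permutation matrix of g. On the projection to an
      eigenline it returns the eigenvalue, and it is visibly continuous in A.\<close>
    define f where "f A = (\<Sum>i\<in>UNIV. A $ i $ inv_into UNIV g i)" for A :: "real^'n^'n"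
    have fc: "f (proj_point a) = c" if "a \<noteq> 0" "perm_vec g a = c *\<^sub>R a" for a c
    proof -
      have "f (proj_point a) = (\<Sum>i\<in>UNIV. a $ i * perm_vec g a $ i) / (a \<bullet> a)"
        by (simp add: f_def proj_point_def perm_vec_def sum_divide_distrib)
      also have "\<dots> = (a \<bullet> perm_vec g a) / (a \<bullet> a)" by (simp add: inner_vec_def)
      also have "\<dots> = c" using that by simp
      finally show ?thesis .
    qed
    have cont: "continuous_on C f" unfolding f_def by (intro continuous_intros)
    have "connected (f ` C)" by (rule connected_continuous_image[OF cont C(1)])
    then have ivl: "is_interval (f ` C)" by (simp add: is_interval_connected_1)
    have "perm_vec g v = 1 *\<^sub>R v" using v(2) g by (simp add: fixed_space_def)
    from fc[OF v(1) this] have one: "1 \<in> f ` C" using C(3) by force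
    obtain c where c: "perm_vec g u = c *\<^sub>R u" "c * c = 1" using fixY[OF u0 _ g] C(2,4) u(2) by blast
    from fc[OF u0 c(1)] have cin: "c \<in> f ` C" using C(4) u(2) by force
    \<comment> \<open>Otherwise f would also take the value 0 on the connected set C, although its
      values there are eigenvalues of square 1.\<close>
    have "c \<noteq> -1"
    proof
      assume "c = -1"
      then have "0 \<in> f ` C" using ivl one cin unfolding is_interval_1 by (metis neg_le_0_iff_le zero_le_one)
      then obtain A where A: "A \<in> C" "f A = 0" by auto
      have "A \<in> RP" using C(2) A(1) by auto
      then obtain a where a: "a \<bullet> a = 1" "A = proj_point a" by (rule projectivization_unit[OF subspace_UNIV])
      have a0: "a \<noteq> 0" using a by auto
      obtain d where d: "perm_vec g a = d *\<^sub>R a" "d * d = 1" using fixY[OF a0 _ g] C(2) A(1) a(2) by blast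
      show False using fc[OF a0 d(1)] A(2) a(2) d(2) by simp
    qed
    then have "c = 1" using c(2) by (auto simp: square_eq_1_iff)
    then show ?thesis using c(1) by simp
  qed
  then have "u \<in> fixed_space F" by (simp add: fixed_space_def)
  then show "y \<in> ?P" using u0 u(2) by (auto simp: projectivization_def)
next
  fix y assume "y \<in> ?P"
  then obtain u' where u': "u' \<in> fixed_space F" "u' \<noteq> 0" "y = proj_point u'" by (auto simp: projectivization_def)
  \<comment> \<open>The sign is chosen so that u and v do not form an obtuse angle; then the segment
    between them avoids the origin.\<close>
  define u where "u = (if u' \<bullet> v \<ge> 0 then 1 else -1) *\<^sub>R u'"
  have u: "u \<in> fixed_space F" "u \<noteq> 0" "y = proj_point u" "u \<bullet> v \<ge> 0"
    using u' by (auto simp: u_def subspace_neg[OF subspace_fixed_space] proj_point_scaleR[of "-1", simplified])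
  define C where "C = proj_point ` closed_segment v u"
  have nz: "a \<noteq> 0" if a: "a \<in> closed_segment v u" for a
  proof
    assume "a = 0"
    obtain t where t: "0 \<le> t" "t \<le> 1" "a = (1 - t) *\<^sub>R v + t *\<^sub>R u" using a unfolding closed_segment_def by auto
    have "0 = (1 - t) * (v \<bullet> v) + t * (u \<bullet> v)" using arg_cong[OF t(3), of "\<lambda>z. z \<bullet> v"] \<open>a = 0\<close> by (simp add: inner_add_left)
    moreover have "0 \<le> (1 - t) * (v \<bullet> v)" "0 \<le> t * (u \<bullet> v)" using t u(4) by simp_all
    ultimately have "(1 - t) * (v \<bullet> v) = 0" by linarith
    then have "t = 1" using v(1) by simp
    then show False using t(3) \<open>a = 0\<close> u(2) by simp
  qed
  have inF: "a \<in> fixed_space F" if "a \<in> closed_segment v u" for a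
    using that v(2) u(1) unfolding closed_segment_def
    by (auto intro!: subspace_add subspace_scale subspace_fixed_space)
  have "smooth_on (- {0 :: real^'n}) proj_point"
    by (rule smooth_on_proj_point[OF smooth_on_ident]) auto
  then have "continuous_on (closed_segment v u) (proj_point :: real^'n \<Rightarrow> _)"
    by (rule continuous_on_subset[OF smooth_on_imp_continuous]) (use nz in blast)
  then have "connected C" unfolding C_def by (rule connected_continuous_image) simp
  moreover have "C \<subseteq> ?Y"
  proof
    fix z assume "z \<in> C"
    then obtain a where a: "a \<in> closed_segment v u" "z = proj_point a" by (auto simp: C_def)
    have "RP_action g z = z" if "g \<in> F" for g
      using RP_action_proj[OF F[OF that] nz[OF a(1)]] inF[OF a(1)] that a(2) by (simp add: fixed_space_def)
    moreover have "z \<in> RP" using nz[OF a(1)] a(2) by (auto simp: projectivization_def)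
    ultimately show "z \<in> ?Y" by simp
  qed
  moreover have "proj_point v \<in> C" "y \<in> C" using u(3) by (auto simp: C_def)
  ultimately show "y \<in> connected_component_set ?Y (proj_point v)"
    unfolding connected_component_def mem_Collect_eq by (intro exI[of _ C] conjI)
qed

text \<open>The subgroup F written without a base point: by \<open>F_subgroup_RP\<close> the point
  enters only through the condition that H stabilises it.\<close>

definition stratum_group :: "('n::finite \<Rightarrow> 'n) set \<Rightarrow> ('n \<Rightarrow> 'n) set" where
  "stratum_group H = {h \<in> H. \<forall>w\<in>joint_eigenvectors H. perm_vec h w = w}"

lemma L_stratum_RP:
  fixes v :: "real^'n"
  assumes v: "v \<bullet> v = 1" and H: "H \<subseteq> stabilizer Sym RP_action (proj_point v)"
  shows "L_stratum RP_action RP (proj_point v) H = projectivization (fixed_space (stratum_group H))"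
proof -
  have st: "\<exists>\<epsilon>. perm_vec h v = \<epsilon> *\<^sub>R v" "bij h" if h: "h \<in> H" for h
    using stabilizer_Sym[OF v, of h] h H by blast+
  have "v \<in> joint_eigenvectors H" using st by (auto simp: joint_eigenvectors_def)
  then have "v \<in> fixed_space (stratum_group H)" by (auto simp: fixed_space_def stratum_group_def)
  moreover have "v \<noteq> 0" using v by auto
  moreover have "bij g" if "g \<in> stratum_group H" for g using that st(2) by (auto simp: stratum_group_def)
  ultimately show ?thesis
    unfolding L_stratum_def F_subgroup_RP[OF v H] stratum_group_def[symmetric]
    by (intro connected_component_fixed_points)
qed

lemma subgroup_SymD:
  assumes "subgroup H (Sym :: ('n::finite \<Rightarrow> 'n) monoid)"
  shows "h \<in> H \<Longrightarrow> bij h" "h \<in> H \<Longrightarrow> g \<in> H \<Longrightarrow> h \<circ> g \<in> H" "h \<in> H \<Longrightarrow> inv_into UNIV h \<in> H"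
proof -
  show b: "bij h" if "h \<in> H" for h using subgroup.subset[OF assms] that carrier_Sym by auto
  show "h \<circ> g \<in> H" if "h \<in> H" "g \<in> H"
    using subgroup.m_closed[OF assms that] b[OF that(1)] b[OF that(2)]
    by (simp add: BijGroup_def Bij_def compose_def comp_def restrict_def)
  show "inv_into UNIV h \<in> H" if "h \<in> H"
  proof -
    have "h \<in> Bij UNIV" using b[OF that] by (simp add: Bij_def)
    then show ?thesis using subgroup.m_inv_closed[OF assms that] by (simp add: inv_BijGroup restrict_def)
  qed
qed

text \<open>If the fixed space were a hyperplane, its normal line would be \<open>H\<close>-invariant, hence spanned by a
  joint eigenvector, which the stratum group fixes.\<close>

lemma codim_fixed_space_stratum_group:
  fixes H :: "('n::finite \<Rightarrow> 'n) set"
  assumes H: "subgroup H Sym" and ne: "fixed_space (stratum_group H) \<noteq> (UNIV :: (real^'n) set)"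
  shows "CARD('n) - dim (fixed_space (stratum_group H) :: (real^'n) set) \<ge> 2"
proof (rule ccontr)
  let ?V = "fixed_space (stratum_group H) :: (real^'n) set"
  assume "\<not> ?thesis"
  then have d: "CARD('n) \<le> dim ?V + 1" by simp
  note sg = subgroup_SymD[OF H]
  have V: "subspace ?V" by (rule subspace_fixed_space)
  have dlt: "dim ?V < DIM(real^'n)"
  proof -
    have "span ?V = ?V" using V by (simp add: span_eq_iff)
    then have "dim ?V \<noteq> DIM(real^'n)" using ne dim_eq_full[of ?V] by metis
    then show ?thesis using dim_subset_UNIV[of ?V] by simp
  qed
  obtain a where a: "a \<noteq> 0" "\<And>y. y \<in> span ?V \<Longrightarrow> orthogonal a y"
    by (rule orthogonal_to_subspace_exists[OF dlt], rule that)
  have aV: "a \<bullet> x = 0" if "x \<in> ?V" for x using a(2)[of x] that by (simp add: span_base orthogonal_def)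
  have VK: "?V = {x. a \<bullet> x = 0}"
  proof (rule subspace_dim_equal[OF V subspace_hyperplane])
    show "?V \<subseteq> {x. a \<bullet> x = 0}" using aV by auto
    show "dim {x. a \<bullet> x = 0} \<le> dim ?V" using d by (simp add: dim_hyperplane[OF a(1)])
  qed
  \<comment> \<open>H normalises \<open>stratum_group H\<close>: conjugating by an element of H only
    rescales joint eigenvectors in between. Hence H preserves the fixed space.\<close>
  have inv: "perm_vec h x \<in> ?V" if h: "h \<in> H" and x: "x \<in> ?V" for h x
    unfolding fixed_space_def mem_Collect_eq
  proof
    fix g assume g: "g \<in> stratum_group H"
    let ?k = "inv_into UNIV h"
    have bb: "bij h" "bij ?k" "bij g" "?k \<in> H" "g \<in> H"
      using sg(1,3) h g bij_imp_bij_inv by (auto simp: stratum_group_def)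
    have "?k \<circ> (g \<circ> h) \<in> stratum_group H"
      unfolding stratum_group_def
    proof (intro CollectI conjI ballI)
      show "?k \<circ> (g \<circ> h) \<in> H" using bb h sg(2) by blast
      fix w :: "real^'n" assume w: "w \<in> joint_eigenvectors H"
      obtain c where c: "perm_vec h w = c *\<^sub>R w" using w h by (auto simp: joint_eigenvectors_def)
      have gw: "perm_vec g w = w" using g w by (auto simp: stratum_group_def)
      have "perm_vec (?k \<circ> (g \<circ> h)) w = perm_vec ?k (perm_vec g (perm_vec h w))"
        by (simp add: perm_vec_comp[OF bb(2) bij_comp[OF bb(1,3)]] perm_vec_comp[OF bb(3,1)])
      also have "\<dots> = perm_vec ?k (perm_vec h w)" by (simp add: c perm_vec_scaleR gw)
      also have "\<dots> = w" by (rule perm_vec_inv_left[OF bb(1)])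
      finally show "perm_vec (?k \<circ> (g \<circ> h)) w = w" .
    qed
    then have "perm_vec (?k \<circ> (g \<circ> h)) x = x" using x by (simp add: fixed_space_def)
    then have "perm_vec h (perm_vec ?k (perm_vec g (perm_vec h x))) = perm_vec h x"
      by (simp add: perm_vec_comp[OF bb(2) bij_comp[OF bb(1,3)]] perm_vec_comp[OF bb(3,1)])
    then show "perm_vec g (perm_vec h x) = perm_vec h x" by (simp add: perm_vec_inv_right[OF bb(1)])
  qed
  have "a \<in> joint_eigenvectors H"
    unfolding joint_eigenvectors_def mem_Collect_eq
  proof
    fix h assume h: "h \<in> H"
    \<comment> \<open>The multiple k a is the component of h a along a. The rest z lies in the
      hyperplane, and since H preserves the hyperplane and acts orthogonally, z is orthogonal to h
      a, hence to itself.\<close>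
    define k where "k = (perm_vec h a \<bullet> a) / (a \<bullet> a)"
    define z where "z = perm_vec h a - k *\<^sub>R a"
    have "a \<bullet> z = 0" using a(1) by (simp add: z_def k_def inner_diff_right inner_commute)
    then have zV: "z \<in> ?V" using VK by simp
    have "perm_vec h a \<bullet> z = a \<bullet> perm_vec (inv_into UNIV h) z" by (rule perm_vec_inner_left[OF sg(1)[OF h]])
    also have "\<dots> = 0" by (rule aV[OF inv[OF sg(3)[OF h] zV]])
    finally have "z \<bullet> z = 0" using aV[OF zV] by (simp add: z_def inner_diff_left)
    then show "\<exists>c. perm_vec h a = c *\<^sub>R a" by (intro exI[of _ k]) (simp add: z_def)
  qed
  then have "a \<in> ?V" by (auto simp: fixed_space_def stratum_group_def)
  then show False using aV[of a] a(1) by simp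
qed

section \<open>Braid spaces, partitions and intersections\<close>

lemma braid_space_iff:
  "w \<in> braid_space \<pi> \<longleftrightarrow> (\<forall>i j. (\<exists>b\<in>\<pi>. i \<in> b \<and> j \<in> b) \<longrightarrow> w $ i = w $ j)"
proof
  assume w: "w \<in> braid_space \<pi>"
  show "\<forall>i j. (\<exists>b\<in>\<pi>. i \<in> b \<and> j \<in> b) \<longrightarrow> w $ i = w $ j"
  proof (intro allI impI)
    fix i j assume ij: "\<exists>b\<in>\<pi>. i \<in> b \<and> j \<in> b"
    show "w $ i = w $ j"
    proof (cases "i = j")
      case False
      then have "w \<in> braid_hyperplane i j" using w ij unfolding braid_space_def by blast
      then show ?thesis by (simp add: braid_hyperplane_def)
    qed simp
  qed
qed (auto simp: braid_space_def braid_hyperplane_def)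

lemma subspace_braid_space: "subspace (braid_space \<pi>)"
  unfolding subspace_def by (auto simp: braid_space_iff)

text \<open>The blocks are the classes of coordinates that agree on all of V. Defining them through
  V rather than through R makes the equivalence closure of R unnecessary.\<close>

lemma braid_space_of_relation:
  fixes V :: "(real^'n) set"
  assumes V: "V = {w. \<forall>(i, j)\<in>R. w $ i = w $ j}"
  obtains \<pi> where "partition_on UNIV \<pi>" "V = braid_space \<pi>"
proof -
  define cl where "cl i = {j. \<forall>w\<in>V. w $ i = w $ j}" for i
  have "partition_on UNIV (range cl)"
    unfolding partition_on_def disjoint_def
  proof (intro conjI ballI impI)
    show "\<Union>(range cl) = UNIV" "{} \<notin> range cl" by (auto simp: cl_def)
    fix a b assume "a \<in> range cl" "b \<in> range cl" "a \<noteq> b"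
    then obtain i j where ij: "a = cl i" "b = cl j" "cl i \<noteq> cl j" by auto
    show "a \<inter> b = {}"
    proof (rule ccontr)
      assume "a \<inter> b \<noteq> {}"
      then obtain k where "k \<in> cl i" "k \<in> cl j" using ij by auto
      then have "cl i = cl j" by (auto simp: cl_def)
      then show False using ij(3) by simp
    qed
  qed
  moreover have "V = braid_space (range cl)"
  proof (intro equalityI subsetI)
    fix w assume "w \<in> V"
    then show "w \<in> braid_space (range cl)" by (auto simp: braid_space_iff cl_def)
  next
    fix w assume w: "w \<in> braid_space (range cl)"
    have "w $ i = w $ j" if "(i, j) \<in> R" for i j
    proof -
      have "i \<in> cl i" "j \<in> cl i" using that V by (auto simp: cl_def)
      then show ?thesis using w unfolding braid_space_iff by blast
    qed
    then show "w \<in> V" using V by auto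
  qed
  ultimately show ?thesis by (rule that)
qed

lemma braid_space_fixed_space:
  fixes F :: "('n::finite \<Rightarrow> 'n) set"
  assumes "\<And>g. g \<in> F \<Longrightarrow> bij g"
  obtains \<pi> where "partition_on UNIV \<pi>" "(fixed_space F :: (real^'n) set) = braid_space \<pi>"
proof (rule braid_space_of_relation)
  show "fixed_space F = {w :: real^'n. \<forall>(i, j)\<in>{(g m, m) | g m. g \<in> F}. w $ i = w $ j}"
  proof -
    have "w \<in> fixed_space F \<longleftrightarrow> (\<forall>g\<in>F. \<forall>m. w $ g m = w $ m)" for w :: "real^'n"
      by (simp add: fixed_space_def perm_vec_eq_iff assms)
    then show ?thesis unfolding set_eq_iff by blast
  qed
qed (rule that)

lemma braid_space_Inter:
  fixes \<V> :: "(real^'n) set set"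
  assumes "\<And>V. V \<in> \<V> \<Longrightarrow> \<exists>\<pi>. V = braid_space \<pi>"
  obtains \<pi> where "partition_on UNIV \<pi>" "\<Inter>\<V> = braid_space \<pi>"
proof -
  \<comment> \<open>Collecting all coordinate equalities that hold on the intersection avoids
    describing the join of the partitions.\<close>
  define R where "R = {(i, j). \<forall>w\<in>\<Inter>\<V>. w $ i = w $ j}"
  have "\<Inter>\<V> = {w. \<forall>(i, j)\<in>R. w $ i = w $ j}"
  proof (intro equalityI subsetI InterI)
    fix w V assume w: "w \<in> {w :: real^'n. \<forall>(i, j)\<in>R. w $ i = w $ j}" and V: "V \<in> \<V>"
    obtain \<pi> where \<pi>: "V = braid_space \<pi>" using assms[OF V] by auto
    show "w \<in> V"
      unfolding \<pi> braid_space_iff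
    proof (intro allI impI)
      fix i j assume ij: "\<exists>b\<in>\<pi>. i \<in> b \<and> j \<in> b"
      have "u $ i = u $ j" if "u \<in> \<Inter>\<V>" for u
      proof -
        have "u \<in> braid_space \<pi>" using that V \<pi> by auto
        then show ?thesis using ij unfolding braid_space_iff by blast
      qed
      then have "(i, j) \<in> R" by (simp add: R_def)
      then show "w $ i = w $ j" using w by auto
    qed
  qed (auto simp: R_def)
  then show ?thesis by (rule braid_space_of_relation) (rule that)
qed

lemma projectivization_Inter:
  fixes \<V> :: "(real^'n) set set"
  assumes "\<And>V. V \<in> \<V> \<Longrightarrow> subspace V" "\<V> \<noteq> {}"
  shows "\<Inter>(projectivization ` \<V>) = projectivization (\<Inter>\<V>)"
proof (intro equalityI subsetI)
  fix y assume y: "y \<in> \<Inter>(projectivization ` \<V>)"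
  obtain V0 where V0: "V0 \<in> \<V>" using assms(2) by auto
  then obtain v where v: "v \<noteq> 0" "y = proj_point v" using y by (auto simp: projectivization_def)
  have "v \<in> V" if "V \<in> \<V>" for V
    using y that v proj_point_in_projectivization[OF assms(1)[OF that] v(1)] by auto
  then show "y \<in> projectivization (\<Inter>\<V>)" using v by (auto simp: projectivization_def)
qed (auto simp: projectivization_def)

lemma projectivization_inject:
  assumes "subspace V" "subspace V'" "projectivization V = projectivization V'"
  shows "V = V'"
proof -
  have "v \<in> V \<longleftrightarrow> v \<in> V'" for v
    using proj_point_in_projectivization[OF assms(1), of v] proj_point_in_projectivization[OF assms(2), of v]
      assms subspace_0 by (cases "v = 0") auto
  then show ?thesis by auto
qed

text \<open>The invariant lines of the cyclic group generated by \<open>\<sigma>\<close> span the fixed space of \<open>\<sigma>\<^sup>2\<close>. The base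
  point is the all-ones point, which every permutation fixes.\<close>

lemma L_stratum_cyclic:
  fixes \<sigma> :: "'n::finite \<Rightarrow> 'n"
  assumes \<sigma>: "bij \<sigma>" and ne: "fixed_space {\<sigma> \<circ> \<sigma>} \<noteq> (UNIV :: (real^'n) set)"
  shows "projectivization (fixed_space {\<sigma> \<circ> \<sigma>} :: (real^'n) set) \<in> L_stratification Sym RP_action RP"
proof -
  define H where "H = generate (Sym :: ('n \<Rightarrow> 'n) monoid) {\<sigma>}"
  have H: "subgroup H Sym" unfolding H_def
    by (rule group.generate_is_subgroup[OF group_BijGroup]) (use \<sigma> carrier_Sym in auto)
  note sg = subgroup_SymD[OF H]
  have \<sigma>H: "\<sigma> \<in> H" unfolding H_def by (rule generate.incl) simp
  \<comment> \<open>The all-ones point is normalised because the descriptions of tangent spaces and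
    strata are stated for unit representatives.\<close>
  define v :: "real^'n" where "v = inverse (norm (1 :: real^'n)) *\<^sub>R 1"
  have one0: "(1 :: real^'n) \<noteq> 0" by (simp add: vec_eq_iff)
  have v: "v \<bullet> v = 1" using one0 by (simp add: v_def dot_square_norm power2_eq_square)
  have v0: "v \<noteq> 0" using v by auto
  have stab: "H \<subseteq> stabilizer Sym RP_action (proj_point v)"
  proof
    fix h assume h: "h \<in> H"
    have "RP_action h (proj_point v) = proj_point v"
      using RP_action_proj[OF sg(1)[OF h] v0] by (simp add: v_def perm_vec_scaleR perm_vec_1)
    then show "h \<in> stabilizer Sym RP_action (proj_point v)"
      using sg(1)[OF h] by (simp add: stabilizer_def carrier_Sym)
  qed
  \<comment> \<open>For a cyclic group it suffices to be an eigenvector of the generator; c * c = 1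
    makes c its own inverse, which handles the inverse of \<sigma>.\<close>
  have eig: "w \<in> joint_eigenvectors H" if w: "perm_vec \<sigma> w = c *\<^sub>R w" "c * c = 1" for w :: "real^'n" and c
  proof -
    have "\<exists>d. perm_vec h w = d *\<^sub>R w" if "h \<in> generate (Sym :: ('n \<Rightarrow> 'n) monoid) {\<sigma>}" for h
      using that
    proof (induction rule: generate.induct)
      case one
      have e: "(\<one>\<^bsub>Sym\<^esub> :: 'n \<Rightarrow> 'n) = id" by (auto simp: BijGroup_def)
      show ?case unfolding e by (rule exI[of _ 1]) (simp only: perm_vec_id scaleR_one)
    next
      case (incl h)
      then show ?case using w by auto
    next
      case (inv h)
      have "\<sigma> \<in> Bij UNIV" using \<sigma> by (simp add: Bij_def)
      then have i: "m_inv Sym h = inv_into UNIV \<sigma>" using inv by (simp add: inv_BijGroup restrict_def)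
      have "perm_vec (inv_into UNIV \<sigma>) (c *\<^sub>R w) = w" using perm_vec_inv_left[OF \<sigma>, of w] w(1) by simp
      then have "c *\<^sub>R perm_vec (inv_into UNIV \<sigma>) w = w" by (simp add: perm_vec_scaleR)
      then have "c *\<^sub>R c *\<^sub>R perm_vec (inv_into UNIV \<sigma>) w = c *\<^sub>R w" by simp
      then show ?case unfolding i using w(2) by (intro exI[of _ c]) simp
    next
      case (eng h1 h2)
      have h: "bij h1" "bij h2" using eng(1,2) sg(1) unfolding H_def by auto
      then have e: "h1 \<otimes>\<^bsub>Sym\<^esub> h2 = h1 \<circ> h2"
        by (simp add: BijGroup_def Bij_def compose_def comp_def restrict_def)
      obtain c1 c2 where "perm_vec h1 w = c1 *\<^sub>R w" "perm_vec h2 w = c2 *\<^sub>R w" using eng by auto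
      then show ?case unfolding e perm_vec_comp[OF h] by (auto simp: perm_vec_scaleR)
    qed
    then show ?thesis by (auto simp: joint_eigenvectors_def H_def)
  qed
  have eq: "fixed_space (stratum_group H) = (fixed_space {\<sigma> \<circ> \<sigma>} :: (real^'n) set)"
  proof (intro equalityI subsetI)
    fix w :: "real^'n" assume w: "w \<in> fixed_space (stratum_group H)"
    have "\<sigma> \<circ> \<sigma> \<in> stratum_group H"
      unfolding stratum_group_def
    proof (intro CollectI conjI ballI)
      show "\<sigma> \<circ> \<sigma> \<in> H" by (rule sg(2)[OF \<sigma>H \<sigma>H])
      fix u :: "real^'n" assume "u \<in> joint_eigenvectors H"
      then obtain c where c: "perm_vec \<sigma> u = c *\<^sub>R u" using \<sigma>H by (auto simp: joint_eigenvectors_def)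
      show "perm_vec (\<sigma> \<circ> \<sigma>) u = u"
        using perm_vec_eigenvalue(1)[OF \<sigma> c] c by (cases "u = 0") (simp_all add: perm_vec_comp[OF \<sigma> \<sigma>] perm_vec_scaleR perm_vec_0)
    qed
    then show "w \<in> fixed_space {\<sigma> \<circ> \<sigma>}" using w by (simp add: fixed_space_def)
  next
    fix w :: "real^'n" assume "w \<in> fixed_space {\<sigma> \<circ> \<sigma>}"
    then have w: "perm_vec \<sigma> (perm_vec \<sigma> w) = w" by (simp add: fixed_space_def perm_vec_comp[OF \<sigma> \<sigma>])
    \<comment> \<open>On the fixed space of the square, \<sigma> is an involution, so 2 w is the sum
      of an eigenvector for 1 and one for -1. Both are fixed by the stratum group.\<close>
    have p: "w + perm_vec \<sigma> w \<in> joint_eigenvectors H" by (rule eig[of _ 1]) (simp_all add: perm_vec_add w)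
    have m: "w - perm_vec \<sigma> w \<in> joint_eigenvectors H" by (rule eig[of _ "-1"]) (simp_all add: perm_vec_diff w)
    show "w \<in> fixed_space (stratum_group H)"
      unfolding fixed_space_def mem_Collect_eq
    proof
      fix g assume "g \<in> stratum_group H"
      then have "perm_vec g ((w + perm_vec \<sigma> w) + (w - perm_vec \<sigma> w)) = (w + perm_vec \<sigma> w) + (w - perm_vec \<sigma> w)"
        unfolding perm_vec_add[of g "w + perm_vec \<sigma> w" "w - perm_vec \<sigma> w"] using p m by (auto simp: stratum_group_def)
      then have "perm_vec g (2 *\<^sub>R w) = 2 *\<^sub>R w" by (simp add: scaleR_2)
      then show "perm_vec g w = w" by (simp add: perm_vec_scaleR)
    qed
  qed
  have "projectivization (fixed_space {\<sigma> \<circ> \<sigma>} :: (real^'n) set) \<noteq> RP"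
    using projectivization_inject[OF subspace_fixed_space subspace_UNIV] ne by blast
  moreover have "proj_point v \<in> RP" using v0 by (auto simp: projectivization_def)
  moreover have "projectivization (fixed_space {\<sigma> \<circ> \<sigma>} :: (real^'n) set) = L_stratum RP_action RP (proj_point v) H"
    unfolding L_stratum_RP[OF v stab] eq ..
  ultimately show ?thesis unfolding L_stratification_def using H stab by auto
qed

lemma L_stratification_RP_subset:
  "L_stratification Sym RP_action (RP :: (real^'n^'n) set) \<subseteq> rank2_truncation"
proof
  fix S :: "(real^'n^'n) set" assume "S \<in> L_stratification Sym RP_action RP"
  then obtain x H where x: "x \<in> RP" "subgroup H Sym" "H \<subseteq> stabilizer Sym RP_action x" "S = L_stratum RP_action RP x H" "S \<noteq> RP"
    unfolding L_stratification_def by auto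
  obtain v where v: "v \<bullet> v = 1" "x = proj_point v" by (rule projectivization_unit[OF subspace_UNIV x(1)])
  have S: "S = projectivization (fixed_space (stratum_group H))"
    using L_stratum_RP[OF v(1)] x(3,4) v(2) by simp
  then have "fixed_space (stratum_group H) \<noteq> (UNIV :: (real^'n) set)" using x(5) by auto
  then have c: "CARD('n) - dim (fixed_space (stratum_group H) :: (real^'n) set) \<ge> 2"
    by (rule codim_fixed_space_stratum_group[OF x(2)])
  have "bij g" if "g \<in> stratum_group H" for g using that subgroup_SymD(1)[OF x(2)] by (auto simp: stratum_group_def)
  then obtain \<pi> where "partition_on UNIV \<pi>" "(fixed_space (stratum_group H) :: (real^'n) set) = braid_space \<pi>"
    by (rule braid_space_fixed_space)
  then show "S \<in> rank2_truncation" unfolding rank2_truncation_def using S c by auto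
qed

text \<open>If i and j were the only distinct indices sharing a block, the braid space would contain
  the hyperplane x_i = x_j and have codimension at most 1.\<close>

lemma codim_ge_2_pairs:
  fixes \<pi> :: "'n::finite set set"
  assumes "CARD('n) - dim (braid_space \<pi> :: (real^'n) set) \<ge> 2"
    and ij: "i \<noteq> j" "b \<in> \<pi>" "i \<in> b" "j \<in> b"
  shows "\<exists>k l b'. k \<noteq> l \<and> b' \<in> \<pi> \<and> k \<in> b' \<and> l \<in> b' \<and> {k, l} \<noteq> {i, j}"
proof (rule ccontr)
  assume n: "\<not> ?thesis"
  let ?a = "axis i 1 - axis j 1 :: real^'n"
  have "?a $ i = 1" using ij(1) by (simp add: axis_def)
  then have a0: "?a \<noteq> 0" by (metis zero_index zero_neq_one)
  have "{x. ?a \<bullet> x = 0} \<subseteq> braid_space \<pi>"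
  proof
    fix x assume "x \<in> {x. ?a \<bullet> x = 0}"
    then have x: "x $ i = x $ j" by (simp add: inner_diff_left inner_axis' )
    have "x $ k = x $ l" if "b' \<in> \<pi>" "k \<in> b'" "l \<in> b'" for k l b'
    proof (cases "k = l")
      case False
      then have "{k, l} = {i, j}" using n that by blast
      then show ?thesis using x by (auto simp: doubleton_eq_iff)
    qed simp
    then show "x \<in> braid_space \<pi>" unfolding braid_space_iff by blast
  qed
  then have "dim {x. ?a \<bullet> x = 0} \<le> dim (braid_space \<pi> :: (real^'n) set)" by (rule dim_subset)
  then have "CARD('n) - 1 \<le> dim (braid_space \<pi> :: (real^'n) set)" using dim_hyperplane[OF a0] by simp
  then show False using assms(1) by linarith
qed

text \<open>\<open>\<sigma>\<close> is a 3-cycle inside a block with at least three elements, or a 4-cycle whose square is a product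
  of two transpositions from two blocks.\<close>

lemma cycle_square_separates:
  fixes \<pi> :: "'n::finite set set"
  assumes \<pi>: "partition_on UNIV \<pi>" and c: "CARD('n) - dim (braid_space \<pi> :: (real^'n) set) \<ge> 2"
    and ij: "i \<noteq> j" "b \<in> \<pi>" "i \<in> b" "j \<in> b"
  obtains \<sigma> :: "'n \<Rightarrow> 'n" where "bij \<sigma>" "braid_space \<pi> \<subseteq> (fixed_space {\<sigma> \<circ> \<sigma>} :: (real^'n) set)"
    "(fixed_space {\<sigma> \<circ> \<sigma>} :: (real^'n) set) \<subseteq> {w. w $ i = w $ j}"
proof -
  note goal_rule = that
  have w_eq: "w $ k = w $ l" if "w \<in> braid_space \<pi>" "b' \<in> \<pi>" "k \<in> b'" "l \<in> b'" for w :: "real^'n" and k l b'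
    using that unfolding braid_space_iff by blast
  have fx: "w \<in> fixed_space {\<sigma> \<circ> \<sigma>} \<longleftrightarrow> (\<forall>m. w $ \<sigma> (\<sigma> m) = w $ m)" if "bij \<sigma>" for \<sigma> :: "'n \<Rightarrow> 'n" and w :: "real^'n"
    using perm_vec_eq_iff[OF bij_comp[OF that that], of w] by (simp add: fixed_space_def)
  have bijI: "bij f" if "inj f" for f :: "'n \<Rightarrow> 'n" using that finite_UNIV_inj_surj[of f] by (simp add: bij_def)
  have three: thesis if k: "k \<in> b" "k \<noteq> i" "k \<noteq> j" for k
  proof -
    \<comment> \<open>The cycle i -> k -> j -> i; its square takes i to j.\<close>
    define \<sigma> where "\<sigma> = id(i := k, k := j, j := i)"
    have \<sigma>: "\<sigma> i = k" "\<sigma> k = j" "\<sigma> j = i" "\<And>m. m \<noteq> i \<Longrightarrow> m \<noteq> j \<Longrightarrow> m \<noteq> k \<Longrightarrow> \<sigma> m = m"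
      using ij(1) k by (simp_all add: \<sigma>_def)
    have b: "bij \<sigma>" by (rule bijI, rule injI) (use \<sigma> in metis)
    show thesis
    proof (rule goal_rule[OF b])
      show "braid_space \<pi> \<subseteq> fixed_space {\<sigma> \<circ> \<sigma>}"
      proof
        fix w assume w: "w \<in> braid_space \<pi>"
        have "w $ \<sigma> (\<sigma> m) = w $ m" for m
          using \<sigma> w_eq[OF w ij(2)] ij(3,4) k(1) by (cases "m = i"; cases "m = j"; cases "m = k") metis+
        then show "w \<in> fixed_space {\<sigma> \<circ> \<sigma>}" unfolding fx[OF b] by blast
      qed
      show "(fixed_space {\<sigma> \<circ> \<sigma>} :: (real^'n) set) \<subseteq> {w. w $ i = w $ j}"
      proof
        fix w :: "real^'n" assume "w \<in> fixed_space {\<sigma> \<circ> \<sigma>}"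
        then have "w $ \<sigma> (\<sigma> i) = w $ i" unfolding fx[OF b] by blast
        then show "w \<in> {w. w $ i = w $ j}" by (simp add: \<sigma>)
      qed
    qed
  qed
  obtain k l b' where kl: "k \<noteq> l" "b' \<in> \<pi>" "k \<in> b'" "l \<in> b'" "{k, l} \<noteq> {i, j}"
    using codim_ge_2_pairs[OF c ij] by blast
  show thesis
  proof (cases "b' = b")
    case True
    then have "(k \<noteq> i \<and> k \<noteq> j) \<or> (l \<noteq> i \<and> l \<noteq> j)" using kl(1,5) by auto
    then show thesis using three kl True by blast
  next
    case False
    then have "b \<inter> b' = {}" using partition_onD2[OF \<pi>] ij(2) kl(2) by (auto simp: disjoint_def)
    then have d: "k \<noteq> i" "k \<noteq> j" "l \<noteq> i" "l \<noteq> j" using ij kl by auto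
    \<comment> \<open>The cycle i -> k -> j -> l -> i alternates between the two blocks, so that its
      square exchanges i with j and k with l and thus respects the blocks.\<close>
    define \<sigma> where "\<sigma> = id(i := k, k := j, j := l, l := i)"
    have \<sigma>: "\<sigma> i = k" "\<sigma> k = j" "\<sigma> j = l" "\<sigma> l = i" "\<And>m. m \<noteq> i \<Longrightarrow> m \<noteq> j \<Longrightarrow> m \<noteq> k \<Longrightarrow> m \<noteq> l \<Longrightarrow> \<sigma> m = m"
      using ij(1) kl(1) d by (simp_all add: \<sigma>_def)
    have b: "bij \<sigma>" by (rule bijI, rule injI) (use \<sigma> in metis)
    show thesis
    proof (rule goal_rule[OF b])
      show "braid_space \<pi> \<subseteq> fixed_space {\<sigma> \<circ> \<sigma>}"
      proof
        fix w assume w: "w \<in> braid_space \<pi>"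
        have e: "w $ i = w $ j" "w $ k = w $ l" using w_eq[OF w ij(2-4)] w_eq[OF w kl(2-4)] by auto
        have "w $ \<sigma> (\<sigma> m) = w $ m" for m
          using \<sigma> e by (cases "m = i"; cases "m = j"; cases "m = k"; cases "m = l") metis+
        then show "w \<in> fixed_space {\<sigma> \<circ> \<sigma>}" unfolding fx[OF b] by blast
      qed
      show "(fixed_space {\<sigma> \<circ> \<sigma>} :: (real^'n) set) \<subseteq> {w. w $ i = w $ j}"
      proof
        fix w :: "real^'n" assume "w \<in> fixed_space {\<sigma> \<circ> \<sigma>}"
        then have "w $ \<sigma> (\<sigma> i) = w $ i" unfolding fx[OF b] by blast
        then show "w \<in> {w. w $ i = w $ j}" by (simp add: \<sigma>)
      qed
    qed
  qed
qed

text \<open>Intersecting braid spaces of codimension at least 2 gives such spaces again. For the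
  converse, a braid space is cut out by the cyclic strata containing it: for each pair of indices in
  a common block one of them imposes the equality of the two coordinates.\<close>

theorem strata_L_stratification_RP:
  "strata (RP :: (real^'n^'n) set) (L_stratification Sym RP_action RP) = rank2_truncation"
proof (intro equalityI subsetI)
  fix Y :: "(real^'n^'n) set" assume "Y \<in> strata RP (L_stratification Sym RP_action RP)"
  then obtain \<S> where S: "\<S> \<subseteq> L_stratification Sym RP_action RP" "\<S> \<noteq> {}" "Y = \<Inter>\<S>"
    unfolding strata_def by auto
  define \<V> where "\<V> = {V :: (real^'n) set. projectivization V \<in> \<S> \<and> (\<exists>\<pi>. V = braid_space \<pi>) \<and> CARD('n) - dim V \<ge> 2}"
  have "\<exists>V\<in>\<V>. Z = projectivization V" if "Z \<in> \<S>" for Z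
  proof -
    have "Z \<in> rank2_truncation" using that S(1) L_stratification_RP_subset by auto
    then show ?thesis using that unfolding rank2_truncation_def \<V>_def by auto
  qed
  then have SV: "\<S> = projectivization ` \<V>" by (auto simp: \<V>_def)
  then have ne: "\<V> \<noteq> {}" using S(2) by auto
  have Y: "Y = projectivization (\<Inter>\<V>)"
    unfolding S(3) SV by (rule projectivization_Inter[OF _ ne]) (auto simp: \<V>_def subspace_braid_space)
  obtain \<pi> where \<pi>: "partition_on UNIV \<pi>" "\<Inter>\<V> = braid_space \<pi>"
    by (rule braid_space_Inter[of \<V>]) (auto simp: \<V>_def)
  obtain V where V: "V \<in> \<V>" using ne by auto
  have "dim (\<Inter>\<V>) \<le> dim V" using V by (intro dim_subset) auto
  then have "CARD('n) - dim (\<Inter>\<V>) \<ge> 2" using V unfolding \<V>_def by auto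
  then show "Y \<in> rank2_truncation" unfolding rank2_truncation_def Y using \<pi> by auto
next
  fix Y :: "(real^'n^'n) set" assume "Y \<in> rank2_truncation"
  then obtain \<pi> where \<pi>: "partition_on UNIV \<pi>" "Y = projectivization (braid_space \<pi>)"
    and c: "CARD('n) - dim (braid_space \<pi> :: (real^'n) set) \<ge> 2"
    unfolding rank2_truncation_def by auto
  \<comment> \<open>All proper fixed spaces of squares that contain the braid space; the condition
    of being proper excludes the whole space, which is not counted as a stratum.\<close>
  define \<V> where "\<V> = {fixed_space {\<sigma> \<circ> \<sigma>} :: (real^'n) set | \<sigma>. bij \<sigma> \<and> braid_space \<pi> \<subseteq> (fixed_space {\<sigma> \<circ> \<sigma>} :: (real^'n) set) \<and>
      fixed_space {\<sigma> \<circ> \<sigma>} \<noteq> (UNIV :: (real^'n) set)}"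
  have bneU: "braid_space \<pi> \<noteq> (UNIV :: (real^'n) set)" using c by auto
  have sep: "\<exists>V\<in>\<V>. V \<subseteq> {w. w $ i = w $ j}" if ij: "i \<noteq> j" "b \<in> \<pi>" "i \<in> b" "j \<in> b" for i j b
  proof -
    obtain \<sigma> :: "'n \<Rightarrow> 'n" where \<sigma>: "bij \<sigma>" "braid_space \<pi> \<subseteq> (fixed_space {\<sigma> \<circ> \<sigma>} :: (real^'n) set)"
      "(fixed_space {\<sigma> \<circ> \<sigma>} :: (real^'n) set) \<subseteq> {w. w $ i = w $ j}"
      by (rule cycle_square_separates[OF \<pi>(1) c ij], rule that)
    have "(axis i 1 :: real^'n) \<notin> {w. w $ i = w $ j}" using ij(1) by (simp add: axis_def)
    then have "fixed_space {\<sigma> \<circ> \<sigma>} \<noteq> (UNIV :: (real^'n) set)" using \<sigma>(3) by blast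
    then show ?thesis using \<sigma> unfolding \<V>_def by blast
  qed
  have I: "\<Inter>\<V> = braid_space \<pi>"
  proof (intro equalityI subsetI)
    fix w assume w: "w \<in> \<Inter>\<V>"
    have "w $ i = w $ j" if bij: "b \<in> \<pi>" "i \<in> b" "j \<in> b" for i j b
    proof (cases "i = j")
      case False
      obtain V where "V \<in> \<V>" "V \<subseteq> {w. w $ i = w $ j}" using sep[OF False bij] by auto
      then show ?thesis using w by auto
    qed simp
    then show "w \<in> braid_space \<pi>" unfolding braid_space_iff by blast
  qed (auto simp: \<V>_def)
  have ne: "\<V> \<noteq> {}" using I bneU by auto
  have sub: "subspace V" if "V \<in> \<V>" for V using that subspace_fixed_space by (auto simp: \<V>_def)
  have Y: "Y = \<Inter>(projectivization ` \<V>)" unfolding \<pi>(2) I[symmetric] by (rule projectivization_Inter[OF sub ne, symmetric])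
  have "projectivization ` \<V> \<subseteq> L_stratification Sym RP_action RP"
    using L_stratum_cyclic by (auto simp: \<V>_def)
  moreover have "projectivization ` \<V> \<noteq> {}" using ne by simp
  \<comment> \<open>\<open>strata\<close> admits only non-empty intersections; the all-ones point
    lies on every braid space.\<close>
  moreover have "\<Inter>(projectivization ` \<V>) \<noteq> {}"
  proof -
    have "(1 :: real^'n) \<in> braid_space \<pi>" by (simp add: braid_space_iff)
    moreover have "(1 :: real^'n) \<noteq> 0" by (simp add: vec_eq_iff)
    ultimately show ?thesis unfolding Y[symmetric] \<pi>(2) by (auto simp: projectivization_def)
  qed
  moreover have "Y \<noteq> RP"
    unfolding \<pi>(2) using projectivization_inject[OF subspace_braid_space subspace_UNIV] bneU by blast
  ultimately show "Y \<in> strata RP (L_stratification Sym RP_action RP)"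
    unfolding strata_def Y by blast
qed

section \<open>Projective arrangements are flat\<close>

text \<open>The affine chart a \<mapsto> a / (a . e) - e around [e], expressed by the projection
  matrix: A e is a multiple of a, and the scalar in front normalises its inner product with e to
  1.\<close>

definition affine_chart :: "real^'n \<Rightarrow> real^'n^'n \<Rightarrow> real^'n" where
  "affine_chart e A = inverse (e \<bullet> (A *v e)) *\<^sub>R (A *v e) - e"

lemma affine_chart_proj_point:
  "a \<bullet> e \<noteq> 0 \<Longrightarrow> affine_chart e (proj_point a) = inverse (a \<bullet> e) *\<^sub>R a - e"
  by (cases "a = 0") (simp_all add: affine_chart_def proj_point_mult inner_commute field_simps)

lemma diffeo_affine_chart:
  fixes e :: "real^'n"
  assumes e: "e \<bullet> e = 1"
  shows "diffeo {A \<in> RP. e \<bullet> (A *v e) \<noteq> 0} {y. y \<bullet> e = 0} (affine_chart e)" (is "diffeo ?D ?K _")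
proof (rule diffeoI[where g = "\<lambda>y. proj_point (e + y)"])
  have D: "\<exists>a. A = proj_point a \<and> a \<bullet> e \<noteq> 0" if "A \<in> ?D" for A
    using that by (auto simp: projectivization_def proj_point_mult inner_commute)
  have K1: "(e + y) \<bullet> e = 1" if "y \<in> ?K" for y using that e by (simp add: inner_add_left)
  have K0: "e + y \<noteq> 0" if "y \<in> ?K" for y using K1[OF that] by auto
  show "smooth_map ?D ?K (affine_chart e)"
  proof (rule smooth_mapI_smooth_on)
    have s: "smooth_on UNIV (\<lambda>A::real^'n^'n. e \<bullet> (A *v e))"
      by (intro smooth_on_inner smooth_on_matrix_vector_mult smooth_on_ident smooth_on_const open_UNIV)
    have o: "open {A::real^'n^'n. e \<bullet> (A *v e) \<noteq> 0}" (is "open ?U")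
      by (rule open_Collect_neq[OF smooth_on_imp_continuous[OF s] continuous_on_const])
    show "smooth_on ?U (affine_chart e)" unfolding affine_chart_def
      by (intro smooth_on_diff smooth_on_scaleR smooth_on_inner smooth_on_inverse smooth_on_matrix_vector_mult
          smooth_on_ident smooth_on_const o) auto
    show "affine_chart e ` ?D \<subseteq> ?K"
    proof
      fix y assume "y \<in> affine_chart e ` ?D"
      then obtain a where "a \<bullet> e \<noteq> 0" "y = affine_chart e (proj_point a)" using D by blast
      then show "y \<in> ?K" using e by (simp add: affine_chart_proj_point inner_diff_left)
    qed
  qed auto
  show "smooth_map ?K ?D (\<lambda>y. proj_point (e + y))"
  proof (rule smooth_mapI_smooth_on)
    have o: "open {y. e + y \<noteq> (0 :: real^'n)}" (is "open ?U")
      by (intro open_Collect_neq continuous_intros)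
    show "smooth_on ?U (\<lambda>y. proj_point (e + y))"
      by (intro smooth_on_proj_point smooth_on_add smooth_on_const smooth_on_ident o) auto
    show "?K \<subseteq> ?U" using K0 by blast
    show "(\<lambda>y. proj_point (e + y)) ` ?K \<subseteq> ?D"
    proof
      fix A assume "A \<in> (\<lambda>y. proj_point (e + y)) ` ?K"
      then obtain y where y: "y \<in> ?K" "A = proj_point (e + y)" by auto
      have "e \<bullet> (A *v e) = 1 / ((e + y) \<bullet> (e + y))"
        using K1[OF y(1)] y(2) by (simp add: proj_point_mult inner_commute)
      then show "A \<in> ?D" using K0[OF y(1)] y(2) by (auto simp: projectivization_def)
    qed
  qed
  show "proj_point (e + affine_chart e A) = A" if A: "A \<in> ?D" for A
  proof -
    obtain a where a: "A = proj_point a" "a \<bullet> e \<noteq> 0" using D[OF A] by auto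
    then have "e + affine_chart e A = inverse (a \<bullet> e) *\<^sub>R a" by (simp add: affine_chart_proj_point)
    then show ?thesis using a by (simp add: proj_point_scaleR)
  qed
  show "affine_chart e (proj_point (e + y)) = y" if "y \<in> ?K" for y
    using K1[OF that] by (simp add: affine_chart_proj_point)
qed

text \<open>Subtracting e does not leave V because e lies in V. Projectivized subspaces through [e]
  therefore become linear subspaces through the origin of the chart, not merely affine ones.\<close>

lemma affine_chart_mem_iff:
  fixes e :: "real^'n"
  assumes "subspace V" "e \<in> V" "A \<in> RP" "e \<bullet> (A *v e) \<noteq> 0"
  shows "affine_chart e A \<in> V \<longleftrightarrow> A \<in> projectivization V"
proof -
  obtain a where a: "a \<noteq> 0" "A = proj_point a" using assms(3) by (auto simp: projectivization_def)
  have ae: "a \<bullet> e \<noteq> 0" using assms(4) a by (auto simp: proj_point_mult inner_commute)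
  have "inverse (a \<bullet> e) *\<^sub>R a - e \<in> V \<longleftrightarrow> a \<in> V"
  proof
    assume "inverse (a \<bullet> e) *\<^sub>R a - e \<in> V"
    from subspace_add[OF assms(1) this assms(2)] have "inverse (a \<bullet> e) *\<^sub>R a \<in> V" by simp
    from subspace_scale[OF assms(1) this, of "a \<bullet> e"] show "a \<in> V" using ae by simp
  qed (intro subspace_diff subspace_scale assms)
  then show ?thesis
    unfolding a(2) affine_chart_proj_point[OF ae] proj_point_in_projectivization[OF assms(1) a(1)] .
qed

lemma closedin_projectivization:
  fixes V :: "(real^'n) set"
  assumes V: "subspace V"
  shows "closedin (top_of_set RP) (projectivization V)"
proof -
  have "projectivization V = RP \<inter> (\<Inter>z. {A. A *v z \<in> V})"
  proof (intro equalityI subsetI)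
    fix A assume "A \<in> projectivization V"
    then obtain a where "a \<in> V" "a \<noteq> 0" "A = proj_point a" by (auto simp: projectivization_def)
    then show "A \<in> RP \<inter> (\<Inter>z. {A. A *v z \<in> V})"
      by (auto simp: proj_point_mult subspace_scale[OF V] projectivization_def)
  next
    fix A assume A: "A \<in> RP \<inter> (\<Inter>z. {A. A *v z \<in> V})"
    then obtain a where a: "a \<noteq> 0" "A = proj_point a" by (auto simp: projectivization_def)
    have "A *v a \<in> V" using A by auto
    then show "A \<in> projectivization V" using a by (auto simp: proj_point_mult_self projectivization_def)
  qed
  moreover have "closed {A :: real^'n^'n. A *v z \<in> V}" for z
    using continuous_closed_vimage[OF closed_subspace[OF V] linear_continuous_at[OF bounded_linear_matrix_apply[of z]]]
    by (simp add: vimage_def)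
  ultimately show ?thesis by (auto intro!: closedin_closed_Int)
qed

lemma projectivization_Int:
  assumes "subspace V" "subspace V'"
  shows "projectivization V \<inter> projectivization V' = projectivization (V \<inter> V')"
  using projectivization_Inter[of "{V, V'}"] assms by auto

text \<open>At [e] the affine chart centred there flattens every member through [e] at once. Its
  target, the complement of e, varies with e and lies in another space than X, so it is carried
  isometrically to a fixed T. The predicate records that hyperplanes have models of codimension 1 in
  T.\<close>

lemma flat_arrangement_RP:
  fixes \<iota> :: "real^'m \<Rightarrow> real^'n^'n" and I :: "(real^'n) set set"
  assumes \<iota>: "diffeo X RP \<iota>" and I: "\<And>V. V \<in> I \<Longrightarrow> subspace V" "\<And>V V'. V \<in> I \<Longrightarrow> V' \<in> I \<Longrightarrow> V \<inter> V' \<in> I"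
  obtains T where "flat_arrangement T (\<lambda>V S. dim V + 1 = CARD('n) \<longrightarrow> dim S + 1 = dim T) I
    (\<lambda>V. X \<inter> \<iota> -` projectivization V) X"
proof -
  note s\<iota> = diffeo_smooth_map[OF \<iota>]
  define D where "D e = {A \<in> RP. e \<bullet> (A *v e) \<noteq> 0}" for e :: "real^'n"
  define K where "K e = {y. y \<bullet> e = 0}" for e :: "real^'n"
  have sK: "subspace (K e)" for e using subspace_orth[OF subspace_UNIV, of e] by (simp add: K_def)
  have dK: "dim (K e) + 1 = CARD('n)" if "e \<bullet> e = 1" for e :: "real^'n"
    using dim_orthogonal_to_vector[OF subspace_UNIV UNIV_I that] by (simp add: K_def)
  have chart: "openin (top_of_set X) (X \<inter> \<iota> -` D e) \<and> diffeo (X \<inter> \<iota> -` D e) (K e) (\<lambda>x. affine_chart e (\<iota> x))"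
    if e: "e \<bullet> e = 1" for e
  proof
    have "open {A::real^'n^'n. e \<bullet> (A *v e) \<noteq> 0}"
    proof (rule open_Collect_neq[OF _ continuous_on_const])
      show "continuous_on UNIV (\<lambda>A::real^'n^'n. e \<bullet> (A *v e))"
        by (rule smooth_on_imp_continuous)
          (intro smooth_on_inner smooth_on_matrix_vector_mult smooth_on_ident smooth_on_const open_UNIV)
    qed
    then have "openin (top_of_set X) (X \<inter> \<iota> -` {A. e \<bullet> (A *v e) \<noteq> 0})"
      by (rule continuous_openin_preimage_gen[OF smooth_map_continuous_on[OF s\<iota>]])
    moreover have "X \<inter> \<iota> -` {A. e \<bullet> (A *v e) \<noteq> 0} = X \<inter> \<iota> -` D e"
      using smooth_map_image[OF s\<iota>] by (auto simp: D_def)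
    ultimately show "openin (top_of_set X) (X \<inter> \<iota> -` D e)" by simp
    have "\<iota> ` (X \<inter> \<iota> -` D e) = \<iota> ` X \<inter> D e" by auto
    then have "\<iota> ` (X \<inter> \<iota> -` D e) = D e" using diffeo_image[OF \<iota>] by (auto simp: D_def)
    then have "diffeo (X \<inter> \<iota> -` D e) (D e) \<iota>" using diffeo_restrict[OF \<iota>, of "X \<inter> \<iota> -` D e"] by simp
    then show "diffeo (X \<inter> \<iota> -` D e) (K e) (\<lambda>x. affine_chart e (\<iota> x))"
      using diffeo_affine_chart[OF e] unfolding D_def K_def by (rule diffeo_compose)
  qed
  \<comment> \<open>Any one chart is enough to see that the ambient space of X has dimension at
    least n - 1, so that a suitable T exists.\<close>
  have "(axis undefined 1 :: real^'n) \<bullet> axis undefined 1 = 1" by (simp add: inner_axis_axis)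
  then obtain e0 :: "real^'n" where e0: "e0 \<bullet> e0 = 1" by blast
  have K0: "0 \<in> K e0" by (simp add: K_def)
  have "dim (K e0) \<le> DIM(real^'m)"
    by (rule diffeo_dim_le[OF sK openin_subtopology_self K0 chart[OF e0, THEN conjunct2]])
  then have "CARD('n) - 1 \<le> dim (UNIV :: (real^'m) set)" using dK[OF e0] by simp
  then obtain T :: "(real^'m) set" where T: "subspace T" "dim T = CARD('n) - 1"
    using choose_subspace_of_subspace by metis
  have cl: "closedin (top_of_set X) (X \<inter> \<iota> -` projectivization V)" if "V \<in> I" for V
    by (rule continuous_closedin_preimage_gen[OF smooth_map_continuous_on[OF s\<iota>] _ closedin_projectivization[OF I(1)[OF that]]])
      (use smooth_map_image[OF s\<iota>] in auto)
  have meet: "(X \<inter> \<iota> -` projectivization V) \<inter> (X \<inter> \<iota> -` projectivization V') = X \<inter> \<iota> -` projectivization (V \<inter> V')"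
    if "V \<in> I" "V' \<in> I" for V V'
    using projectivization_Int[OF I(1)[OF that(1)] I(1)[OF that(2)]] by auto
  have flat: "flat_at T (\<lambda>V S. dim V + 1 = CARD('n) \<longrightarrow> dim S + 1 = dim T) I (\<lambda>V. X \<inter> \<iota> -` projectivization V) X x"
    if x: "x \<in> X" for x
  proof -
    obtain e where e: "e \<bullet> e = 1" "\<iota> x = proj_point e"
      by (rule projectivization_unit[OF subspace_UNIV smooth_map_image[OF s\<iota> x]], rule that)
    have e0: "e \<noteq> 0" using e(1) by auto
    have dKT: "dim (K e) = dim T" using dK[OF e(1)] T(2) by simp
    \<comment> \<open>Linear isometries between the complement of e and T; being linear, they keep
      the models of the members linear.\<close>
    obtain f g where fg: "linear f" "linear g" "f ` K e = T" "g ` T = K e"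
      "\<And>y. y \<in> K e \<Longrightarrow> g (f y) = y" "\<And>t. t \<in> T \<Longrightarrow> f (g t) = t"
      by (rule isometries_subspaces[OF sK T(1) dKT], rule that)
    have df: "diffeo (K e) T f"
      by (rule diffeoI[where g = g]; (rule smooth_mapI_smooth_on[OF smooth_on_linear[OF open_UNIV]])?)
        (use fg in \<open>auto simp: linear_conv_bounded_linear\<close>)
    note c = chart[OF e(1)]
    have dphi: "diffeo (X \<inter> \<iota> -` D e) T (\<lambda>x. f (affine_chart e (\<iota> x)))"
      by (rule diffeo_compose[OF c[THEN conjunct2] df])
    show ?thesis
    proof (rule flat_atI[OF c[THEN conjunct1] _ _ dphi])
      show "x \<in> X \<inter> \<iota> -` D e"
        using x e smooth_map_image[OF s\<iota> x] by (simp add: D_def proj_point_mult)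
      show "openin (top_of_set T) T" by simp
      fix V assume V: "V \<in> I" "x \<in> X \<inter> \<iota> -` projectivization V"
      note sV = I(1)[OF V(1)]
      have eV: "e \<in> V" using V(2) e(2) proj_point_in_projectivization[OF sV e0] by simp
      define S where "S = f ` {y \<in> V. y \<bullet> e = 0}"
      have sub: "{y \<in> V. y \<bullet> e = 0} \<subseteq> K e" by (auto simp: K_def)
      have sS: "subspace S" unfolding S_def by (rule linear_subspace_image[OF fg(1) subspace_orth[OF sV]])
      have ST: "S \<subseteq> T" unfolding S_def using fg(3) sub by auto
      have injK: "inj_on f (K e)" using fg(5) by (rule inj_on_inverseI)
      have sp: "span {y \<in> V. y \<bullet> e = 0} = {y \<in> V. y \<bullet> e = 0}"
        using subspace_orth[OF sV, of e] by (simp add: span_eq_iff)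
      have "inj_on f (span {y \<in> V. y \<bullet> e = 0})"
        unfolding sp by (rule inj_on_subset[OF injK sub])
      then have "dim S = dim {y \<in> V. y \<bullet> e = 0}" unfolding S_def by (rule dim_image_eq[OF fg(1)])
      then have dS: "dim S + 1 = dim V" using dim_orthogonal_to_vector[OF sV eV e(1)] by simp
      have ch: "affine_chart e A \<in> K e" if "A \<in> D e" for A
        using smooth_map_image[OF diffeo_smooth_map[OF diffeo_affine_chart[OF e(1)]], of A] that by (simp add: D_def K_def)
      have "(\<lambda>x. f (affine_chart e (\<iota> x))) ` ((X \<inter> \<iota> -` D e) \<inter> (X \<inter> \<iota> -` projectivization V)) = T \<inter> S"
      proof (intro equalityI subsetI)
        fix t assume "t \<in> (\<lambda>x. f (affine_chart e (\<iota> x))) ` ((X \<inter> \<iota> -` D e) \<inter> (X \<inter> \<iota> -` projectivization V))"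
        then obtain x' where x': "t = f (affine_chart e (\<iota> x'))" "\<iota> x' \<in> D e" "\<iota> x' \<in> projectivization V" by auto
        have "affine_chart e (\<iota> x') \<in> V"
          using affine_chart_mem_iff[OF sV eV, of "\<iota> x'"] x' by (simp add: D_def)
        then have "t \<in> S" unfolding S_def x'(1) using ch[OF x'(2)] by (auto simp: K_def)
        then show "t \<in> T \<inter> S" using ST by auto
      next
        fix t assume t: "t \<in> T \<inter> S"
        then have "t \<in> (\<lambda>x. f (affine_chart e (\<iota> x))) ` (X \<inter> \<iota> -` D e)" using diffeo_image[OF dphi] by simp
        then obtain x' where x': "x' \<in> X" "\<iota> x' \<in> D e" "t = f (affine_chart e (\<iota> x'))" by auto
        obtain y where y: "y \<in> V" "y \<in> K e" "t = f y" using t sub by (auto simp: S_def)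
        have "affine_chart e (\<iota> x') = y" using fg(5)[OF ch[OF x'(2)]] fg(5)[OF y(2)] x'(3) y(3) by simp
        then have "\<iota> x' \<in> projectivization V"
          using affine_chart_mem_iff[OF sV eV, of "\<iota> x'"] x'(2) y(1) by (simp add: D_def)
        then show "t \<in> (\<lambda>x. f (affine_chart e (\<iota> x))) ` ((X \<inter> \<iota> -` D e) \<inter> (X \<inter> \<iota> -` projectivization V))"
          using x' by blast
      qed
      then show "\<exists>S. subspace S \<and> S \<subseteq> T \<and> (dim V + 1 = CARD('n) \<longrightarrow> dim S + 1 = dim T) \<and>
          (\<lambda>x. f (affine_chart e (\<iota> x))) ` ((X \<inter> \<iota> -` D e) \<inter> (X \<inter> \<iota> -` projectivization V)) = T \<inter> S"
        using sS ST dS T(2) by (intro exI[of _ S]) auto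
    qed
  qed
  show ?thesis
    by (rule that[of T]) (unfold flat_arrangement_def, use T(1) cl meet flat I(2) in simp)
qed

text \<open>If a meets a later member i in a different listed member, that one comes after a and has
  at least the dimension of a. As a subspace of a it must then be a itself.\<close>

lemma center_order_sorted:
  assumes "distinct L" "\<And>V. V \<in> set L \<Longrightarrow> subspace V" "sorted_wrt (\<lambda>V V'. dim V \<le> dim V') L"
  shows "center_order (L :: 'a::euclidean_space set list)"
  using assms
proof (induction L)
  case (Cons a L)
  have "a \<subseteq> i" if i: "i \<in> set L" "a \<inter> i \<in> insert a (set L)" for i
  proof (cases "a \<inter> i = a")
    case False
    then have "dim a \<le> dim (a \<inter> i)" using i Cons.prems(3) by auto
    then have "a \<inter> i = a"
      using Cons.prems(2) i(1) by (intro subspace_dim_equal) (auto intro: subspace_inter)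
    then show ?thesis by auto
  qed auto
  then show ?case using Cons by auto
qed simp

text \<open>A left inverse of \<open>projectivization\<close> on subspaces. It turns a given list of
  strata in projective space into a list of subspaces, which serve as indices of the
  arrangement.\<close>

definition line_cone :: "(real^'n^'n) set \<Rightarrow> (real^'n) set" where
  "line_cone S = {v. v = 0 \<or> proj_point v \<in> S}"

lemma line_cone_projectivization:
  assumes "subspace V"
  shows "line_cone (projectivization V) = V"
proof -
  have "v \<in> line_cone (projectivization V) \<longleftrightarrow> v \<in> V" for v
    using proj_point_in_projectivization[OF assms, of v] subspace_0[OF assms]
    by (cases "v = 0") (simp_all add: line_cone_def)
  then show ?thesis by blast
qed

section \<open>Ordered lists of braid spaces and comparison of the two models\<close>

definition proper_braid_spaces :: "(real^'n) set set" where
  "proper_braid_spaces = {braid_space \<pi> | \<pi>. partition_on UNIV \<pi>} - {UNIV}"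

text \<open>Every braid space contains the all-ones vector and is therefore non-zero. The bound dim
  V \<ge> 1 ensures that the truncated subtraction in \<open>dim V - 1\<close> preserves the order
  of dimensions.\<close>

lemma proper_braid_spaceD:
  fixes V :: "(real^'n) set"
  assumes "V \<in> proper_braid_spaces"
  shows "subspace V" "V \<noteq> {0}" "dim V \<ge> 1" "dim V < CARD('n)" "mdim (projectivization V) = dim V - 1"
proof -
  obtain \<pi> where \<pi>: "V = braid_space \<pi>" "V \<noteq> UNIV" using assms by (auto simp: proper_braid_spaces_def)
  show V: "subspace V" unfolding \<pi>(1) by (rule subspace_braid_space)
  have one: "(1 :: real^'n) \<in> V" unfolding \<pi>(1) by (simp add: braid_space_iff)
  moreover have one0: "(1 :: real^'n) \<noteq> 0" by (simp add: vec_eq_iff)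
  ultimately show ne: "V \<noteq> {0}" by auto
  have "\<not> V \<subseteq> {0}" using one one0 by blast
  then have "dim V \<noteq> 0" by simp
  then show "dim V \<ge> 1" by linarith
  have "span V = V" using V by (simp add: span_eq_iff)
  then have "dim V \<noteq> DIM(real^'n)" using \<pi>(2) dim_eq_full[of V] by metis
  then show "dim V < CARD('n)" using dim_subset_UNIV[of V] by simp
  show "mdim (projectivization V) = dim V - 1" by (rule mdim_projectivization[OF V ne])
qed

lemma proper_braid_spaces_Int:
  fixes V :: "(real^'n) set"
  assumes "V \<in> proper_braid_spaces" "V' \<in> proper_braid_spaces"
  shows "V \<inter> V' \<in> proper_braid_spaces"
proof -
  obtain \<pi> where "partition_on UNIV \<pi>" "\<Inter>{V, V'} = braid_space \<pi>"
    by (rule braid_space_Inter[of "{V, V'}"]) (use assms in \<open>auto simp: proper_braid_spaces_def\<close>)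
  then show ?thesis using assms by (auto simp: proper_braid_spaces_def)
qed

lemma finite_proper_braid_spaces: "finite (proper_braid_spaces :: (real^'n) set set)"
proof -
  have "proper_braid_spaces \<subseteq> (range braid_space :: (real^'n) set set)" by (auto simp: proper_braid_spaces_def)
  then show ?thesis by (rule finite_subset) simp
qed

lemma projective_braid_spaces_eq:
  "projective_braid_spaces - {RP :: (real^'n^'n) set} = projectivization ` proper_braid_spaces"
proof (intro equalityI subsetI)
  fix S :: "(real^'n^'n) set" assume "S \<in> projective_braid_spaces - {RP}"
  then show "S \<in> projectivization ` proper_braid_spaces"
    unfolding projective_braid_spaces_def proper_braid_spaces_def by auto
next
  fix S :: "(real^'n^'n) set" assume "S \<in> projectivization ` proper_braid_spaces"
  then obtain V where V: "V \<in> proper_braid_spaces" "S = projectivization V" by auto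
  have "S \<noteq> RP"
  proof
    assume "S = RP"
    then have "V = UNIV" using projectivization_inject[OF proper_braid_spaceD(1)[OF V(1)] subspace_UNIV] V(2) by simp
    then show False using V(1) by (simp add: proper_braid_spaces_def)
  qed
  then show "S \<in> projective_braid_spaces - {RP}"
    using V by (auto simp: proper_braid_spaces_def projective_braid_spaces_def)
qed

lemma rank2_truncation_eq:
  "(rank2_truncation :: (real^'n^'n) set set) = projectivization ` {V \<in> proper_braid_spaces. dim V + 1 < CARD('n)}"
proof -
  have "CARD('n) - dim V \<ge> 2 \<longleftrightarrow> V \<noteq> UNIV \<and> dim V + 1 < CARD('n)" for V :: "(real^'n) set" by auto
  then show ?thesis unfolding rank2_truncation_def proper_braid_spaces_def by auto
qed

lemma sorted_wrt_split:
  fixes f :: "'a \<Rightarrow> 'b::linorder"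
  assumes "sorted_wrt (\<lambda>x y. f x \<le> f y) xs"
  shows "xs = filter (\<lambda>x. f x < c) xs @ filter (\<lambda>x. \<not> f x < c) xs"
  using assms
proof (induction xs)
  case (Cons x xs)
  show ?case
  proof (cases "f x < c")
    case False
    then have "\<forall>y\<in>set xs. \<not> f y < c" using Cons.prems by auto
    then show ?thesis using False by (simp add: filter_empty_conv filter_id_conv)
  qed (use Cons in simp)
qed simp

lemma sorted_wrt_const:
  fixes f :: "'a \<Rightarrow> 'b::order"
  assumes "\<And>x. x \<in> set xs \<Longrightarrow> f x = c"
  shows "sorted_wrt (\<lambda>x y. f x \<le> f y) xs"
  using assms by (induction xs) auto

lemma map_projectivization_line_cone:
  assumes "set Zs = projectivization ` I" "\<And>V. V \<in> I \<Longrightarrow> subspace V"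
  shows "map projectivization (map line_cone Zs) = Zs" "set (map line_cone Zs) = I"
proof -
  have c: "line_cone (projectivization V) = V" if "V \<in> I" for V
    by (rule line_cone_projectivization[OF assms(2)[OF that]])
  have "projectivization (line_cone S) = S" if S: "S \<in> set Zs" for S
  proof -
    obtain V where V: "V \<in> I" "S = projectivization V" using S assms(1) by auto
    show ?thesis unfolding V(2) c[OF V(1)] ..
  qed
  then show "map projectivization (map line_cone Zs) = Zs" by (simp add: map_idI)
  have "set (map line_cone Zs) = (\<lambda>V. line_cone (projectivization V)) ` I"
    by (simp only: set_map assms(1) image_image)
  also have "\<dots> = (\<lambda>V. V) ` I" by (rule image_cong[OF refl c])
  finally show "set (map line_cone Zs) = I" by (simp only: image_ident)
qed

lemma inj_on_projectivization: "inj_on projectivization (proper_braid_spaces :: (real^'n) set set)"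
  by (rule inj_onI) (use projectivization_inject proper_braid_spaceD(1) in blast)

lemma sorted_wrt_mdim_iff:
  fixes L :: "(real^'n) set list"
  assumes "set L \<subseteq> proper_braid_spaces"
  shows "sorted_wrt (\<lambda>S T. mdim S \<le> mdim T) (map projectivization L) \<longleftrightarrow> sorted_wrt (\<lambda>V V'. dim V \<le> dim V') L"
proof -
  have iff: "mdim (projectivization V) \<le> mdim (projectivization V') \<longleftrightarrow> dim V \<le> dim V'"
    if "V \<in> set L" "V' \<in> set L" for V V'
  proof -
    have "V \<in> proper_braid_spaces" "V' \<in> proper_braid_spaces" using that assms by blast+
    from proper_braid_spaceD(3,5)[OF this(1)] proper_braid_spaceD(3,5)[OF this(2)] show ?thesis by linarith
  qed
  show ?thesis unfolding sorted_wrt_map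
  proof
    show "sorted_wrt (\<lambda>V V'. dim V \<le> dim V') L"
      if "sorted_wrt (\<lambda>V V'. mdim (projectivization V) \<le> mdim (projectivization V')) L"
      by (rule sorted_wrt_mono_rel[OF _ that]) (simp add: iff)
    show "sorted_wrt (\<lambda>V V'. mdim (projectivization V) \<le> mdim (projectivization V')) L"
      if "sorted_wrt (\<lambda>V V'. dim V \<le> dim V') L"
      by (rule sorted_wrt_mono_rel[OF _ that]) (simp add: iff)
  qed
qed

text \<open>From left to right the hyperplanes are appended to the list and blown up by the
  identity. From right to left they are cut off the end of the list, and the diffeomorphism by which
  the two blown-up spaces differ has to be absorbed.\<close>

lemma maximal_wonderful_model_rank2_iff:
  fixes Y :: "(real^'m) set" and p :: "real^'m \<Rightarrow> real^'n^'n"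
  shows "maximal_wonderful_model RP rank2_truncation Y p \<longleftrightarrow>
    maximal_wonderful_model RP (projective_braid_spaces - {RP}) Y p"
proof
  define I where "I = (proper_braid_spaces :: (real^'n) set set)"
  define A where "A = {V \<in> I. dim V + 1 < CARD('n)}"
  define Hs where "Hs = I - A"
  have rank2: "rank2_truncation = projectivization ` A" and all: "projective_braid_spaces - {RP} = projectivization ` I"
    unfolding A_def I_def by (rule rank2_truncation_eq, rule projective_braid_spaces_eq)
  have sub: "subspace V" if "V \<in> I" for V using that proper_braid_spaceD(1) by (simp add: I_def)
  have AI: "A \<subseteq> I" by (auto simp: A_def)
  have dimH: "dim V + 1 = CARD('n)" if "V \<in> Hs" for V
    using that proper_braid_spaceD(4)[of V] by (auto simp: Hs_def A_def I_def)
  define Z where "Z X \<iota> V = X \<inter> \<iota> -` projectivization V" for X :: "(real^'m) set" and \<iota> and V :: "(real^'n) set"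
  have mapZ: "map (\<lambda>S. X \<inter> \<iota> -` S) (map projectivization L) = map (Z X \<iota>) L"
    for X :: "(real^'m) set" and \<iota> and L :: "(real^'n) set list" by (simp add: Z_def)
  have arr: "\<exists>T. flat_arrangement T (\<lambda>V S. dim V + 1 = CARD('n) \<longrightarrow> dim S + 1 = dim T) I (Z X \<iota>) X"
    if "diffeo X RP \<iota>" for X :: "(real^'m) set" and \<iota>
    by (rule flat_arrangement_RP[OF that, of I]) (use sub proper_braid_spaces_Int in \<open>auto simp: I_def Z_def[abs_def]\<close>)
  {
    assume "maximal_wonderful_model RP rank2_truncation Y p"
    then obtain Zs X \<iota> b where m: "set Zs = rank2_truncation" "distinct Zs" "sorted_wrt (\<lambda>S T. mdim S \<le> mdim T) Zs"
      "diffeo X RP \<iota>" "iterated_blowup X (map (\<lambda>S. X \<inter> \<iota> -` S) Zs) Y b" "\<forall>y\<in>Y. p y = \<iota> (b y)"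
      unfolding maximal_wonderful_model_def by (elim exE conjE) (rule that)
    define as where "as = map line_cone Zs"
    have as: "map projectivization as = Zs" "set as = A"
      using map_projectivization_line_cone[OF m(1)[unfolded rank2]] sub AI unfolding as_def by blast+
    have "finite Hs" unfolding Hs_def I_def by (rule finite_Diff[OF finite_proper_braid_spaces])
    then obtain hs where hs: "set hs = Hs" "distinct hs" using finite_distinct_list by blast
    \<comment> \<open>Hyperplanes have the largest dimension among proper braid spaces, so appending
      them keeps the list sorted.\<close>
    let ?L = "as @ hs"
    have setL: "set ?L = I" using as(2) hs(1) AI by (auto simp: Hs_def)
    have "distinct as" using m(2) unfolding as(1)[symmetric] distinct_map by (rule conjunct1)
    then have distL: "distinct ?L" using hs as(2) by (auto simp: Hs_def)
    have "sorted_wrt (\<lambda>V V'. dim V \<le> dim V') as"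
      using m(3) sorted_wrt_mdim_iff[of as] as AI by (simp add: I_def)
    moreover have "sorted_wrt (\<lambda>V V'. dim V \<le> dim V') hs"
      by (rule sorted_wrt_const[where c = "CARD('n) - 1"]) (use dimH hs(1) in force)
    moreover have "dim V \<le> dim V'" if "V \<in> set as" "V' \<in> set hs" for V V'
      using that as(2) hs(1) dimH[of V'] by (auto simp: A_def)
    ultimately have sortL: "sorted_wrt (\<lambda>V V'. dim V \<le> dim V') ?L" by (auto simp: sorted_wrt_append)
    have co: "center_order ?L" by (rule center_order_sorted[OF distL _ sortL]) (use sub setL in auto)
    obtain T where T: "flat_arrangement T (\<lambda>V S. dim V + 1 = CARD('n) \<longrightarrow> dim S + 1 = dim T) I (Z X \<iota>) X"
      using arr[OF m(4)] by blast
    have "iterated_blowup X (map (Z X \<iota>) as) Y b" using m(5) unfolding as(1)[symmetric] mapZ .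
    then have it: "iterated_blowup X (map (Z X \<iota>) ?L) Y b"
      by (rule iterated_blowup_append_hypersurfaces[OF T[folded setL] co, rotated]) (use dimH hs(1) in auto)
    show "maximal_wonderful_model RP (projective_braid_spaces - {RP}) Y p"
      unfolding maximal_wonderful_model_def
    proof (intro exI conjI)
      show "set (map projectivization ?L) = projective_braid_spaces - {RP}" unfolding all setL[symmetric] by (rule set_map)
      show "distinct (map projectivization ?L)"
        unfolding distinct_map setL using distL inj_on_projectivization by (simp add: I_def)
      show "sorted_wrt (\<lambda>S T. mdim S \<le> mdim T) (map projectivization ?L)"
        by (rule sorted_wrt_mdim_iff[THEN iffD2, OF _ sortL]) (simp only: setL I_def order_refl)
      show "iterated_blowup X (map (\<lambda>S. X \<inter> \<iota> -` S) (map projectivization ?L)) Y b" unfolding mapZ by (rule it)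
    qed (rule m(4), rule m(6))
  }
  {
    assume "maximal_wonderful_model RP (projective_braid_spaces - {RP}) Y p"
    then obtain Zs X \<iota> b where m: "set Zs = projective_braid_spaces - {RP}" "distinct Zs" "sorted_wrt (\<lambda>S T. mdim S \<le> mdim T) Zs"
      "diffeo X RP \<iota>" "iterated_blowup X (map (\<lambda>S. X \<inter> \<iota> -` S) Zs) Y b" "\<forall>y\<in>Y. p y = \<iota> (b y)"
      unfolding maximal_wonderful_model_def by (elim exE conjE) (rule that)
    define L where "L = map line_cone Zs"
    have L: "map projectivization L = Zs" "set L = I"
      using map_projectivization_line_cone[OF m(1)[unfolded all]] sub unfolding L_def by blast+
    have distL: "distinct L" using m(2) unfolding L(1)[symmetric] distinct_map by (rule conjunct1)
    have sortL: "sorted_wrt (\<lambda>V V'. dim V \<le> dim V') L"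
      using m(3) sorted_wrt_mdim_iff[of L] L by (simp add: I_def)
    \<comment> \<open>Proper braid spaces have dimension at most n - 1, so the entries not below
      this bound are the hyperplanes, and sortedness makes them a final segment.\<close>
    define as where "as = filter (\<lambda>V. dim V < CARD('n) - 1) L"
    define hs where "hs = filter (\<lambda>V. \<not> dim V < CARD('n) - 1) L"
    have L_split: "L = as @ hs" unfolding as_def hs_def by (rule sorted_wrt_split[OF sortL])
    have setas: "set as = A" and seths: "set hs = Hs" using L(2) by (auto simp: as_def hs_def A_def Hs_def)
    have co: "center_order (as @ hs)"
      unfolding L_split[symmetric] by (rule center_order_sorted[OF distL _ sortL]) (use sub L(2) in auto)
    obtain T where T: "flat_arrangement T (\<lambda>V S. dim V + 1 = CARD('n) \<longrightarrow> dim S + 1 = dim T) I (Z X \<iota>) X"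
      using arr[OF m(4)] by blast
    have it: "iterated_blowup X (map (Z X \<iota>) (as @ hs)) Y b"
      using m(5) unfolding L(1)[symmetric] mapZ L_split[symmetric] .
    have "\<exists>Y1 \<gamma> b1. iterated_blowup X (map (Z X \<iota>) as) Y1 b1 \<and> diffeo Y Y1 \<gamma> \<and> b = b1 \<circ> \<gamma>"
      by (rule iterated_blowup_split_hypersurfaces[OF T[folded L(2), unfolded L_split] co _ it]) (use dimH seths in auto)
    then obtain Y1 \<gamma> b1 where s: "iterated_blowup X (map (Z X \<iota>) as) Y1 b1" "diffeo Y Y1 \<gamma>" "b = b1 \<circ> \<gamma>"
      by (elim exE conjE) (rule that)
    have sortas: "sorted_wrt (\<lambda>S T. mdim S \<le> mdim T) (map projectivization as)"
      using sortL setas AI sorted_wrt_mdim_iff[of as] unfolding L_split by (simp add: sorted_wrt_append I_def)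
    have "distinct as" using distL by (simp add: as_def)
    then have distas: "distinct (map projectivization as)"
      unfolding distinct_map using inj_on_subset[OF inj_on_projectivization] AI setas by (simp add: I_def)
    have setP: "set (map projectivization as) = rank2_truncation" unfolding rank2 setas[symmetric] by (rule set_map)
    show "maximal_wonderful_model RP rank2_truncation Y p"
    proof (cases "as = []")
      case False
      then have "iterated_blowup X (map (Z X \<iota>) as) Y b"
        unfolding s(3) by (intro iterated_blowup_precompose[OF s(1,2)]) simp
      then have "iterated_blowup X (map (\<lambda>S. X \<inter> \<iota> -` S) (map projectivization as)) Y b" unfolding mapZ .
      then show ?thesis
        unfolding maximal_wonderful_model_def using setP distas sortas m(4,6) by blast
    next
      \<comment> \<open>This happens exactly for n \<le> 2, where the line of constant vectors has
        codimension below 2. No blowup is left to absorb \<open>\<gamma>\<close>, so the copy X of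
        projective space is replaced by Y, identified through \<open>\<iota>\<close> after
        \<open>\<gamma>\<close>.\<close>
      case True
      then have e: "Y1 = X" "b1 = id" using iterated_blowup_Nil_cases[of X Y1 b1] s(1) by simp_all
      have d: "diffeo Y RP (\<lambda>y. \<iota> (\<gamma> y))" by (rule diffeo_compose[OF s(2)[unfolded e] m(4)])
      show ?thesis
        unfolding maximal_wonderful_model_def
      proof (intro exI conjI)
        show "set (map projectivization as) = rank2_truncation" by (rule setP)
        show "iterated_blowup Y (map (\<lambda>S. Y \<inter> (\<lambda>y. \<iota> (\<gamma> y)) -` S) (map projectivization as)) Y id"
          unfolding True list.map by (rule iterated_blowup.Nil)
        show "\<forall>y\<in>Y. p y = \<iota> (\<gamma> (id y))" using m(6) unfolding s(3) e by simp
      qed (rule distas sortas d)+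
    qed
  }
qed

theorem theorem4p3:
  "strata (RP :: (real^'n^'n) set) (L_stratification Sym RP_action RP) = rank2_truncation \<and>
   (\<forall>(Y :: (real^'m) set) (p :: real^'m \<Rightarrow> real^'n^'n).
      digitalization Sym RP_action RP Y p \<longleftrightarrow> maximal_projective_braid_model Y p)"
  unfolding digitalization_def maximal_projective_braid_model_def strata_L_stratification_RP
  using maximal_wonderful_model_rank2_iff by blast

end
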